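(* Let $\nu>0$, $f\in C(\mathbb{R})$ and $u_0\in H^1_0(\Omega)$. Suppose $u=u(x,t)$ is a weak solution on $[0,T]$, for some $T>0$, of the problem $$u_t-\nu\Delta u+f(u)u=0 \ \text{ in } \Omega\times(0,T),\qquad u|_{\partial\Omega}=0,\qquad u(\cdot,0)=u_0 .$$ Let $\xi\in C([0,T];\Omega)$ be the mean value path of $f$ through $u$, i.e. a function such that for all $t\in[0,T]$ $$\int_\Omega f(u(x,t))\,u^2(x,t)\,dx=f(u(\xi(t),t))\int_\Omega u^2(x,t)\,dx .$$ Then, for all $t\in[0,T]$, $$\|u(t)\|\le \exp\left[-\int_0^t f(u(\xi(\tau),\tau))\,d\tau\right]\|u_0\| .$$
   Context: $\Omega\subset\mathbb{R}^N$ is a bounded domain (open and connected) with sufficiently smooth boundary $\partial\Omega$; $\|\cdot\|$ and $\langle\cdot,\cdot\rangle$ are the norm and inner product (or duality pairing) of $L^2(\Omega)$. $H^{-1}(\Omega)$ denotes the dual of $H^1(\Omega)$. A weak solution on $[0,T]$ is a function $u\in L^\infty(0,T;L^2(\Omega))\cap L^2(0,T;H^1_0(\Omega))$ with $\partial_t u\in L^2(0,T;H^{-1}(\Omega))$ such that for all $\varphi\in H^1_0(\Omega)$ and almost all $t\in[0,T]$, $\langle u_t,\varphi\rangle+\nu\langle\nabla u,\nabla\varphi\rangle+\langle f(u)u,\varphi\rangle=0$, and $u(0)=u_0$. Such $u$ lies in $C([0,T];L^2(\Omega))$. Existence of a mean value path $\xi\in C([0,T];\Omega)$ is asserted in the paper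 for every $u\in C([0,T];L^2(\Omega))$ and $f\in C(\mathbb{R})$. It is understood that $u(\xi(t),t)$ is a real number for each $t\in[0,T]$.
   Formalization: The bound at time t is stated when the integral of f(u(ξ(τ),τ)) over [0,t] exists; existence is proved if u does not vanish in L² on [0,t]. Where u(τ)=0 the mean value identity leaves f(u(ξ(τ),τ)) undetermined, so the integral may be undefined. *)

theory Defs
  imports "HOL-Analysis.Analysis"
begin

text \<open>
  Elements of function spaces over \<open>\<Omega>\<close> are represented by functions on the whole space; only their
  values on \<open>\<Omega>\<close> matter, and equality of elements is equality almost everywhere on \<open>\<Omega>\<close>. Spaces are
  sets of such representatives, equipped with an explicit (semi)norm. A difference \<open>u - v\<close> of
  functions is the pointwise one.
\<close>

subsection \<open>Differentiability classes, domains and test functions\<close>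

fun Ck :: "nat \<Rightarrow> ('a::euclidean_space \<Rightarrow> real) \<Rightarrow> bool" where
  "Ck 0 f \<longleftrightarrow> continuous_on UNIV f"
| "Ck (Suc k) f \<longleftrightarrow> (\<forall>x. f differentiable (at x)) \<and>
     (\<forall>i\<in>Basis. Ck k (\<lambda>x. frechet_derivative f (at x) i))"

text \<open>
  Boundary of class \<open>C\<^sup>k\<close>: near each boundary point, \<open>\<Omega>\<close> is the region above the graph of a \<open>C\<^sup>k\<close>
  function over the hyperplane orthogonal to some unit vector \<open>e\<close>.
\<close>

definition Ck_boundary :: "nat \<Rightarrow> 'a::euclidean_space set \<Rightarrow> bool" where
  "Ck_boundary k \<Omega> \<longleftrightarrow>
     (\<forall>z\<in>frontier \<Omega>. \<exists>r>0. \<exists>e \<gamma>. norm e = 1 \<and> Ck k \<gamma> \<and>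
        \<Omega> \<inter> ball z r = {x \<in> ball z r. x \<bullet> e > \<gamma> (x - (x \<bullet> e) *\<^sub>R e)})"

definition test_functions :: "'a::euclidean_space set \<Rightarrow> ('a \<Rightarrow> real) set" where
  "test_functions \<Omega> = {\<phi>. (\<forall>k. Ck k \<phi>) \<and>
     compact (closure {x. \<phi> x \<noteq> 0}) \<and> closure {x. \<phi> x \<noteq> 0} \<subseteq> \<Omega>}"

subsection \<open>Lebesgue and Sobolev spaces on \<open>\<Omega>\<close>\<close>

definition L2 :: "'a::euclidean_space set \<Rightarrow> ('a \<Rightarrow> 'b::euclidean_space) set" where
  "L2 \<Omega> = {v \<in> borel_measurable (lebesgue_on \<Omega>). integrable (lebesgue_on \<Omega>) (\<lambda>x. (norm (v x))\<^sup>2)}"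

definition L2_inner ::
  "'a::euclidean_space set \<Rightarrow> ('a \<Rightarrow> 'b::euclidean_space) \<Rightarrow> ('a \<Rightarrow> 'b) \<Rightarrow> real" where
  "L2_inner \<Omega> v w = (\<integral>x. v x \<bullet> w x \<partial>lebesgue_on \<Omega>)"

definition L2_norm :: "'a::euclidean_space set \<Rightarrow> ('a \<Rightarrow> 'b::euclidean_space) \<Rightarrow> real" where
  "L2_norm \<Omega> v = sqrt (L2_inner \<Omega> v v)"

definition has_weak_grad ::
  "'a::euclidean_space set \<Rightarrow> ('a \<Rightarrow> real) \<Rightarrow> ('a \<Rightarrow> 'a) \<Rightarrow> bool" where
  "has_weak_grad \<Omega> v g \<longleftrightarrow>
     (\<forall>\<phi>\<in>test_functions \<Omega>. \<forall>i\<in>Basis.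
        (\<integral>x. v x * frechet_derivative \<phi> (at x) i \<partial>lebesgue_on \<Omega>)
          = - (\<integral>x. (g x \<bullet> i) * \<phi> x \<partial>lebesgue_on \<Omega>))"

definition H1 :: "'a::euclidean_space set \<Rightarrow> ('a \<Rightarrow> real) set" where
  "H1 \<Omega> = {v \<in> L2 \<Omega>. \<exists>g\<in>L2 \<Omega>. has_weak_grad \<Omega> v g}"

definition wgrad :: "'a::euclidean_space set \<Rightarrow> ('a \<Rightarrow> real) \<Rightarrow> ('a \<Rightarrow> 'a)" where
  "wgrad \<Omega> v = (SOME g. g \<in> L2 \<Omega> \<and> has_weak_grad \<Omega> v g)"

definition H1_norm :: "'a::euclidean_space set \<Rightarrow> ('a \<Rightarrow> real) \<Rightarrow> real" where
  "H1_norm \<Omega> v = sqrt ((L2_norm \<Omega> v)\<^sup>2 + (L2_norm \<Omega> (wgrad \<Omega> v))\<^sup>2)"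

definition H10 :: "'a::euclidean_space set \<Rightarrow> ('a \<Rightarrow> real) set" where
  "H10 \<Omega> = {v \<in> H1 \<Omega>. \<exists>\<phi>::nat \<Rightarrow> 'a \<Rightarrow> real.
     (\<forall>n. \<phi> n \<in> test_functions \<Omega>) \<and> (\<lambda>n. H1_norm \<Omega> (v - \<phi> n)) \<longlonglongrightarrow> 0}"

text \<open>
  The dual of \<open>H\<^sup>1(\<Omega>)\<close>. Boundedness makes a functional independent of the choice of representatives.
\<close>

definition Hm1 :: "'a::euclidean_space set \<Rightarrow> (('a \<Rightarrow> real) \<Rightarrow> real) set" where
  "Hm1 \<Omega> = {l.
     (\<forall>v\<in>H1 \<Omega>. \<forall>w\<in>H1 \<Omega>. l (\<lambda>x. v x + w x) = l v + l w) \<and>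
     (\<forall>c. \<forall>v\<in>H1 \<Omega>. l (\<lambda>x. c * v x) = c * l v) \<and>
     (\<exists>C. \<forall>v\<in>H1 \<Omega>. \<bar>l v\<bar> \<le> C * H1_norm \<Omega> v)}"

definition Hm1_norm :: "'a::euclidean_space set \<Rightarrow> (('a \<Rightarrow> real) \<Rightarrow> real) \<Rightarrow> real" where
  "Hm1_norm \<Omega> l = (SUP v\<in>{v \<in> H1 \<Omega>. H1_norm \<Omega> v \<le> 1}. \<bar>l v\<bar>)"

subsection \<open>Spaces of functions of time with values in a normed space \<open>(V, N)\<close>\<close>

text \<open>Strong measurability: almost everywhere limit of simple functions with values in \<open>V\<close>.\<close>

definition strongly_measurable ::
  "real \<Rightarrow> 'v::minus set \<Rightarrow> ('v \<Rightarrow> real) \<Rightarrow> (real \<Rightarrow> 'v) \<Rightarrow> bool" where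
  "strongly_measurable T V N u \<longleftrightarrow>
     (AE t in lebesgue_on {0..T}. u t \<in> V) \<and>
     (\<exists>s::nat \<Rightarrow> real \<Rightarrow> 'v.
        (\<forall>n. simple_function (lebesgue_on {0..T}) (s n) \<and> s n ` {0..T} \<subseteq> V) \<and>
        (AE t in lebesgue_on {0..T}. (\<lambda>n. N (s n t - u t)) \<longlonglongrightarrow> 0))"

definition L2_time ::
  "real \<Rightarrow> 'v::minus set \<Rightarrow> ('v \<Rightarrow> real) \<Rightarrow> (real \<Rightarrow> 'v) set" where
  "L2_time T V N =
     {u. strongly_measurable T V N u \<and> integrable (lebesgue_on {0..T}) (\<lambda>t. (N (u t))\<^sup>2)}"

definition Linf_time ::
  "real \<Rightarrow> 'v::minus set \<Rightarrow> ('v \<Rightarrow> real) \<Rightarrow> (real \<Rightarrow> 'v) set" where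
  "Linf_time T V N =
     {u. strongly_measurable T V N u \<and> (\<exists>C. AE t in lebesgue_on {0..T}. N (u t) \<le> C)}"

definition C_time ::
  "real \<Rightarrow> 'v::minus set \<Rightarrow> ('v \<Rightarrow> real) \<Rightarrow> (real \<Rightarrow> 'v) set" where
  "C_time T V N =
     {u. \<forall>t\<in>{0..T}. u t \<in> V \<and> ((\<lambda>s. N (u s - u t)) \<longlongrightarrow> 0) (at t within {0..T})}"

text \<open>
  \<open>w = \<partial>\<^sub>t u\<close> in the sense of distributions on \<open>(0,T)\<close> with values in the dual of \<open>H\<^sup>1(\<Omega>)\<close>, where
  \<open>u t\<close> acts on \<open>H\<^sup>1(\<Omega>)\<close> through the inner product of \<open>L\<^sup>2(\<Omega>)\<close>. The identity between vector-valued
  integrals is expressed by evaluating both sides at every \<open>\<phi>\<close>.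
\<close>

definition has_weak_time_deriv ::
  "'a::euclidean_space set \<Rightarrow> real \<Rightarrow> (real \<Rightarrow> 'a \<Rightarrow> real) \<Rightarrow> (real \<Rightarrow> ('a \<Rightarrow> real) \<Rightarrow> real) \<Rightarrow> bool"
  where
  "has_weak_time_deriv \<Omega> T u w \<longleftrightarrow>
     (\<forall>\<eta>\<in>test_functions {0<..<T}. \<forall>\<phi>\<in>H1 \<Omega>.
        (\<integral>t. L2_inner \<Omega> (u t) \<phi> * deriv \<eta> t \<partial>lebesgue_on {0..T})
          = - (\<integral>t. w t \<phi> * \<eta> t \<partial>lebesgue_on {0..T}))"

subsection \<open>Weak solutions and mean value paths\<close>

text \<open>
  A function \<open>u(x,t)\<close> is written \<open>u t x\<close>. Since \<open>u(t)\<close> and \<open>u(0)\<close> are evaluated at individual times,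
  \<open>u\<close> is taken to be the representative (with respect to \<open>t\<close>) lying in \<open>C([0,T]; L\<^sup>2(\<Omega>))\<close>.
  The integrability clause says that the pairing of \<open>f(u)u\<close> with \<open>\<phi>\<close> is meaningful; without it the
  Bochner integral would default to \<open>0\<close>.
\<close>

definition weak_solution ::
  "'a::euclidean_space set \<Rightarrow> real \<Rightarrow> (real \<Rightarrow> real) \<Rightarrow> ('a \<Rightarrow> real) \<Rightarrow> real
     \<Rightarrow> (real \<Rightarrow> 'a \<Rightarrow> real) \<Rightarrow> bool" where
  "weak_solution \<Omega> \<nu> f u0 T u \<longleftrightarrow>
     u \<in> Linf_time T (L2 \<Omega>) (L2_norm \<Omega>) \<and>
     u \<in> L2_time T (H10 \<Omega>) (H1_norm \<Omega>) \<and>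
     u \<in> C_time T (L2 \<Omega>) (L2_norm \<Omega>) \<and>
     (\<exists>w \<in> L2_time T (Hm1 \<Omega>) (Hm1_norm \<Omega>).
        has_weak_time_deriv \<Omega> T u w \<and>
        (\<forall>\<phi>\<in>H10 \<Omega>. AE t in lebesgue_on {0..T}.
           integrable (lebesgue_on \<Omega>) (\<lambda>x. f (u t x) * u t x * \<phi> x) \<and>
           w t \<phi> + \<nu> * L2_inner \<Omega> (wgrad \<Omega> (u t)) (wgrad \<Omega> \<phi>)
             + L2_inner \<Omega> (\<lambda>x. f (u t x) * u t x) \<phi> = 0)) \<and>
     (AE x in lebesgue_on \<Omega>. u 0 x = u0 x)"

text \<open>
  The integrability clause again says that the left-hand integral is meaningful.
\<close>

definition mean_value_path ::
  "'a::euclidean_space set \<Rightarrow> (real \<Rightarrow> real) \<Rightarrow> real \<Rightarrow> (real \<Rightarrow> 'a \<Rightarrow> real) \<Rightarrow> (real \<Rightarrow> 'a) \<Rightarrow> bool"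
  where
  "mean_value_path \<Omega> f T u \<xi> \<longleftrightarrow>
     continuous_on {0..T} \<xi> \<and> \<xi> ` {0..T} \<subseteq> \<Omega> \<and>
     (\<forall>t\<in>{0..T}.
        integrable (lebesgue_on \<Omega>) (\<lambda>x. f (u t x) * (u t x)\<^sup>2) \<and>
        (\<integral>x. f (u t x) * (u t x)\<^sup>2 \<partial>lebesgue_on \<Omega>)
          = f (u t (\<xi> t)) * (\<integral>x. (u t x)\<^sup>2 \<partial>lebesgue_on \<Omega>))"

end

theory Submission
  imports Defs "HOL-Real_Asymp.Real_Asymp"
begin

text \<open>
  Testing the equation with \<open>u(t)\<close> itself gives
  \<open>(1/2) d/dt \<parallel>u\<parallel>\<^sup>2 = - \<nu> \<parallel>\<nabla>u\<parallel>\<^sup>2 - \<integral> f(u) u\<^sup>2 \<le> - f(u(\<xi>(t),t)) \<parallel>u\<parallel>\<^sup>2\<close>, and Gronwall's inequality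
  concludes. Two steps need care. First, \<open>f(u) u\<close> is only integrable against the test functions and
  against \<open>u\<close>, and the null set of exceptional times depends on the test function. One therefore
  approximates \<open>u(t)\<close> by smooth truncations \<open>2 \<phi> \<psi>\<^sup>2 / (\<phi>\<^sup>2 + \<psi>\<^sup>2 + \<epsilon>)\<close> with \<open>\<phi>\<close>, \<open>\<psi>\<close> from a countable
  set of test functions; they are dominated by \<open>2 |\<phi>|\<close> and by \<open>|\<psi>|\<close>, so dominated convergence applies.
  Second, only an inequality for \<open>\<parallel>u\<parallel>\<^sup>2\<close> is needed, and it follows from
  \<open>\<parallel>u(t)\<parallel>\<^sup>2 - \<parallel>u(s)\<parallel>\<^sup>2 \<le> 2 \<langle>u(t) - u(s), u(t)\<rangle> = 2 \<integral>\<^sub>s\<^sup>t \<langle>u\<^sub>t(\<tau>), u(t)\<rangle> d\<tau>\<close> by summing over a fine partition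
  whose position is chosen such that the sums converge.
\<close>

subsection \<open>Calculus of smooth functions\<close>

text \<open>Replacing \<open>u t\<close> by \<open>u \<tau>\<close> in the pairing with
  \<open>w \<tau>\<close> costs the dual norm of \<open>w \<tau>\<close> times the H^1 distance of
  the two values, and \<open>u\<close> need not be continuous in H^1. Its substitute is a modulus in
  the mean: for close times at which \<open>u\<close> lies in \<open>H10 \<Omega>\<close> the
  squared distance is at most \<open>E t + E \<tau> + \<epsilon>\<close>, where \<open>E\<close> has
  small integral. The value of \<open>E\<close> at one partition point is uncontrolled, but its
  average over all shifts of the partition is an integral of \<open>E\<close>; this is why the
  partition must be moved. Young's inequality with weight \<kappa> separates the dual norm from the
  distance, and \<kappa> is fixed before \<epsilon>. In space, a test function truncated by
  \<open>u t\<close> itself would be dominated at once, but such a truncation varies with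
  \<open>t\<close> and belongs to no countable family. A second test function takes the place of
  \<open>u t\<close>, at the price of a double limit.\<close>

definition partial :: "'a::euclidean_space \<Rightarrow> ('a \<Rightarrow> real) \<Rightarrow> 'a \<Rightarrow> real" where
  "partial i f = (\<lambda>x. frechet_derivative f (at x) i)"

definition cgrad :: "('a::euclidean_space \<Rightarrow> real) \<Rightarrow> 'a \<Rightarrow> 'a" where
  "cgrad f = (\<lambda>x. \<Sum>i\<in>Basis. partial i f x *\<^sub>R i)"

lemma Ck_Suc: "Ck (Suc k) f \<longleftrightarrow> (\<forall>x. f differentiable at x) \<and> (\<forall>i\<in>Basis. Ck k (partial i f))"
  by (simp add: partial_def)

declare Ck.simps(2) [simp del]

lemma partial_eq:
  assumes "\<And>x. (f has_derivative f' x) (at x)"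
  shows "partial i f = (\<lambda>x. f' x i)"
  unfolding partial_def using frechet_derivative_at[OF assms] by metis

lemma differentiable_has_derivative_partial:
  assumes "\<forall>x. f differentiable at x"
  shows "(f has_derivative (\<lambda>h. partial h f x)) (at x)"
  using assms unfolding partial_def by (simp add: frechet_derivative_works)

lemma Ck_continuous: "Ck k f \<Longrightarrow> continuous_on UNIV f"
  by (cases k) (auto simp: Ck_Suc continuous_at_imp_continuous_on differentiable_imp_continuous_within)

lemma Ck_mono: "Ck (Suc k) f \<Longrightarrow> Ck k f"
proof (induction k arbitrary: f)
  case 0 then show ?case using Ck_continuous by simp
next
  case (Suc k) then show ?case using Ck_Suc by metis
qed

lemma Ck_add: "Ck k f \<Longrightarrow> Ck k g \<Longrightarrow> Ck k (\<lambda>x. f x + g x)"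
proof (induction k arbitrary: f g)
  case 0 then show ?case by (simp add: continuous_on_add)
next
  case (Suc k)
  have d: "\<And>x. ((\<lambda>x. f x + g x) has_derivative (\<lambda>h. partial h f x + partial h g x)) (at x)"
    using Suc.prems unfolding Ck_Suc
    by (intro has_derivative_add differentiable_has_derivative_partial) auto
  show ?case unfolding Ck_Suc partial_eq[OF d] using Suc d
    by (auto simp: Ck_Suc differentiable_def)
qed

lemma Ck_mult: "Ck k f \<Longrightarrow> Ck k g \<Longrightarrow> Ck k (\<lambda>x. f x * g x)"
proof (induction k arbitrary: f g)
  case 0 then show ?case by (simp add: continuous_on_mult)
next
  case (Suc k)
  have d: "\<And>x. ((\<lambda>x. f x * g x) has_derivative (\<lambda>h. f x * partial h g x + partial h f x * g x)) (at x)"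
    using Suc.prems unfolding Ck_Suc
    by (intro has_derivative_mult differentiable_has_derivative_partial) auto
  show ?case unfolding Ck_Suc partial_eq[OF d]
    using Suc d Suc.prems[THEN Ck_mono] by (auto simp: Ck_Suc differentiable_def intro!: Ck_add)
qed

lemma Ck_const: "Ck k (\<lambda>x. c)"
proof (induction k arbitrary: c)
  case (Suc k)
  have d: "\<And>x. ((\<lambda>x::'a. c) has_derivative (\<lambda>h. 0)) (at x)" by simp
  show ?case unfolding Ck_Suc partial_eq[OF d] using Suc by auto
qed auto

lemma Ck_cmult: "Ck k f \<Longrightarrow> Ck k (\<lambda>x. c * f x)"
  by (intro Ck_mult Ck_const)

lemma Ck_prod: "(\<And>i. i \<in> I \<Longrightarrow> Ck k (f i)) \<Longrightarrow> Ck k (\<lambda>x. \<Prod>i\<in>I. f i x)"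
  by (induction I rule: infinite_finite_induct) (auto intro: Ck_const Ck_mult)

text \<open>The derivative of the inverse contains the inverse twice, so the induction hypothesis is
  applied to \<open>f\<close> itself, lowered by one order with \<open>Ck_mono\<close>.\<close>

lemma Ck_inverse: "Ck k f \<Longrightarrow> (\<And>x. f x \<noteq> 0) \<Longrightarrow> Ck k (\<lambda>x. inverse (f x))"
proof (induction k arbitrary: f)
  case 0 then show ?case by (simp add: continuous_on_inverse)
next
  case (Suc k)
  have d: "\<And>x. ((\<lambda>x. inverse (f x)) has_derivative
      (\<lambda>h. -1 * (inverse (f x) * partial h f x * inverse (f x)))) (at x)"
    using Suc.prems(1) unfolding Ck_Suc
    by (auto intro!: Deriv.has_derivative_inverse[THEN has_derivative_eq_rhs] Suc.prems(2)
        differentiable_has_derivative_partial)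
  have "Ck k (\<lambda>x. inverse (f x))"
    using Suc.IH Suc.prems Ck_mono by blast
  then show ?case unfolding Ck_Suc partial_eq[OF d]
    using Suc.IH Suc.prems d Ck_mono[OF Suc.prems(1)] Ck_Suc[of k f]
    by (intro conjI ballI allI Ck_cmult Ck_mult) (auto simp: differentiable_def)
qed

text \<open>A function of one real variable enters through the whole sequence of its derivatives.
  This keeps the induction on \<open>k\<close> inside one family: a partial derivative only shifts
  \<open>n\<close> and adds a constant factor.\<close>

lemma Ck_compose_affine:
  fixes F :: "nat \<Rightarrow> real \<Rightarrow> real"
  assumes "\<And>n s. (F n has_real_derivative F (Suc n) s) (at s)"
  shows "Ck k (\<lambda>x. F n (c * (x \<bullet> e) + d))"
proof (induction k arbitrary: n)
  case 0
  have "continuous_on UNIV (F n)"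
    using assms DERIV_isCont by (blast intro: continuous_at_imp_continuous_on)
  then have "continuous_on UNIV (F n \<circ> (\<lambda>x. c * (x \<bullet> e) + d))"
    by (intro continuous_on_compose) (auto intro!: continuous_intros elim: continuous_on_subset)
  then show ?case by (simp add: o_def)
next
  case (Suc k)
  have d: "((\<lambda>x. F n (c * (x \<bullet> e) + d)) has_derivative
      (\<lambda>h. (c * (h \<bullet> e)) * F (Suc n) (c * (x \<bullet> e) + d))) (at x)" for x
  proof -
    have "(F n has_derivative (\<lambda>h. h * F (Suc n) (c * (x \<bullet> e) + d))) (at (c * (x \<bullet> e) + d))"
      using assms[of n "c * (x \<bullet> e) + d"] unfolding has_field_derivative_def
      by (simp only: mult.commute[of _ "F (Suc n) (c * (x \<bullet> e) + d)"])
    moreover have "((\<lambda>x. c * (x \<bullet> e) + d) has_derivative (\<lambda>h. c * (h \<bullet> e))) (at x)"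
      by (auto intro!: derivative_eq_intros)
    ultimately show ?thesis
      using has_derivative_compose by blast
  qed
  show ?case unfolding Ck_Suc partial_eq[OF d] using Suc d
    by (auto simp: differentiable_def intro!: Ck_cmult)
qed

subsection \<open>Flat functions and bumps\<close>

text \<open>The functions p(1/s) exp(-1/s), extended by zero, are closed under differentiation.
  Treating the whole family at once gives smoothness of the standard case \<open>p = 1\<close>
  without formulas for its higher derivatives.\<close>

definition flat :: "real poly \<Rightarrow> real \<Rightarrow> real" where
  "flat p s = (if s > 0 then poly p (inverse s) * exp (- inverse s) else 0)"

lemma poly_exp_tendsto_0: "((\<lambda>x::real. poly p x * exp (-x)) \<longlongrightarrow> 0) at_top"
proof -
  have "(\<lambda>x. poly p x * exp (-x)) = (\<lambda>x. \<Sum>i\<le>degree p. coeff p i * (x ^ i / exp x))"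
    by (auto simp: poly_altdef sum_distrib_right exp_minus divide_inverse mult.assoc)
  moreover have "((\<lambda>x. \<Sum>i\<le>degree p. coeff p i * (x ^ i / exp x)) \<longlongrightarrow> (\<Sum>i\<le>degree p. coeff p i * 0)) at_top"
    by (intro tendsto_sum tendsto_mult tendsto_const tendsto_power_div_exp_0)
  ultimately show ?thesis by simp
qed

lemma flat_tendsto_0: "(flat p \<longlongrightarrow> 0) (at 0)"
proof -
  have "((\<lambda>s. poly p (inverse s) * exp (- inverse s)) \<longlongrightarrow> 0) (at_right (0::real))"
    using filterlim_compose[OF poly_exp_tendsto_0 filterlim_inverse_at_top_right] .
  moreover have "\<forall>\<^sub>F s in at_right 0. poly p (inverse s) * exp (- inverse s) = flat p s"
    by (auto simp: flat_def eventually_at_right_field intro!: exI[of _ 1])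
  ultimately have "(flat p \<longlongrightarrow> 0) (at_right 0)"
    by (rule Lim_transform_eventually)
  moreover have "(flat p \<longlongrightarrow> 0) (at_left 0)"
    by (rule tendsto_eventually) (auto simp: flat_def eventually_at_left_field intro!: exI[of _ "-1"])
  ultimately show ?thesis by (simp add: filterlim_at_split)
qed

text \<open>In the derivative of p(1/s) exp(-1/s) the exponential contributes p/s^2 and the
  polynomial -p'/s^2; \<open>monom 1 2\<close>, evaluated at 1/s, is the factor 1/s^2.\<close>

definition flat_step :: "real poly \<Rightarrow> real poly" where
  "flat_step p = (p - pderiv p) * monom 1 2"

lemma flat_deriv: "(flat p has_real_derivative flat (flat_step p) s) (at s)"
proof -
  consider "s < 0" | "s = 0" | "s > 0" by linarith
  then show ?thesis
  proof cases
    case 1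
    have "((\<lambda>s. 0) has_real_derivative 0) (at s)" by simp
    then have "(flat p has_real_derivative 0) (at s)"
      by (rule has_field_derivative_transform_within_open[where S="{..<0}"]) (use 1 in \<open>auto simp: flat_def\<close>)
    then show ?thesis using 1 by (simp add: flat_def)
  next
    case 2
    \<comment> \<open>The difference quotient at 0 is again flat, with \<open>p\<close> multiplied
      by the variable, so its limit is already known.\<close>
    have "((\<lambda>h. flat p h / h) \<longlongrightarrow> 0) (at 0)"
    proof (rule Lim_transform_eventually[OF flat_tendsto_0[of "p * monom 1 1"]])
      show "\<forall>\<^sub>F h in at 0. flat (p * monom 1 1) h = flat p h / h"
        by (rule eventuallyI) (auto simp: flat_def poly_monom field_simps)
    qed
    then show ?thesis unfolding 2 DERIV_def by (simp add: flat_def)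
  next
    case 3
    have "((\<lambda>s. poly p (inverse s) * exp (- inverse s)) has_real_derivative
       flat (flat_step p) s) (at s)"
      using 3 by (auto intro!: derivative_eq_intros DERIV_chain2[OF poly_DERIV]
        simp: flat_def flat_step_def poly_monom field_simps power2_eq_square)
    then show ?thesis
      by (rule has_field_derivative_transform_within_open[where S="{0<..}"]) (use 3 in \<open>auto simp: flat_def\<close>)
  qed
qed

lemma flat_measurable: "flat p \<in> borel_measurable borel"
  using flat_deriv by (intro borel_measurable_continuous_onI continuous_at_imp_continuous_on) (blast intro: DERIV_isCont)

lemma Ck_flat_affine: "Ck k (\<lambda>x. flat p (c * (x \<bullet> e) + d))"
  using Ck_compose_affine[of "\<lambda>n. flat ((flat_step ^^ n) p)" k 0 c e d] by (simp add: flat_deriv)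

abbreviation bmp :: "real \<Rightarrow> real" where "bmp \<equiv> flat 1"

lemma bmp_bounds: "0 \<le> bmp s" "bmp s \<le> 1"
  by (auto simp: flat_def)

lemma bmp_pos: "0 < bmp s \<longleftrightarrow> 0 < s" "bmp s = 0 \<longleftrightarrow> s \<le> 0"
  by (auto simp: flat_def)

lemma bmp_tendsto: "s > 0 \<Longrightarrow> (\<lambda>j. bmp (real j * s)) \<longlonglongrightarrow> 1"
proof -
  assume s: "s > 0"
  have "(\<lambda>j. exp (- (inverse (real j) * inverse s))) \<longlonglongrightarrow> exp (- (0 * inverse s))"
    by (intro tendsto_intros lim_inverse_n)
  moreover have "\<forall>\<^sub>F j in sequentially. exp (- (inverse (real j) * inverse s)) = bmp (real j * s)"
    using eventually_gt_at_top[of 0] by eventually_elim (use s in \<open>auto simp: flat_def\<close>)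
  ultimately show ?thesis using Lim_transform_eventually by fastforce
qed

text \<open>A smooth approximation of the indicator of the open box from below: it lies between 0
  and 1 and vanishes outside the box for every \<open>j\<close>. In one dimension the same functions
  later serve as test functions in time.\<close>

definition box_bump :: "'a::euclidean_space \<Rightarrow> 'a \<Rightarrow> nat \<Rightarrow> 'a \<Rightarrow> real" where
  "box_bump a b j x = (\<Prod>i\<in>Basis. bmp (real j * (x \<bullet> i - a \<bullet> i)) * bmp (real j * (b \<bullet> i - x \<bullet> i)))"

lemma box_bump_bounds: "0 \<le> box_bump a b j x" "box_bump a b j x \<le> 1"
  unfolding box_bump_def
  by (auto intro!: prod_nonneg prod_le_1 mult_nonneg_nonneg mult_le_one bmp_bounds)

lemma box_bump_eq_0: "x \<notin> box a b \<Longrightarrow> box_bump a b j x = 0"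
  by (auto simp: box_bump_def bmp_pos mem_box mult_le_0_iff not_less)

lemma box_bump_tendsto: "(\<lambda>j. box_bump a b j x) \<longlonglongrightarrow> indicator (box a b) x"
proof (cases "x \<in> box a b")
  case True
  have "(\<lambda>j. box_bump a b j x) \<longlonglongrightarrow> (\<Prod>i\<in>(Basis::'a set). 1 * 1)"
    unfolding box_bump_def using True
    by (intro tendsto_prod tendsto_mult bmp_tendsto) (auto simp: mem_box)
  then show ?thesis using True by simp
qed (simp add: box_bump_eq_0)

lemma Ck_box_bump: "Ck k (box_bump a b j)"
proof -
  define g where "g i x = bmp (real j * (x \<bullet> i) + - (real j * (a \<bullet> i)))
      * bmp (- real j * (x \<bullet> i) + real j * (b \<bullet> i))" for i x
  have "Ck k (g i)" for i
    unfolding g_def[abs_def] by (rule Ck_mult; rule Ck_flat_affine)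
  then have "Ck k (\<lambda>x. \<Prod>i\<in>Basis. g i x)"
    by (intro Ck_prod)
  moreover have "box_bump a b j = (\<lambda>x. \<Prod>i\<in>Basis. g i x)"
    by (simp add: box_bump_def g_def fun_eq_iff algebra_simps)
  ultimately show ?thesis by simp
qed

subsection \<open>Test functions\<close>

lemma eq_0_outside_closure: "x \<notin> closure {x. \<phi> x \<noteq> 0} \<Longrightarrow> \<phi> x = 0"
  using subsetD[OF closure_subset, of x "{x. \<phi> x \<noteq> 0}"] by blast

lemma closure_supp_mono:
  fixes f g :: "'a::euclidean_space \<Rightarrow> real"
  assumes "compact (closure {x. f x \<noteq> 0})" "closure {x. f x \<noteq> 0} \<subseteq> \<Omega>"
    and "\<And>x. f x = 0 \<Longrightarrow> g x = 0"
  shows "compact (closure {x. g x \<noteq> 0})" "closure {x. g x \<noteq> 0} \<subseteq> \<Omega>"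
proof -
  have *: "{x. g x \<noteq> 0} \<subseteq> {x. f x \<noteq> 0}" using assms(3) by auto
  then show "closure {x. g x \<noteq> 0} \<subseteq> \<Omega>" using assms(2) closure_mono by blast
  show "compact (closure {x. g x \<noteq> 0})"
    using assms(1) bounded_subset[of "{x. f x \<noteq> 0}"] * by (simp only: compact_closure)
qed

lemma test_function_times:
  assumes "\<phi> \<in> test_functions \<Omega>" "\<And>k. Ck k g"
  shows "(\<lambda>x. \<phi> x * g x) \<in> test_functions \<Omega>"
  using assms closure_supp_mono[of \<phi> \<Omega> "\<lambda>x. \<phi> x * g x"]
  unfolding test_functions_def by (auto intro!: Ck_mult)

lemma box_bump_test:
  assumes "cbox a b \<subseteq> \<Omega>"
  shows "box_bump a b j \<in> test_functions \<Omega>"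
proof -
  have "{x. box_bump a b j x \<noteq> 0} \<subseteq> cbox a b"
    using box_bump_eq_0 box_subset_cbox by blast
  then have "closure {x. box_bump a b j x \<noteq> 0} \<subseteq> cbox a b" "bounded {x. box_bump a b j x \<noteq> 0}"
    using closure_minimal[OF _ closed_cbox] bounded_subset[OF bounded_cbox] by blast+
  then show ?thesis
    using assms Ck_box_bump unfolding test_functions_def by auto
qed

lemma test_function_differentiable:
  "\<phi> \<in> test_functions \<Omega> \<Longrightarrow> (\<phi> has_derivative (\<lambda>h. partial h \<phi> x)) (at x)"
  unfolding test_functions_def using Ck_Suc differentiable_has_derivative_partial by blast

lemma test_function_eq_0: "\<phi> \<in> test_functions \<Omega> \<Longrightarrow> x \<notin> \<Omega> \<Longrightarrow> \<phi> x = 0"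
  unfolding test_functions_def using eq_0_outside_closure[of x \<phi>] by blast

lemma partial_eq_0:
  assumes "x \<notin> closure {x. \<phi> x \<noteq> 0}"
  shows "partial i \<phi> x = 0"
proof -
  have "((\<lambda>x. 0::real) has_derivative (\<lambda>h. 0)) (at x)" by simp
  then have "(\<phi> has_derivative (\<lambda>h. 0)) (at x)"
  proof (rule has_derivative_transform_within_open)
    show "open (- closure {x. \<phi> x \<noteq> 0})" "x \<in> - closure {x. \<phi> x \<noteq> 0}"
      using assms by (simp_all add: open_Compl)
    show "0 = \<phi> y" if "y \<in> - closure {x. \<phi> x \<noteq> 0}" for y
      using eq_0_outside_closure that by (metis ComplD)
  qed
  from fun_cong[OF frechet_derivative_at[OF this], of i] show ?thesis
    unfolding partial_def by simp
qed

lemma partial_test_function: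
  assumes "\<phi> \<in> test_functions \<Omega>" "i \<in> Basis"
  shows "partial i \<phi> \<in> test_functions \<Omega>"
proof -
  have "{x. partial i \<phi> x \<noteq> 0} \<subseteq> closure {x. \<phi> x \<noteq> 0}"
    using partial_eq_0[of _ \<phi>] by auto
  then have *: "closure {x. partial i \<phi> x \<noteq> 0} \<subseteq> closure {x. \<phi> x \<noteq> 0}"
    by (simp add: closure_minimal)
  then have "bounded {x. partial i \<phi> x \<noteq> 0}"
    by (rule bounded_subset[rotated, OF subset_trans[OF closure_subset]])
      (use assms in \<open>simp add: test_functions_def bounded_closure\<close>)
  moreover have "Ck k (partial i \<phi>)" for k
    using assms Ck_Suc unfolding test_functions_def by blast
  ultimately show ?thesis
    using assms * subset_trans[of _ "closure {x. \<phi> x \<noteq> 0}" \<Omega>] unfolding test_functions_def by simp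
qed

lemma test_function_bounded:
  assumes "\<phi> \<in> test_functions \<Omega>"
  shows "\<exists>M\<ge>0. \<forall>x. \<bar>\<phi> x\<bar> \<le> M"
proof -
  let ?K = "closure {x. \<phi> x \<noteq> 0}"
  have "continuous_on UNIV \<phi>"
    using assms Ck_continuous unfolding test_functions_def by blast
  moreover have "compact ?K" using assms by (simp add: test_functions_def del: compact_closure)
  ultimately have "bounded (\<phi> ` ?K)"
    by (meson compact_continuous_image compact_imp_bounded continuous_on_subset subset_UNIV)
  then obtain M where "\<forall>y\<in>\<phi> ` ?K. norm y \<le> M" and M: "M > 0"
    unfolding bounded_pos by auto
  then have "\<bar>\<phi> x\<bar> \<le> M" for x
    using closure_subset[of "{x. \<phi> x \<noteq> 0}"] by (cases "\<phi> x = 0") auto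
  then show ?thesis using M by (intro exI[of _ M]) auto
qed

lemma test_function_continuous: "\<phi> \<in> test_functions \<Omega> \<Longrightarrow> continuous_on UNIV \<phi>"
  unfolding test_functions_def using Ck_continuous by blast

lemma test_function_measurable: "\<phi> \<in> test_functions \<Omega> \<Longrightarrow> \<phi> \<in> borel_measurable borel"
  using test_function_continuous borel_measurable_continuous_onI by blast

lemma integrable_bounded_compact:
  fixes \<phi> :: "'a::euclidean_space \<Rightarrow> real"
  assumes "\<phi> \<in> borel_measurable borel" "compact K" "\<And>x. x \<notin> K \<Longrightarrow> \<phi> x = 0" "\<And>x. \<bar>\<phi> x\<bar> \<le> M"
  shows "integrable lborel \<phi>"
proof (rule Bochner_Integration.integrable_bound)
  show "integrable lborel (\<lambda>x. M * indicator K x :: real)"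
    using emeasure_compact_finite[OF assms(2)] borel_compact[OF assms(2)] by simp
  show "AE x in lborel. norm (\<phi> x) \<le> norm (M * indicator K x :: real)"
    using assms(3,4) by (intro AE_I2) (auto simp: indicator_def intro: order_trans[OF _ abs_ge_self])
qed (use assms in auto)

lemma test_function_integrable:
  assumes "\<phi> \<in> test_functions \<Omega>"
  shows "integrable lborel \<phi>"
proof -
  obtain M where "\<forall>x. \<bar>\<phi> x\<bar> \<le> M" using test_function_bounded[OF assms] by blast
  then show ?thesis
    using assms eq_0_outside_closure
    by (intro integrable_bounded_compact[of \<phi> "closure {x. \<phi> x \<noteq> 0}" M] test_function_measurable[OF assms])
      (simp_all add: test_functions_def)
qed


text \<open>Translation invariance makes the integral of every difference quotient vanish.\<close>

lemma integral_partial_eq_0: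
  fixes \<phi> :: "'a::euclidean_space \<Rightarrow> real"
  assumes \<phi>: "\<phi> \<in> test_functions \<Omega>" and i: "i \<in> Basis"
  shows "(\<integral>x. partial i \<phi> x \<partial>lborel) = 0"
proof -
  obtain M where M: "0 \<le> M" "\<And>x. \<bar>partial i \<phi> x\<bar> \<le> M"
    using test_function_bounded[OF partial_test_function[OF \<phi> i]] by blast
  let ?K = "closure {x. \<phi> x \<noteq> 0}"
  have K: "compact ?K" using \<phi> by (simp add: test_functions_def)
  obtain R where R: "\<And>x. x \<in> ?K \<Longrightarrow> norm x \<le> R"
    using compact_imp_bounded[OF K] unfolding bounded_iff by blast
  define q where "q n x = (\<phi> (x + (1 / Suc n) *\<^sub>R i) - \<phi> x) * Suc n" for n x
  note ms[measurable] = test_function_measurable[OF \<phi>]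
  have lip: "\<bar>\<phi> (x + h *\<^sub>R i) - \<phi> x\<bar> \<le> M * h" if "h > 0" for x h
  proof -
    have d: "((\<lambda>r. \<phi> (x + r *\<^sub>R i)) has_derivative (\<lambda>k. k * partial i \<phi> (x + r *\<^sub>R i))) (at r)" for r
    proof -
      have l: "bounded_linear (\<lambda>h. partial h \<phi> (x + r *\<^sub>R i))"
        using test_function_differentiable[OF \<phi>] has_derivative_bounded_linear by blast
      have "((\<lambda>r. x + r *\<^sub>R i) has_derivative (\<lambda>k. k *\<^sub>R i)) (at r)"
        by (auto intro!: derivative_eq_intros)
      from has_derivative_compose[OF this test_function_differentiable[OF \<phi>]]
      show ?thesis by (simp add: linear_scale[OF bounded_linear.linear[OF l]])
    qed
    have d': "((\<lambda>r. \<phi> (x + r *\<^sub>R i)) has_real_derivative partial i \<phi> (x + r *\<^sub>R i)) (at r)" for r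
      using d[of r] unfolding has_field_derivative_def by (simp add: mult_commute_abs)
    obtain z where "\<phi> (x + h *\<^sub>R i) - \<phi> (x + 0 *\<^sub>R i) = (h - 0) * partial i \<phi> (x + z *\<^sub>R i)"
      using MVT2[OF \<open>h > 0\<close> d'] by blast
    then have "\<phi> (x + h *\<^sub>R i) - \<phi> x = h * partial i \<phi> (x + z *\<^sub>R i)" by simp
    then show ?thesis
      using M(2)[of "x + z *\<^sub>R i"] that by (simp add: abs_mult mult.commute)
  qed
  have "(\<lambda>n. \<integral>x. q n x \<partial>lborel) \<longlonglongrightarrow> (\<integral>x. partial i \<phi> x \<partial>lborel)"
  proof (rule integral_dominated_convergence)
    show "partial i \<phi> \<in> borel_measurable lborel"
      using test_function_measurable[OF partial_test_function[OF \<phi> i]] by simp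
    show "q n \<in> borel_measurable lborel" for n unfolding q_def by measurable
    \<comment> \<open>\<open>M\<close> bounds all quotients by the mean value theorem, and since the
      shift has length at most 1 every quotient vanishes outside the ball of radius
      \<open>R + 1\<close>.\<close>
    show "integrable lborel (\<lambda>x::'a. M * indicator (cball 0 (R + 1)) x :: real)"
      using emeasure_lborel_cball_finite[of "0::'a" "R + 1"] by (intro integrable_mult_right integrable_real_indicator) auto
    show "AE x in lborel. (\<lambda>n. q n x) \<longlonglongrightarrow> partial i \<phi> x"
    proof (rule AE_I2)
      fix x
      have "((\<lambda>r. \<phi> (x + r *\<^sub>R i)) has_derivative (\<lambda>k. partial (k *\<^sub>R i) \<phi> (x + 0 *\<^sub>R i))) (at 0)"
        by (rule has_derivative_compose[OF _ test_function_differentiable[OF \<phi>]])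
          (auto intro!: derivative_eq_intros)
      moreover have "partial (k *\<^sub>R i) \<phi> x = partial i \<phi> x * k" for k
        using linear_scale[OF bounded_linear.linear[OF has_derivative_bounded_linear[OF test_function_differentiable[OF \<phi>]]]]
        by (simp add: mult.commute)
      ultimately have "((\<lambda>r. \<phi> (x + r *\<^sub>R i)) has_real_derivative partial i \<phi> x) (at 0)"
        unfolding has_field_derivative_def by simp
      then have l: "((\<lambda>h. (\<phi> (x + h *\<^sub>R i) - \<phi> x) / h) \<longlongrightarrow> partial i \<phi> x) (at 0)"
        unfolding DERIV_def by simp
      have "filterlim (\<lambda>n. 1 / real (Suc n)) (at 0) sequentially"
        unfolding filterlim_at using LIMSEQ_inverse_real_of_nat by (auto simp: inverse_eq_divide)
      from filterlim_compose[OF l this]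
      show "(\<lambda>n. q n x) \<longlonglongrightarrow> partial i \<phi> x" unfolding q_def by simp
    qed
    show "AE x in lborel. norm (q n x) \<le> M * indicator (cball 0 (R + 1)) x" for n
    proof (rule AE_I2)
      fix x
      have le: "\<bar>q n x\<bar> \<le> M"
        using lip[of "1 / Suc n" x] unfolding q_def abs_mult
        by (simp add: pos_le_divide_eq del: of_nat_Suc)
      show "norm (q n x) \<le> M * indicator (cball 0 (R + 1)) x"
      proof (cases "norm x \<le> R + 1")
        case False
        have "x \<notin> ?K" using False R by force
        moreover have "x + (1 / Suc n) *\<^sub>R i \<notin> ?K"
        proof
          assume "x + (1 / Suc n) *\<^sub>R i \<in> ?K"
          then have "norm (x + (1 / Suc n) *\<^sub>R i) \<le> R" using R by blast
          moreover have "norm ((1 / real (Suc n)) *\<^sub>R i) \<le> 1" using i by simp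
          ultimately show False
            using False norm_triangle_ineq4[of "x + (1 / Suc n) *\<^sub>R i" "(1 / Suc n) *\<^sub>R i"]
            unfolding add_diff_cancel by linarith
        qed
        ultimately have "\<phi> x = 0" "\<phi> (x + (1 / Suc n) *\<^sub>R i) = 0"
          by (blast intro: eq_0_outside_closure)+
        then show ?thesis using M(1) by (simp add: q_def)
      qed (use le in simp)
    qed
  qed
  moreover have "(\<integral>x. q n x \<partial>lborel) = 0" for n
  proof -
    let ?c = "(1 / Suc n) *\<^sub>R i"
    have i0: "integrable lborel \<phi>" by (rule test_function_integrable[OF \<phi>])
    have d: "distr lborel borel (\<lambda>x. x + ?c) = lborel"
    proof -
      have "(\<lambda>x. x + ?c) = (+) ?c" by (rule ext) (rule add.commute)
      then show ?thesis using lborel_distr_plus[of ?c] by (simp only:)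
    qed
    have "(\<integral>x. \<phi> x \<partial>distr lborel borel (\<lambda>x. x + ?c)) = (\<integral>x. \<phi> (x + ?c) \<partial>lborel)"
      by (rule integral_distr) auto
    then have e: "(\<integral>x. \<phi> (x + ?c) \<partial>lborel) = (\<integral>x. \<phi> x \<partial>lborel)" unfolding d by simp
    have "integrable (distr lborel borel (\<lambda>x. x + ?c)) \<phi>" unfolding d by (rule i0)
    then have i1: "integrable lborel (\<lambda>x. \<phi> (x + ?c))"
      by (subst (asm) integrable_distr_eq) auto
    show ?thesis unfolding q_def using i0 i1 e by simp
  qed
  ultimately show ?thesis by (simp add: LIMSEQ_const_iff)
qed

subsection \<open>The Lebesgue space\<close>

lemma L2_D:
  assumes "v \<in> L2 \<Omega>"
  shows "v \<in> borel_measurable (lebesgue_on \<Omega>)" "integrable (lebesgue_on \<Omega>) (\<lambda>x. (norm (v x))\<^sup>2)"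
  using assms by (auto simp: L2_def)

lemma integrable_inner_L2:
  assumes "v \<in> L2 \<Omega>" "w \<in> L2 \<Omega>"
  shows "integrable (lebesgue_on \<Omega>) (\<lambda>x. v x \<bullet> w x)"
proof (rule Bochner_Integration.integrable_bound)
  show "integrable (lebesgue_on \<Omega>) (\<lambda>x. (norm (v x))\<^sup>2 + (norm (w x))\<^sup>2)"
    using assms by (intro Bochner_Integration.integrable_add L2_D)
  note [measurable] = L2_D(1)[OF assms(1)] L2_D(1)[OF assms(2)]
  show "(\<lambda>x. v x \<bullet> w x) \<in> borel_measurable (lebesgue_on \<Omega>)" by measurable
  have "\<bar>v x \<bullet> w x\<bar> \<le> (norm (v x))\<^sup>2 + (norm (w x))\<^sup>2" for x
    using Cauchy_Schwarz_ineq2[of "v x" "w x"] sum_squares_bound[of "norm (v x)" "norm (w x)"]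
      mult_nonneg_nonneg[OF norm_ge_zero[of "v x"] norm_ge_zero[of "w x"]]
    by linarith
  then show "AE x in lebesgue_on \<Omega>. norm (v x \<bullet> w x) \<le> norm ((norm (v x))\<^sup>2 + (norm (w x))\<^sup>2)"
    by simp
qed

lemma integrable_mult_L2:
  fixes v w :: "'a::euclidean_space \<Rightarrow> real"
  assumes "v \<in> L2 \<Omega>" "w \<in> L2 \<Omega>"
  shows "integrable (lebesgue_on \<Omega>) (\<lambda>x. v x * w x)"
  using integrable_inner_L2[OF assms] by simp

lemma L2_scale: "v \<in> L2 \<Omega> \<Longrightarrow> (\<lambda>x. c *\<^sub>R v x) \<in> L2 \<Omega>"
  unfolding L2_def by (auto simp: power_mult_distrib)

lemma L2_add:
  assumes "v \<in> L2 \<Omega>" "w \<in> L2 \<Omega>"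
  shows "(\<lambda>x. v x + w x) \<in> L2 \<Omega>"
proof -
  have "(norm (v x + w x))\<^sup>2 = (norm (v x))\<^sup>2 + 2 * (v x \<bullet> w x) + (norm (w x))\<^sup>2" for x
    by (simp add: power2_norm_eq_inner inner_add inner_commute)
  then show ?thesis
    using L2_D[OF assms(1)] L2_D[OF assms(2)] integrable_inner_L2[OF assms] unfolding L2_def by auto
qed

lemma L2_diff: "v \<in> L2 \<Omega> \<Longrightarrow> w \<in> L2 \<Omega> \<Longrightarrow> (\<lambda>x. v x - w x) \<in> L2 \<Omega>"
  using L2_add[of v \<Omega> "\<lambda>x. -1 *\<^sub>R w x"] L2_scale[of w \<Omega> "-1"] by simp

lemma L2_inner_commute: "L2_inner \<Omega> v w = L2_inner \<Omega> w v"
  unfolding L2_inner_def by (simp add: inner_commute)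

lemma L2_inner_add:
  "v \<in> L2 \<Omega> \<Longrightarrow> w \<in> L2 \<Omega> \<Longrightarrow> z \<in> L2 \<Omega> \<Longrightarrow>
    L2_inner \<Omega> (\<lambda>x. v x + w x) z = L2_inner \<Omega> v z + L2_inner \<Omega> w z"
  unfolding L2_inner_def by (simp add: inner_add integrable_inner_L2)

lemma L2_inner_diff:
  "v \<in> L2 \<Omega> \<Longrightarrow> w \<in> L2 \<Omega> \<Longrightarrow> z \<in> L2 \<Omega> \<Longrightarrow>
    L2_inner \<Omega> (\<lambda>x. v x - w x) z = L2_inner \<Omega> v z - L2_inner \<Omega> w z"
  unfolding L2_inner_def by (simp add: inner_diff integrable_inner_L2)

lemma L2_inner_scale: "L2_inner \<Omega> (\<lambda>x. c *\<^sub>R v x) z = c * L2_inner \<Omega> v z"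
  unfolding L2_inner_def by simp

lemma L2_inner_nonneg: "0 \<le> L2_inner \<Omega> v v"
  unfolding L2_inner_def by (auto intro: integral_nonneg_AE)

lemma L2_norm_nonneg: "0 \<le> L2_norm \<Omega> v"
  unfolding L2_norm_def using L2_inner_nonneg by simp

lemma L2_norm_square: "(L2_norm \<Omega> v)\<^sup>2 = L2_inner \<Omega> v v"
  unfolding L2_norm_def using L2_inner_nonneg[of \<Omega> v] by simp

lemma L2_norm_square_integral: "(L2_norm \<Omega> v)\<^sup>2 = (\<integral>x. (norm (v x))\<^sup>2 \<partial>lebesgue_on \<Omega>)"
  unfolding L2_norm_square L2_inner_def by (simp add: power2_norm_eq_inner)

lemma L2_norm_AE_cong:
  assumes "v \<in> L2 \<Omega>" "w \<in> L2 \<Omega>" "AE x in lebesgue_on \<Omega>. v x = w x"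
  shows "L2_norm \<Omega> v = L2_norm \<Omega> w"
proof -
  have "L2_inner \<Omega> v v = L2_inner \<Omega> w w"
    unfolding L2_inner_def using assms
    by (intro integral_cong_AE borel_measurable_integrable integrable_inner_L2) auto
  then show ?thesis by (simp add: L2_norm_def)
qed

lemma L2_norm_add_square:
  assumes "v \<in> L2 \<Omega>" "w \<in> L2 \<Omega>"
  shows "(L2_norm \<Omega> (\<lambda>x. v x + w x))\<^sup>2 = (L2_norm \<Omega> v)\<^sup>2 + 2 * L2_inner \<Omega> v w + (L2_norm \<Omega> w)\<^sup>2"
proof -
  note [simp] = assms L2_add[OF assms]
  have "L2_inner \<Omega> (\<lambda>x. v x + w x) (\<lambda>x. v x + w x)
      = L2_inner \<Omega> v (\<lambda>x. v x + w x) + L2_inner \<Omega> w (\<lambda>x. v x + w x)"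
    by (rule L2_inner_add) simp_all
  also have "\<dots> = L2_inner \<Omega> (\<lambda>x. v x + w x) v + L2_inner \<Omega> (\<lambda>x. v x + w x) w"
    by (simp add: L2_inner_commute)
  also have "\<dots> = L2_inner \<Omega> v v + 2 * L2_inner \<Omega> v w + L2_inner \<Omega> w w"
    by (simp add: L2_inner_add L2_inner_commute[of \<Omega> w v])
  finally show ?thesis by (simp add: L2_norm_square)
qed

lemma L2_norm_scale: "L2_norm \<Omega> (\<lambda>x. c *\<^sub>R v x) = \<bar>c\<bar> * L2_norm \<Omega> v"
proof -
  have "L2_inner \<Omega> (\<lambda>x. c *\<^sub>R v x) (\<lambda>x. c *\<^sub>R v x) = c\<^sup>2 * L2_inner \<Omega> v v"
    unfolding L2_inner_def by (simp add: power2_eq_square mult.assoc)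
  then show ?thesis by (simp add: L2_norm_def real_sqrt_mult)
qed

text \<open>Applied to the square of the norm of v + r w it yields the Cauchy-Schwarz inequality.
  \<open>L2_norm\<close> is a seminorm on representatives, so the leading coefficient may vanish and
  \<open>c = 0\<close> is a case of its own.\<close>

lemma quadratic_nonneg_imp_discriminant:
  fixes a b c :: real
  assumes "\<And>r. 0 \<le> a + 2 * r * b + r\<^sup>2 * c" "0 \<le> c"
  shows "b\<^sup>2 \<le> a * c"
proof (cases "c = 0")
  case True
  have "b = 0"
  proof (rule ccontr)
    assume "b \<noteq> 0"
    \<comment> \<open>At this \<open>r\<close> the expression, linear in \<open>r\<close> for
      \<open>c = 0\<close>, equals -1.\<close>
    then show False using assms(1)[of "- (a + 1) / (2 * b)"] True by (simp add: field_simps)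
  qed
  then show ?thesis using True by simp
next
  case False
  \<comment> \<open>The minimum over \<open>r\<close> is attained at \<open>- b / c\<close>.\<close>
  have "0 \<le> a + 2 * (- b / c) * b + (- b / c)\<^sup>2 * c" by (rule assms)
  also have "\<dots> = a - b\<^sup>2 / c" using False by (simp add: power2_eq_square field_simps)
  finally show ?thesis using False assms(2) by (simp add: field_simps)
qed

lemma L2_Cauchy_Schwarz:
  assumes "v \<in> L2 \<Omega>" "w \<in> L2 \<Omega>"
  shows "\<bar>L2_inner \<Omega> v w\<bar> \<le> L2_norm \<Omega> v * L2_norm \<Omega> w"
proof -
  have "0 \<le> (L2_norm \<Omega> v)\<^sup>2 + 2 * r * L2_inner \<Omega> v w + r\<^sup>2 * (L2_norm \<Omega> w)\<^sup>2" for r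
    using L2_norm_add_square[OF assms(1) L2_scale[OF assms(2), of r]]
      zero_le_power2[of "L2_norm \<Omega> (\<lambda>x. v x + r *\<^sub>R w x)"]
    by (simp add: L2_norm_scale power_mult_distrib L2_inner_commute[of \<Omega> v] L2_inner_scale)
  then have "(L2_inner \<Omega> v w)\<^sup>2 \<le> (L2_norm \<Omega> v)\<^sup>2 * (L2_norm \<Omega> w)\<^sup>2"
    by (rule quadratic_nonneg_imp_discriminant) simp
  then have "\<bar>L2_inner \<Omega> v w\<bar>\<^sup>2 \<le> (L2_norm \<Omega> v * L2_norm \<Omega> w)\<^sup>2"
    by (simp add: power_mult_distrib)
  then show ?thesis
    by (rule power2_le_imp_le) (simp add: L2_norm_nonneg)
qed

lemma L2_norm_triangle:
  assumes "v \<in> L2 \<Omega>" "w \<in> L2 \<Omega>"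
  shows "L2_norm \<Omega> (\<lambda>x. v x + w x) \<le> L2_norm \<Omega> v + L2_norm \<Omega> w"
proof (rule power2_le_imp_le)
  show "(L2_norm \<Omega> (\<lambda>x. v x + w x))\<^sup>2 \<le> (L2_norm \<Omega> v + L2_norm \<Omega> w)\<^sup>2"
    using L2_Cauchy_Schwarz[OF assms] unfolding L2_norm_add_square[OF assms] by (simp add: power2_sum)
qed (simp add: L2_norm_nonneg)

lemma L2_norm_minus_commute: "L2_norm \<Omega> (\<lambda>x. v x - w x) = L2_norm \<Omega> (\<lambda>x. w x - v x)"
  using L2_norm_scale[of \<Omega> "-1" "\<lambda>x. v x - w x"] by simp

lemma L2_inner_tendsto:
  assumes "v \<in> L2 \<Omega>" "w \<in> L2 \<Omega>" "\<And>n. a n \<in> L2 \<Omega>" "((\<lambda>n. L2_norm \<Omega> (\<lambda>x. a n x - v x)) \<longlongrightarrow> 0) F"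
  shows "((\<lambda>n. L2_inner \<Omega> (a n) w) \<longlongrightarrow> L2_inner \<Omega> v w) F"
proof (rule LIM_zero_cancel, rule Lim_null_comparison)
  show "\<forall>\<^sub>F n in F. norm (L2_inner \<Omega> (a n) w - L2_inner \<Omega> v w)
      \<le> L2_norm \<Omega> (\<lambda>x. a n x - v x) * L2_norm \<Omega> w"
    using L2_Cauchy_Schwarz[OF L2_diff[OF assms(3,1)] assms(2)]
    by (intro always_eventually allI) (simp add: L2_inner_diff assms)
  show "((\<lambda>n. L2_norm \<Omega> (\<lambda>x. a n x - v x) * L2_norm \<Omega> w) \<longlongrightarrow> 0) F"
    using tendsto_mult[OF assms(4) tendsto_const] by simp
qed

subsection \<open>The fundamental lemma of the calculus of variations\<close>

text \<open>The Borel sets over which \<open>h\<close> integrates to zero form a Dynkin system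
  containing the boxes, and boxes are stable under intersection and generate the Borel sets.\<close>

lemma AE_eq_0_if_box_integrals_0:
  fixes h :: "'a::euclidean_space \<Rightarrow> real"
  assumes h: "integrable lborel h" and z: "\<And>a b. (\<integral>x. indicator (box a b) x * h x \<partial>lborel) = 0"
  shows "AE x in lborel. h x = 0"
proof (rule sigma_finite_measure.density_zero[OF _ h])
  show "sigma_finite_measure (lborel :: 'a measure)" by (rule sigma_finite_lborel)
  have i: "integrable lborel (\<lambda>x. indicator A x * h x)" if "A \<in> sets borel" for A
    using integrable_real_mult_indicator[of A lborel h] that h by (simp add: mult.commute)
  \<comment> \<open>Closure under complements needs the integral over the whole space; it is the
    limit of the integrals over growing boxes centred at the origin.\<close>
  have all: "(\<integral>x. h x \<partial>lborel) = 0"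
  proof -
    have "(\<lambda>n. \<integral>x. indicator (box (- real n *\<^sub>R One) (real n *\<^sub>R One)) x * h x \<partial>lborel) \<longlonglongrightarrow> (\<integral>x. h x \<partial>lborel)"
    proof (rule integral_dominated_convergence)
      show "integrable lborel (\<lambda>x. \<bar>h x\<bar>)" using h by simp
      show "h \<in> borel_measurable lborel" using h by simp
      show "(\<lambda>x. indicator (box (- real n *\<^sub>R One) (real n *\<^sub>R One)) x * h x) \<in> borel_measurable lborel" for n
        using i[THEN borel_measurable_integrable] by simp
      show "AE x in lborel. (\<lambda>n. indicator (box (- real n *\<^sub>R One) (real n *\<^sub>R One)) x * h x) \<longlonglongrightarrow> h x"
      proof (rule AE_I2, rule tendsto_eventually)
        fix x :: 'a
        obtain N where N: "norm x < real N" using reals_Archimedean2 by blast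
        show "\<forall>\<^sub>F n in sequentially. indicator (box (- real n *\<^sub>R One) (real n *\<^sub>R One)) x * h x = h x"
          using eventually_ge_at_top[of N]
        proof eventually_elim
          case (elim n)
          have "\<bar>x \<bullet> i\<bar> < real n" if "i \<in> Basis" for i
            using Basis_le_norm[OF that, of x] N elim by linarith
          then have "x \<in> box (- real n *\<^sub>R One) (real n *\<^sub>R One)" by (auto simp: mem_box abs_less_iff minus_less_iff)
          then show ?case by simp
        qed
      qed
    qed (auto simp: indicator_def)
    then show ?thesis by (simp add: z LIMSEQ_const_iff)
  qed
  fix A :: "'a set" assume "A \<in> sets lborel"
  then have A: "A \<in> sigma_sets UNIV (range (\<lambda>(a, b). box a b))"
    by (simp add: borel_eq_box)
  have sb: "B \<in> sigma_sets UNIV (range (\<lambda>(a, b). box a b)) \<Longrightarrow> B \<in> sets borel" for B :: "'a set"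
    by (simp add: borel_eq_box)
  have "(\<integral>x. indicator A x * h x \<partial>lborel) = 0"
  proof (rule sigma_sets_induct_disjoint[OF _ _ A])
    show "Int_stable (range (\<lambda>(a, b). box a b :: 'a set))"
      by (auto simp: Int_stable_def box_Int_box)
    show "range (\<lambda>(a, b). box a b) \<subseteq> Pow (UNIV :: 'a set)" by simp
    show "(\<integral>x. indicator B x * h x \<partial>lborel) = 0" if "B \<in> range (\<lambda>(a, b). box a b)" for B :: "'a set"
      using that z by auto
    show "(\<integral>x. indicator {} x * h x \<partial>lborel) = 0" by simp
    show "(\<integral>x. indicator (UNIV - B) x * h x \<partial>lborel) = 0"
      if B: "B \<in> sigma_sets UNIV (range (\<lambda>(a, b). box a b))" and e: "(\<integral>x. indicator B x * h x \<partial>lborel) = 0" for B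
    proof -
      have "(\<lambda>x. indicator (UNIV - B) x * h x) = (\<lambda>x. h x - indicator B x * h x)"
        by (auto simp: indicator_def)
      then show ?thesis using i[OF sb[OF B]] h e all by simp
    qed
    show "(\<integral>x. indicator (\<Union>i. B i) x * h x \<partial>lborel) = 0"
      if d: "disjoint_family B" and B: "range B \<subseteq> sigma_sets UNIV (range (\<lambda>(a, b). box a b))"
        and e: "\<And>i. (\<integral>x. indicator (B i) x * h x \<partial>lborel) = 0" for B :: "nat \<Rightarrow> 'a set"
    proof -
      have Bb: "B i \<in> sets borel" for i using sb B by blast
      have "set_lebesgue_integral lborel (\<Union>i. B i) h = (\<Sum>i. set_lebesgue_integral lborel (B i) h)"
        using d Bb h
        by (intro lebesgue_integral_countable_add)
          (auto simp: disjoint_family_on_def set_integrable_def intro!: i[simplified] sets.countable_UN)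
      then show ?thesis using e by (simp add: set_lebesgue_integral_def)
    qed
  qed
  then show "set_lebesgue_integral lborel A h = 0" by (simp add: set_lebesgue_integral_def)
qed

lemma integrable_restrict_lebesgue_on:
  fixes f :: "'a::euclidean_space \<Rightarrow> real"
  assumes "integrable lebesgue f" "\<Omega> \<in> sets lebesgue"
  shows "integrable (lebesgue_on \<Omega>) f"
  using assms integrable_mult_indicator[of \<Omega> lebesgue f] by (subst integrable_restrict_space) auto

lemma test_function_L2:
  assumes "\<phi> \<in> test_functions \<Omega>" "\<Omega> \<in> sets lebesgue"
  shows "\<phi> \<in> L2 \<Omega>"
proof -
  note [measurable] = test_function_measurable[OF assms(1)]
  have m: "\<phi> \<in> borel_measurable lborel" by simp
  have "(\<lambda>x. \<phi> x * \<phi> x) \<in> test_functions \<Omega>"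
    using assms(1) by (intro test_function_times) (auto simp: test_functions_def)
  then have "integrable lborel (\<lambda>x. (norm (\<phi> x))\<^sup>2)"
    using test_function_integrable by (fastforce simp: power2_eq_square)
  then have "integrable lebesgue (\<lambda>x. (norm (\<phi> x))\<^sup>2)"
    by (subst integrable_completion) auto
  then have "integrable (lebesgue_on \<Omega>) (\<lambda>x. (norm (\<phi> x))\<^sup>2)"
    by (rule integrable_restrict_lebesgue_on) (use assms in auto)
  moreover have "\<phi> \<in> borel_measurable (lebesgue_on \<Omega>)"
    using measurable_completion[OF m] measurable_restrict_space1 by blast
  ultimately show ?thesis unfolding L2_def by auto
qed

text \<open>Bumps recover the integral of \<open>h\<close> over every \<open>box a b\<close> with
  \<open>cbox a b\<close> in \<open>\<Omega>\<close>. This gives \<open>h = 0\<close> almost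
  everywhere on each such box, and countably many closed boxes cover the open set.\<close>

lemma fundamental_lemma:
  fixes h :: "'a::euclidean_space \<Rightarrow> real"
  assumes \<Omega>: "open \<Omega>" and h: "h \<in> L2 \<Omega>"
    and z: "\<And>\<phi>. \<phi> \<in> test_functions \<Omega> \<Longrightarrow> (\<integral>x. h x * \<phi> x \<partial>lebesgue_on \<Omega>) = 0"
  shows "AE x in lebesgue_on \<Omega>. h x = 0"
proof -
  have s[simp]: "\<Omega> \<in> sets lebesgue" using \<Omega> by simp
  note [measurable] = L2_D(1)[OF h]
  have box_L2: "(indicator (box a b) :: 'a \<Rightarrow> real) \<in> L2 \<Omega>" for a b
  proof -
    have "integrable lborel (indicator (box a b) :: 'a \<Rightarrow> real)"
      using emeasure_lborel_box_finite[of a b] by (intro integrable_real_indicator) auto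
    then have "integrable lebesgue (indicator (box a b) :: 'a \<Rightarrow> real)"
      by (subst integrable_completion) auto
    then have "integrable (lebesgue_on \<Omega>) (indicator (box a b) :: 'a \<Rightarrow> real)"
      by (rule integrable_restrict_lebesgue_on) simp
    moreover have "(\<lambda>x. (norm (indicator (box a b) x :: real))\<^sup>2) = indicator (box a b)"
      by (auto simp: indicator_def)
    ultimately show ?thesis unfolding L2_def by auto
  qed
  have box0: "(\<integral>x. indicator (box a b) x * h x \<partial>lebesgue_on \<Omega>) = 0" if "cbox a b \<subseteq> \<Omega>" for a b
  proof -
    have "(\<lambda>j. \<integral>x. h x * box_bump a b j x \<partial>lebesgue_on \<Omega>) \<longlonglongrightarrow> (\<integral>x. indicator (box a b) x * h x \<partial>lebesgue_on \<Omega>)"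
    proof (rule integral_dominated_convergence)
      show "integrable (lebesgue_on \<Omega>) (\<lambda>x. \<bar>h x * indicator (box a b) x\<bar>)"
        using integrable_mult_L2[OF h box_L2] by (rule integrable_abs)
      show "(\<lambda>x. indicator (box a b) x * h x) \<in> borel_measurable (lebesgue_on \<Omega>)"
        using borel_measurable_integrable[OF integrable_mult_L2[OF box_L2 h]] .
      show "(\<lambda>x. h x * box_bump a b j x) \<in> borel_measurable (lebesgue_on \<Omega>)" for j
        using borel_measurable_integrable[OF integrable_mult_L2[OF h test_function_L2[OF box_bump_test[OF that] s]]] .
      show "AE x in lebesgue_on \<Omega>. (\<lambda>j. h x * box_bump a b j x) \<longlonglongrightarrow> indicator (box a b) x * h x"
        using tendsto_mult[OF tendsto_const box_bump_tendsto] by (intro AE_I2) (simp add: mult.commute)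
      show "AE x in lebesgue_on \<Omega>. norm (h x * box_bump a b j x) \<le> \<bar>h x * indicator (box a b) x\<bar>" for j
      proof (rule AE_I2)
        fix x
        show "norm (h x * box_bump a b j x) \<le> \<bar>h x * indicator (box a b) x\<bar>"
          using box_bump_bounds[of a b j x] box_bump_eq_0[of x a b j]
          by (cases "x \<in> box a b") (auto simp: abs_mult mult_left_le)
      qed
    qed
    then show ?thesis using z[OF box_bump_test[OF that]] by (simp add: LIMSEQ_const_iff)
  qed
  \<comment> \<open>Cutting \<open>h\<close> off to a box extends it to an integrable function on
    the whole space. Its integral over any other box is one over an intersection of boxes, which is
    again a box inside \<open>\<Omega>\<close>.\<close>
  have *: "AE x in lebesgue. x \<in> box c d \<longrightarrow> h x = 0" if cd: "cbox c d \<subseteq> \<Omega>" for c d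
  proof -
    define H where "H x = indicator (box c d) x * h x" for x
    have ind: "indicator \<Omega> x *\<^sub>R (indicator (box c d) x * h x) = H x" for x
      using that box_subset_cbox by (auto simp: H_def indicator_def)
    have "integrable (lebesgue_on \<Omega>) (\<lambda>x. indicator (box c d) x * h x)"
      using integrable_mult_L2[OF box_L2 h] .
    then have H: "integrable lebesgue H"
      by (subst (asm) integrable_restrict_space) (simp_all only: ind s sets.Int_space_eq2)
    \<comment> \<open>The box criterion concerns integrability for \<open>lborel\<close>, so
      \<open>H\<close> is replaced by a Borel function equal to it almost everywhere.\<close>
    then obtain H' where H'[measurable]: "H' \<in> borel_measurable lborel" and ae: "AE x in lborel. H x = H' x"
      using completion_ex_borel_measurable_real by blast
    have ae': "AE x in lebesgue. H x = H' x" using ae by (rule AE_completion)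
    have m': "H' \<in> borel_measurable lebesgue" using H' by (rule measurable_completion)
    have "integrable lebesgue H'"
      using H ae' integrable_cong_AE[OF _ m' ae'] by auto
    then have iH': "integrable lborel H'"
      by (subst (asm) integrable_completion) auto
    have "AE x in lborel. H' x = 0"
    proof (rule AE_eq_0_if_box_integrals_0[OF iH'])
      fix a b
      obtain p q where pq: "box a b \<inter> box c d = box p q"
        by (simp add: box_Int_box)
      have "(\<integral>x. indicator (box a b) x * H' x \<partial>lborel) = (\<integral>x. indicator (box a b) x * H' x \<partial>lebesgue)"
        by (subst integral_completion) auto
      also have "\<dots> = (\<integral>x. indicator (box a b) x * H x \<partial>lebesgue)"
      proof (rule integral_cong_AE)
        show "(\<lambda>x. indicator (box a b) x * H' x) \<in> borel_measurable lebesgue"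
          by (rule measurable_completion) simp
        show "(\<lambda>x. indicator (box a b) x * H x) \<in> borel_measurable lebesgue"
          by (intro borel_measurable_times borel_measurable_integrable[OF H] measurable_completion) simp
      qed (use ae' in auto)
      also have "\<dots> = (\<integral>x. indicator \<Omega> x *\<^sub>R (indicator (box p q) x * h x) \<partial>lebesgue)"
        using pq by (intro Bochner_Integration.integral_cong refl) (simp add: ind[symmetric] pq[symmetric] indicator_inter_arith)
      also have "\<dots> = (\<integral>x. indicator (box p q) x * h x \<partial>lebesgue_on \<Omega>)"
        by (subst integral_restrict_space) auto
      also have "\<dots> = 0"
      \<comment> \<open>An empty \<open>box p q\<close> gives no control over
        \<open>cbox p q\<close>, which may be degenerate and lie outside \<open>\<Omega>\<close>;
        nonemptiness makes \<open>cbox p q\<close> the closure of the intersection.\<close>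
      proof (cases "box p q = {}")
        case False
        then have "cbox p q = closure (box p q)" by (simp add: closure_box)
        also have "\<dots> \<subseteq> cbox c d" using pq by (intro closure_minimal) (auto intro: subsetD[OF box_subset_cbox])
        finally show ?thesis using cd by (intro box0) auto
      qed simp
      finally show "(\<integral>x. indicator (box a b) x * H' x \<partial>lborel) = 0" .
    qed
    then have "AE x in lebesgue. H' x = 0" by (rule AE_completion)
    with ae' show ?thesis by eventually_elim (auto simp: H_def)
  qed
  obtain D where D: "countable D" "D \<subseteq> Pow \<Omega>" "\<And>X. X \<in> D \<Longrightarrow> \<exists>a b. X = cbox a b"
    and U: "\<Union>D = \<Omega>"
    using open_countable_Union_open_cbox[OF \<Omega>] by metis
  have "AE x in lebesgue. x \<in> X \<longrightarrow> h x = 0" if "X \<in> D" for X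
  proof -
    obtain c d where X: "X = cbox c d" using D(3) \<open>X \<in> D\<close> by blast
    \<comment> \<open>The closed boxes of the cover exceed the open ones by their faces, a null
      set.\<close>
    have "cbox c d - box c d \<in> null_sets lebesgue"
      using negligible_frontier_interval negligible_iff_null_sets by blast
    moreover have "cbox c d \<subseteq> \<Omega>" using D(2) that X by auto
    ultimately show ?thesis
      using AE_not_in * [of c d] unfolding X by fastforce
  qed
  then have "AE x in lebesgue. \<forall>X\<in>D. x \<in> X \<longrightarrow> h x = 0"
    unfolding AE_ball_countable[OF D(1)] by blast
  then have "AE x in lebesgue. x \<in> \<Omega> \<longrightarrow> h x = 0"
    by eventually_elim (use U in auto)
  then show ?thesis by (simp add: AE_restrict_space_iff)
qed

subsection \<open>Weak gradients\<close>

lemma has_weak_grad_partial: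
  "has_weak_grad \<Omega> v g \<longleftrightarrow> (\<forall>\<phi>\<in>test_functions \<Omega>. \<forall>i\<in>Basis.
     (\<integral>x. v x * partial i \<phi> x \<partial>lebesgue_on \<Omega>) = - (\<integral>x. (g x \<bullet> i) * \<phi> x \<partial>lebesgue_on \<Omega>))"
  by (simp add: has_weak_grad_def partial_def)

lemma L2_component: "g \<in> L2 \<Omega> \<Longrightarrow> i \<in> Basis \<Longrightarrow> (\<lambda>x. g x \<bullet> i) \<in> L2 \<Omega>"
proof -
  assume g: "g \<in> L2 \<Omega>" and i: "i \<in> Basis"
  note [measurable] = L2_D(1)[OF g]
  have "integrable (lebesgue_on \<Omega>) (\<lambda>x. (norm (g x \<bullet> i))\<^sup>2)"
  proof (rule Bochner_Integration.integrable_bound[OF L2_D(2)[OF g]])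
    show "AE x in lebesgue_on \<Omega>. norm ((norm (g x \<bullet> i))\<^sup>2) \<le> norm ((norm (g x))\<^sup>2)"
      using Basis_le_norm[OF i] by (intro AE_I2) (simp add: abs_le_square_iff[symmetric])
  qed measurable
  then show ?thesis unfolding L2_def by auto
qed

lemma has_weak_grad_unique:
  fixes v :: "'a::euclidean_space \<Rightarrow> real"
  assumes \<Omega>: "open \<Omega>" and g: "g \<in> L2 \<Omega>" "has_weak_grad \<Omega> v g" and h: "h \<in> L2 \<Omega>" "has_weak_grad \<Omega> v h"
  shows "AE x in lebesgue_on \<Omega>. g x = h x"
proof -
  have s: "\<Omega> \<in> sets lebesgue" using \<Omega> by simp
  have "AE x in lebesgue_on \<Omega>. g x \<bullet> i - h x \<bullet> i = 0" if i: "i \<in> Basis" for i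
  proof (rule fundamental_lemma[OF \<Omega>])
    show "(\<lambda>x. g x \<bullet> i - h x \<bullet> i) \<in> L2 \<Omega>" by (intro L2_diff L2_component g h i)
    fix \<phi> assume \<phi>: "\<phi> \<in> test_functions \<Omega>"
    have "integrable (lebesgue_on \<Omega>) (\<lambda>x. g x \<bullet> i * \<phi> x)" "integrable (lebesgue_on \<Omega>) (\<lambda>x. h x \<bullet> i * \<phi> x)"
      by (intro integrable_mult_L2 L2_component g h i test_function_L2 \<phi> s)+
    then show "(\<integral>x. (g x \<bullet> i - h x \<bullet> i) * \<phi> x \<partial>lebesgue_on \<Omega>) = 0"
      using g(2) h(2) \<phi> i unfolding has_weak_grad_partial by (simp add: left_diff_distrib)
  qed
  then have "AE x in lebesgue_on \<Omega>. \<forall>i\<in>Basis. g x \<bullet> i - h x \<bullet> i = 0"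
    by (simp add: AE_ball_countable countable_finite)
  then show ?thesis by eventually_elim (auto intro: euclidean_eqI)
qed

lemma has_weak_grad_add:
  assumes \<Omega>: "open \<Omega>" and "v \<in> L2 \<Omega>" "w \<in> L2 \<Omega>" "g \<in> L2 \<Omega>" "h \<in> L2 \<Omega>"
    and "has_weak_grad \<Omega> v g" "has_weak_grad \<Omega> w h"
  shows "has_weak_grad \<Omega> (\<lambda>x. v x + w x) (\<lambda>x. g x + h x)"
  unfolding has_weak_grad_partial
proof (intro ballI)
  fix \<phi> :: "'a \<Rightarrow> real" and i :: 'a assume \<phi>: "\<phi> \<in> test_functions \<Omega>" and i: "i \<in> Basis"
  have s: "\<Omega> \<in> sets lebesgue" using \<Omega> by simp
  have "integrable (lebesgue_on \<Omega>) (\<lambda>x. g x \<bullet> i * \<phi> x)" "integrable (lebesgue_on \<Omega>) (\<lambda>x. h x \<bullet> i * \<phi> x)"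
    "integrable (lebesgue_on \<Omega>) (\<lambda>x. v x * partial i \<phi> x)" "integrable (lebesgue_on \<Omega>) (\<lambda>x. w x * partial i \<phi> x)"
    by (intro integrable_mult_L2 L2_component assms i test_function_L2 partial_test_function \<phi> s)+
  then show "(\<integral>x. (v x + w x) * partial i \<phi> x \<partial>lebesgue_on \<Omega>)
      = - (\<integral>x. (g x + h x) \<bullet> i * \<phi> x \<partial>lebesgue_on \<Omega>)"
    using assms(6,7) \<phi> i unfolding has_weak_grad_partial by (simp add: distrib_right inner_add_left)
qed

lemma has_weak_grad_scale:
  assumes "has_weak_grad \<Omega> v g"
  shows "has_weak_grad \<Omega> (\<lambda>x. c * v x) (\<lambda>x. c *\<^sub>R g x)"
  using assms unfolding has_weak_grad_partial by (simp add: mult.assoc)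

lemma has_weak_grad_diff:
  assumes "open \<Omega>" "v \<in> L2 \<Omega>" "w \<in> L2 \<Omega>" "g \<in> L2 \<Omega>" "h \<in> L2 \<Omega>"
    "has_weak_grad \<Omega> v g" "has_weak_grad \<Omega> w h"
  shows "has_weak_grad \<Omega> (\<lambda>x. v x - w x) (\<lambda>x. g x - h x)"
  using has_weak_grad_add[OF assms(1,2) L2_scale[OF assms(3), of "-1"] assms(4) L2_scale[OF assms(5), of "-1"]
      assms(6)] has_weak_grad_scale[OF assms(7), of "-1"] by simp

text \<open>Both sides of the defining identity are inner products with fixed functions in L^2,
  hence continuous in \<open>v\<close> and \<open>g\<close>. So the weak gradient is a closed
  operator; limits of truncations obtain their gradients in this way.\<close>

lemma has_weak_grad_tendsto:
  assumes \<Omega>: "open \<Omega>" and v: "v \<in> L2 \<Omega>" "\<And>n. a n \<in> L2 \<Omega>" and g: "g \<in> L2 \<Omega>" "\<And>n. b n \<in> L2 \<Omega>"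
    and w: "\<And>n. has_weak_grad \<Omega> (a n) (b n)"
    and lim: "(\<lambda>n. L2_norm \<Omega> (\<lambda>x. a n x - v x)) \<longlonglongrightarrow> 0" "(\<lambda>n. L2_norm \<Omega> (\<lambda>x. b n x - g x)) \<longlonglongrightarrow> 0"
  shows "has_weak_grad \<Omega> v g"
  unfolding has_weak_grad_partial
proof (intro ballI)
  fix \<phi> :: "'a \<Rightarrow> real" and i :: 'a assume \<phi>: "\<phi> \<in> test_functions \<Omega>" and i: "i \<in> Basis"
  have s: "\<Omega> \<in> sets lebesgue" using \<Omega> by simp
  have \<phi>i: "(\<lambda>x. \<phi> x *\<^sub>R i) \<in> L2 \<Omega>"
    using test_function_L2[OF \<phi> s] i unfolding L2_def by auto
  have s1: "(\<lambda>n. L2_inner \<Omega> (a n) (partial i \<phi>)) \<longlonglongrightarrow> L2_inner \<Omega> v (partial i \<phi>)"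
    by (intro L2_inner_tendsto v lim test_function_L2[OF partial_test_function] \<phi> i s)
  have s2: "(\<lambda>n. L2_inner \<Omega> (b n) (\<lambda>x. \<phi> x *\<^sub>R i)) \<longlonglongrightarrow> L2_inner \<Omega> g (\<lambda>x. \<phi> x *\<^sub>R i)"
    by (intro L2_inner_tendsto g lim \<phi>i)
  have "L2_inner \<Omega> (a n) (partial i \<phi>) = - L2_inner \<Omega> (b n) (\<lambda>x. \<phi> x *\<^sub>R i)" for n
    using w[of n] \<phi> i unfolding has_weak_grad_partial L2_inner_def by (simp add: mult.commute)
  then have "L2_inner \<Omega> v (partial i \<phi>) = - L2_inner \<Omega> g (\<lambda>x. \<phi> x *\<^sub>R i)"
    using LIMSEQ_unique[OF s1] tendsto_minus[OF s2] by simp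
  then show "(\<integral>x. v x * partial i \<phi> x \<partial>lebesgue_on \<Omega>) = - (\<integral>x. g x \<bullet> i * \<phi> x \<partial>lebesgue_on \<Omega>)"
    unfolding L2_inner_def by (simp add: mult.commute)
qed

lemma cgrad_L2:
  assumes "\<phi> \<in> test_functions \<Omega>" "\<Omega> \<in> sets lebesgue"
  shows "cgrad \<phi> \<in> L2 \<Omega>"
proof -
  have z: "(\<lambda>x. 0) \<in> L2 \<Omega>" by (simp add: L2_def)
  have c: "(\<lambda>x. partial i \<phi> x *\<^sub>R i) \<in> L2 \<Omega>" if "i \<in> Basis" for i
    using test_function_L2[OF partial_test_function[OF assms(1) that] assms(2)] that unfolding L2_def by auto
  have "(\<lambda>x. \<Sum>i\<in>S. partial i \<phi> x *\<^sub>R i) \<in> L2 \<Omega>" if "finite S" "S \<subseteq> Basis" for S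
    using that by (induction S rule: finite_induct) (auto intro: z c L2_add)
  then show ?thesis by (simp add: cgrad_def)
qed

lemma cgrad_inner: "i \<in> Basis \<Longrightarrow> cgrad \<phi> x \<bullet> i = partial i \<phi> x"
  by (simp add: cgrad_def)

lemma integral_lebesgue_on_eq_lborel:
  fixes f :: "'a::euclidean_space \<Rightarrow> real"
  assumes "f \<in> borel_measurable borel" "\<Omega> \<in> sets lebesgue" "\<And>x. x \<notin> \<Omega> \<Longrightarrow> f x = 0"
  shows "(\<integral>x. f x \<partial>lebesgue_on \<Omega>) = (\<integral>x. f x \<partial>lborel)"
proof -
  have "(\<lambda>x. indicator \<Omega> x *\<^sub>R f x) = f" using assms(3) by (auto simp: indicator_def fun_eq_iff)
  then have "(\<integral>x. f x \<partial>lebesgue_on \<Omega>) = (\<integral>x. f x \<partial>lebesgue)"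
    using assms(2) by (subst integral_restrict_space) simp_all
  also have "\<dots> = (\<integral>x. f x \<partial>lborel)" using assms(1) by (subst integral_completion) auto
  finally show ?thesis .
qed

text \<open>The product of two test functions is a test function, so its partial derivative has
  integral zero, and the product rule turns this into integration by parts.\<close>

lemma has_weak_grad_cgrad:
  fixes \<phi> :: "'a::euclidean_space \<Rightarrow> real"
  assumes \<phi>: "\<phi> \<in> test_functions \<Omega>" and s: "\<Omega> \<in> sets lebesgue"
  shows "has_weak_grad \<Omega> \<phi> (cgrad \<phi>)"
  unfolding has_weak_grad_partial
proof (intro ballI)
  fix \<psi> :: "'a \<Rightarrow> real" and i :: 'a assume \<psi>: "\<psi> \<in> test_functions \<Omega>" and i: "i \<in> Basis"
  have t: "(\<lambda>x. \<phi> x * \<psi> x) \<in> test_functions \<Omega>"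
    using \<phi> \<psi> by (intro test_function_times) (auto simp: test_functions_def)
  have p: "partial i (\<lambda>x. \<phi> x * \<psi> x) = (\<lambda>x. \<phi> x * partial i \<psi> x + partial i \<phi> x * \<psi> x)"
    by (rule partial_eq) (intro has_derivative_mult test_function_differentiable[OF \<phi>] test_function_differentiable[OF \<psi>])
  have z: "(\<integral>x. partial i (\<lambda>x. \<phi> x * \<psi> x) x \<partial>lborel) = 0"
    by (rule integral_partial_eq_0[OF t i])
  have "(\<integral>x. partial i (\<lambda>x. \<phi> x * \<psi> x) x \<partial>lebesgue_on \<Omega>) = 0"
    using integral_lebesgue_on_eq_lborel[OF test_function_measurable[OF partial_test_function[OF t i]] s
        test_function_eq_0[OF partial_test_function[OF t i]]] z by simp
  moreover have "integrable (lebesgue_on \<Omega>) (\<lambda>x. \<phi> x * partial i \<psi> x)" "integrable (lebesgue_on \<Omega>) (\<lambda>x. partial i \<phi> x * \<psi> x)"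
    by (intro integrable_mult_L2 test_function_L2 partial_test_function \<phi> \<psi> i s)+
  ultimately show "(\<integral>x. \<phi> x * partial i \<psi> x \<partial>lebesgue_on \<Omega>) = - (\<integral>x. cgrad \<phi> x \<bullet> i * \<psi> x \<partial>lebesgue_on \<Omega>)"
    unfolding p by (simp add: cgrad_inner[OF i])
qed

subsection \<open>The Sobolev space\<close>

lemma wgrad_props:
  assumes "v \<in> H1 \<Omega>"
  shows "wgrad \<Omega> v \<in> L2 \<Omega>" "has_weak_grad \<Omega> v (wgrad \<Omega> v)"
  using assms someI_ex[of "\<lambda>g. g \<in> L2 \<Omega> \<and> has_weak_grad \<Omega> v g"] unfolding H1_def wgrad_def by blast+

lemma H1_I: "v \<in> L2 \<Omega> \<Longrightarrow> g \<in> L2 \<Omega> \<Longrightarrow> has_weak_grad \<Omega> v g \<Longrightarrow> v \<in> H1 \<Omega>"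
  unfolding H1_def by blast

lemma H1_L2: "v \<in> H1 \<Omega> \<Longrightarrow> v \<in> L2 \<Omega>"
  unfolding H1_def by blast

lemma wgrad_AE_eq:
  assumes "open \<Omega>" "v \<in> L2 \<Omega>" "g \<in> L2 \<Omega>" "has_weak_grad \<Omega> v g"
  shows "AE x in lebesgue_on \<Omega>. wgrad \<Omega> v x = g x"
  using has_weak_grad_unique[OF assms(1)] wgrad_props[OF H1_I[OF assms(2,3,4)]] assms(3,4) by blast

text \<open>\<open>wgrad\<close> is a choice among functions that agree almost everywhere, so any
  weak gradient in L^2 computes the norm.\<close>

lemma H1_norm_eq:
  assumes "open \<Omega>" "v \<in> L2 \<Omega>" "g \<in> L2 \<Omega>" "has_weak_grad \<Omega> v g"
  shows "H1_norm \<Omega> v = sqrt ((L2_norm \<Omega> v)\<^sup>2 + (L2_norm \<Omega> g)\<^sup>2)"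
  unfolding H1_norm_def
  using L2_norm_AE_cong[OF wgrad_props(1)[OF H1_I[OF assms(2,3,4)]] assms(3) wgrad_AE_eq[OF assms]] by simp

lemma H1_norm_nonneg: "0 \<le> H1_norm \<Omega> v"
  by (simp add: H1_norm_def)

lemma H1_norm_le:
  assumes "open \<Omega>" "v \<in> L2 \<Omega>" "g \<in> L2 \<Omega>" "has_weak_grad \<Omega> v g"
  shows "H1_norm \<Omega> v \<le> L2_norm \<Omega> v + L2_norm \<Omega> g"
  unfolding H1_norm_eq[OF assms] by (intro sqrt_sum_squares_le_sum L2_norm_nonneg)

lemma L2_norm_le_H1_norm: "L2_norm \<Omega> v \<le> H1_norm \<Omega> v" "L2_norm \<Omega> (wgrad \<Omega> v) \<le> H1_norm \<Omega> v"
  unfolding H1_norm_def by (auto intro: real_le_rsqrt)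

lemma H1_add: "open \<Omega> \<Longrightarrow> v \<in> H1 \<Omega> \<Longrightarrow> w \<in> H1 \<Omega> \<Longrightarrow> (\<lambda>x. v x + w x) \<in> H1 \<Omega>"
  by (rule H1_I[OF L2_add L2_add[of "wgrad \<Omega> v" \<Omega> "wgrad \<Omega> w"] has_weak_grad_add])
    (auto intro: H1_L2 wgrad_props)

lemma H1_scale: "v \<in> H1 \<Omega> \<Longrightarrow> (\<lambda>x. c * v x) \<in> H1 \<Omega>"
  using H1_I[OF L2_scale[of v \<Omega> c, unfolded real_scaleR_def] L2_scale has_weak_grad_scale]
  by (blast intro: H1_L2 wgrad_props)

lemma H1_diff: "open \<Omega> \<Longrightarrow> v \<in> H1 \<Omega> \<Longrightarrow> w \<in> H1 \<Omega> \<Longrightarrow> (\<lambda>x. v x - w x) \<in> H1 \<Omega>"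
  using H1_add[of \<Omega> v "\<lambda>x. -1 * w x"] H1_scale[of w \<Omega> "-1"] by simp

lemma H1_norm_scale:
  assumes "open \<Omega>" "v \<in> H1 \<Omega>"
  shows "H1_norm \<Omega> (\<lambda>x. c * v x) = \<bar>c\<bar> * H1_norm \<Omega> v"
proof -
  have "H1_norm \<Omega> (\<lambda>x. c * v x) = sqrt ((L2_norm \<Omega> (\<lambda>x. c *\<^sub>R v x))\<^sup>2 + (L2_norm \<Omega> (\<lambda>x. c *\<^sub>R wgrad \<Omega> v x))\<^sup>2)"
    using H1_norm_eq[OF assms(1) H1_L2[OF H1_scale[OF assms(2)]] L2_scale has_weak_grad_scale]
      wgrad_props[OF assms(2)] by simp
  also have "\<dots> = sqrt (c\<^sup>2 * ((L2_norm \<Omega> v)\<^sup>2 + (L2_norm \<Omega> (wgrad \<Omega> v))\<^sup>2))"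
    unfolding L2_norm_scale by (simp add: power_mult_distrib distrib_left)
  also have "\<dots> = \<bar>c\<bar> * H1_norm \<Omega> v"
    by (simp add: real_sqrt_mult H1_norm_def)
  finally show ?thesis .
qed

lemma H1_norm_minus_commute:
  assumes "open \<Omega>" "v \<in> H1 \<Omega>" "w \<in> H1 \<Omega>"
  shows "H1_norm \<Omega> (\<lambda>x. v x - w x) = H1_norm \<Omega> (\<lambda>x. w x - v x)"
  using H1_norm_scale[OF assms(1) H1_diff[OF assms], of "-1"] by simp

lemma H1_norm_triangle:
  assumes \<Omega>: "open \<Omega>" and v: "v \<in> H1 \<Omega>" and w: "w \<in> H1 \<Omega>"
  shows "H1_norm \<Omega> (\<lambda>x. v x + w x) \<le> H1_norm \<Omega> v + H1_norm \<Omega> w"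
proof -
  have "H1_norm \<Omega> (\<lambda>x. v x + w x)
      = sqrt ((L2_norm \<Omega> (\<lambda>x. v x + w x))\<^sup>2 + (L2_norm \<Omega> (\<lambda>x. wgrad \<Omega> v x + wgrad \<Omega> w x))\<^sup>2)"
    by (intro H1_norm_eq L2_add has_weak_grad_add \<Omega> H1_L2 wgrad_props v w)
  also have "\<dots> \<le> sqrt ((L2_norm \<Omega> v + L2_norm \<Omega> w)\<^sup>2 + (L2_norm \<Omega> (wgrad \<Omega> v) + L2_norm \<Omega> (wgrad \<Omega> w))\<^sup>2)"
    by (intro real_sqrt_le_mono add_mono power_mono L2_norm_triangle H1_L2 wgrad_props v w L2_norm_nonneg)
  also have "\<dots> \<le> H1_norm \<Omega> v + H1_norm \<Omega> w"
    unfolding H1_norm_def by (rule real_sqrt_sum_squares_triangle_ineq)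
  finally show ?thesis .
qed

lemma H1_norm_triangle_diff:
  assumes "open \<Omega>" "v \<in> H1 \<Omega>" "w \<in> H1 \<Omega>" "z \<in> H1 \<Omega>"
  shows "H1_norm \<Omega> (\<lambda>x. v x - z x) \<le> H1_norm \<Omega> (\<lambda>x. v x - w x) + H1_norm \<Omega> (\<lambda>x. w x - z x)"
  using H1_norm_triangle[OF assms(1) H1_diff[OF assms(1,2,3)] H1_diff[OF assms(1,3,4)]] by simp

lemma H1_norm_le_diff:
  assumes "open \<Omega>" "v \<in> H1 \<Omega>" "w \<in> H1 \<Omega>"
  shows "\<bar>H1_norm \<Omega> v - H1_norm \<Omega> w\<bar> \<le> H1_norm \<Omega> (\<lambda>x. v x - w x)"
  using H1_norm_triangle[OF assms(1) H1_diff[OF assms] assms(3)]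
    H1_norm_triangle[OF assms(1) H1_diff[OF assms(1,3,2)] assms(2)] H1_norm_minus_commute[OF assms] by simp

lemma test_function_H1:
  assumes "\<phi> \<in> test_functions \<Omega>" "open \<Omega>"
  shows "\<phi> \<in> H1 \<Omega>"
  by (rule H1_I[OF test_function_L2 cgrad_L2 has_weak_grad_cgrad]) (use assms in auto)

lemma zero_H1: "(\<lambda>x. 0) \<in> H1 \<Omega>"
  by (rule H1_I[of _ _ "\<lambda>x. 0"]) (simp_all add: L2_def has_weak_grad_def)

lemma H1_norm_zero: "open \<Omega> \<Longrightarrow> H1_norm \<Omega> (\<lambda>x. 0) = 0"
  using H1_norm_scale[OF _ zero_H1, of \<Omega> 0] by simp

lemma test_function_H10:
  assumes "\<phi> \<in> test_functions \<Omega>" "open \<Omega>"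
  shows "\<phi> \<in> H10 \<Omega>"
proof -
  have "\<phi> - \<phi> = (\<lambda>x. 0)" by (simp add: fun_eq_iff)
  then show ?thesis
    unfolding H10_def using test_function_H1[OF assms] assms H1_norm_zero[OF assms(2)]
    by (auto intro!: exI[of _ "\<lambda>n. \<phi>"])
qed

subsection \<open>The dual of the Sobolev space\<close>

lemma Hm1_D:
  assumes "l \<in> Hm1 \<Omega>"
  shows "\<And>v w. v \<in> H1 \<Omega> \<Longrightarrow> w \<in> H1 \<Omega> \<Longrightarrow> l (\<lambda>x. v x + w x) = l v + l w"
    "\<And>c v. v \<in> H1 \<Omega> \<Longrightarrow> l (\<lambda>x. c * v x) = c * l v"
  using assms unfolding Hm1_def by auto

lemma Hm1_bdd_above:
  assumes "l \<in> Hm1 \<Omega>"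
  shows "bdd_above ((\<lambda>v. \<bar>l v\<bar>) ` {v \<in> H1 \<Omega>. H1_norm \<Omega> v \<le> 1})"
proof -
  obtain C where C: "\<And>v. v \<in> H1 \<Omega> \<Longrightarrow> \<bar>l v\<bar> \<le> C * H1_norm \<Omega> v"
    using assms unfolding Hm1_def by blast
  show ?thesis
  proof (rule bdd_aboveI2)
    fix z assume z: "z \<in> {v \<in> H1 \<Omega>. H1_norm \<Omega> v \<le> 1}"
    then have "\<bar>l z\<bar> \<le> C * H1_norm \<Omega> z" using C by blast
    also have "\<dots> \<le> \<bar>C\<bar> * 1" using z H1_norm_nonneg[of \<Omega> z] by (intro mult_mono) auto
    finally show "\<bar>l z\<bar> \<le> \<bar>C\<bar> * 1" .
  qed
qed

lemma Hm1_norm_nonneg: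
  assumes "open \<Omega>" "l \<in> Hm1 \<Omega>"
  shows "0 \<le> Hm1_norm \<Omega> l"
proof -
  have "\<bar>l (\<lambda>x. 0)\<bar> \<le> Hm1_norm \<Omega> l"
    unfolding Hm1_norm_def
    by (rule cSUP_upper[OF _ Hm1_bdd_above[OF assms(2)]]) (simp add: zero_H1 H1_norm_zero[OF assms(1)])
  then show ?thesis by linarith
qed

lemma Hm1_bound:
  assumes \<Omega>: "open \<Omega>" and l: "l \<in> Hm1 \<Omega>" and v: "v \<in> H1 \<Omega>"
  shows "\<bar>l v\<bar> \<le> Hm1_norm \<Omega> l * H1_norm \<Omega> v"
proof (cases "H1_norm \<Omega> v = 0")
  case True
  \<comment> \<open>\<open>v\<close> cannot be normalised here; the bound in the definition of
    \<open>Hm1\<close> forces \<open>l v = 0\<close> instead.\<close>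
  then show ?thesis using l v unfolding Hm1_def by force
next
  case False
  then have pos: "H1_norm \<Omega> v > 0" using H1_norm_nonneg[of \<Omega> v] by linarith
  let ?w = "\<lambda>x. inverse (H1_norm \<Omega> v) * v x"
  have w: "?w \<in> {v \<in> H1 \<Omega>. H1_norm \<Omega> v \<le> 1}"
    using pos by (simp add: H1_scale v H1_norm_scale[OF \<Omega> v])
  have "\<bar>l ?w\<bar> \<le> Hm1_norm \<Omega> l"
    unfolding Hm1_norm_def by (rule cSUP_upper[OF w Hm1_bdd_above[OF l]])
  then have "inverse (H1_norm \<Omega> v) * \<bar>l v\<bar> \<le> Hm1_norm \<Omega> l"
    using pos by (simp only: Hm1_D(2)[OF l v] abs_mult abs_inverse abs_of_pos)
  then show ?thesis using pos by (simp add: field_simps)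
qed

lemma Hm1_diff:
  assumes "open \<Omega>" "l \<in> Hm1 \<Omega>" "v \<in> H1 \<Omega>" "w \<in> H1 \<Omega>"
  shows "l (\<lambda>x. v x - w x) = l v - l w"
  using Hm1_D(1)[OF assms(2,3) H1_scale[OF assms(4), of "-1"]] Hm1_D(2)[OF assms(2,4), of "-1"] by simp

lemma Hm1_minus:
  assumes l: "l \<in> Hm1 \<Omega>" and m: "m \<in> Hm1 \<Omega>"
  shows "l - m \<in> Hm1 \<Omega>"
proof -
  obtain C where C: "\<And>v. v \<in> H1 \<Omega> \<Longrightarrow> \<bar>l v\<bar> \<le> C * H1_norm \<Omega> v" using l unfolding Hm1_def by blast
  obtain D where D: "\<And>v. v \<in> H1 \<Omega> \<Longrightarrow> \<bar>m v\<bar> \<le> D * H1_norm \<Omega> v" using m unfolding Hm1_def by blast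
  have "\<bar>(l - m) v\<bar> \<le> (C + D) * H1_norm \<Omega> v" if "v \<in> H1 \<Omega>" for v
    using C[OF that] D[OF that] by (simp add: distrib_right)
  then show ?thesis
    unfolding Hm1_def using Hm1_D[OF l] Hm1_D[OF m] by (auto simp: right_diff_distrib)
qed

subsection \<open>Testing the equation with the solution itself\<close>

lemma L2_bounded_mult:
  fixes G :: "'a::euclidean_space \<Rightarrow> 'b::euclidean_space"
  assumes c: "c \<in> borel_measurable (lebesgue_on \<Omega>)" "\<And>x. \<bar>c x\<bar> \<le> M" and G: "G \<in> L2 \<Omega>"
  shows "(\<lambda>x. c x *\<^sub>R G x) \<in> L2 \<Omega>" "L2_norm \<Omega> (\<lambda>x. c x *\<^sub>R G x) \<le> M * L2_norm \<Omega> G"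
proof -
  note [measurable] = c(1) L2_D(1)[OF G]
  have M: "0 \<le> M" using c(2) abs_ge_zero order_trans by blast
  have le: "(norm (c x *\<^sub>R G x))\<^sup>2 \<le> M\<^sup>2 * (norm (G x))\<^sup>2" for x
    unfolding norm_scaleR power_mult_distrib
    using c(2)[of x] by (intro mult_right_mono) (auto simp: abs_le_square_iff[symmetric])
  have i: "integrable (lebesgue_on \<Omega>) (\<lambda>x. (norm (c x *\<^sub>R G x))\<^sup>2)"
  proof (rule Bochner_Integration.integrable_bound)
    show "integrable (lebesgue_on \<Omega>) (\<lambda>x. M\<^sup>2 * (norm (G x))\<^sup>2)" using L2_D(2)[OF G] by simp
    show "AE x in lebesgue_on \<Omega>. norm ((norm (c x *\<^sub>R G x))\<^sup>2) \<le> norm (M\<^sup>2 * (norm (G x))\<^sup>2)"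
      using le by (intro AE_I2) simp
  qed measurable
  then show *: "(\<lambda>x. c x *\<^sub>R G x) \<in> L2 \<Omega>" unfolding L2_def by simp
  have "(L2_norm \<Omega> (\<lambda>x. c x *\<^sub>R G x))\<^sup>2 \<le> (M * L2_norm \<Omega> G)\<^sup>2"
    unfolding power_mult_distrib L2_norm_square_integral integral_mult_right_zero[symmetric]
    using L2_D(2)[OF G] le i by (intro integral_mono) auto
  then show "L2_norm \<Omega> (\<lambda>x. c x *\<^sub>R G x) \<le> M * L2_norm \<Omega> G"
    by (rule power2_le_imp_le) (intro mult_nonneg_nonneg M L2_norm_nonneg)
qed

text \<open>Split c_n G_n - d g into c_n (G_n - g) + (c_n - d) g. The uniform bound handles the
  first term and dominated convergence the second. The coefficients converge only almost everywhere
  because this is all that is known for the factors in the gradient of a truncation.\<close>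

lemma L2_mult_tendsto:
  fixes g :: "'a::euclidean_space \<Rightarrow> 'b::euclidean_space"
  assumes c: "\<And>n. c n \<in> borel_measurable (lebesgue_on \<Omega>)" "\<And>n x. \<bar>c n x\<bar> \<le> M"
    and d: "d \<in> borel_measurable (lebesgue_on \<Omega>)" "\<And>x. \<bar>d x\<bar> \<le> M"
    and lim: "AE x in lebesgue_on \<Omega>. (\<lambda>n. c n x) \<longlonglongrightarrow> d x"
    and G: "\<And>n. G n \<in> L2 \<Omega>" and g: "g \<in> L2 \<Omega>" and Gg: "(\<lambda>n. L2_norm \<Omega> (\<lambda>x. G n x - g x)) \<longlonglongrightarrow> 0"
  shows "(\<lambda>n. L2_norm \<Omega> (\<lambda>x. c n x *\<^sub>R G n x - d x *\<^sub>R g x)) \<longlonglongrightarrow> 0"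
proof -
  note [measurable] = c(1) d(1) L2_D(1)[OF g]
  have cd: "\<bar>c n x - d x\<bar> \<le> 2 * M" for n x using c(2)[of n x] d(2)[of x] by linarith
  have m: "(\<lambda>x. c n x - d x) \<in> borel_measurable (lebesgue_on \<Omega>)" for n by measurable
  have "(\<lambda>n. \<integral>x. (norm ((c n x - d x) *\<^sub>R g x))\<^sup>2 \<partial>lebesgue_on \<Omega>) \<longlonglongrightarrow> (\<integral>x. 0 \<partial>lebesgue_on \<Omega>)"
  proof (rule integral_dominated_convergence)
    show "integrable (lebesgue_on \<Omega>) (\<lambda>x. (2 * M)\<^sup>2 * (norm (g x))\<^sup>2)" using L2_D(2)[OF g] by simp
    show "AE x in lebesgue_on \<Omega>. (\<lambda>n. (norm ((c n x - d x) *\<^sub>R g x))\<^sup>2) \<longlonglongrightarrow> 0"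
      using lim
    proof eventually_elim
      case (elim x)
      have "(\<lambda>n. (norm ((c n x - d x) *\<^sub>R g x))\<^sup>2) \<longlonglongrightarrow> (norm ((d x - d x) *\<^sub>R g x))\<^sup>2"
        by (intro tendsto_intros elim)
      then show ?case by simp
    qed
    show "AE x in lebesgue_on \<Omega>. norm ((norm ((c n x - d x) *\<^sub>R g x))\<^sup>2) \<le> (2 * M)\<^sup>2 * (norm (g x))\<^sup>2" for n
    proof (rule AE_I2)
      fix x
      have "\<bar>c n x - d x\<bar>\<^sup>2 \<le> (2 * M)\<^sup>2" using cd[of n x] by (intro power_mono) auto
      then show "norm ((norm ((c n x - d x) *\<^sub>R g x))\<^sup>2) \<le> (2 * M)\<^sup>2 * (norm (g x))\<^sup>2"
        by (simp add: power_mult_distrib mult_right_mono)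
    qed
  qed measurable
  then have "(\<lambda>n. sqrt ((L2_norm \<Omega> (\<lambda>x. (c n x - d x) *\<^sub>R g x))\<^sup>2)) \<longlonglongrightarrow> sqrt 0"
    unfolding L2_norm_square_integral by (intro tendsto_real_sqrt) simp
  then have l2: "(\<lambda>n. L2_norm \<Omega> (\<lambda>x. (c n x - d x) *\<^sub>R g x)) \<longlonglongrightarrow> 0"
    by (simp add: L2_norm_nonneg)
  show ?thesis
  proof (rule Lim_null_comparison)
    show "(\<lambda>n. M * L2_norm \<Omega> (\<lambda>x. G n x - g x) + L2_norm \<Omega> (\<lambda>x. (c n x - d x) *\<^sub>R g x)) \<longlonglongrightarrow> 0"
      using tendsto_add[OF tendsto_mult[OF tendsto_const Gg] l2] by simp
    show "\<forall>\<^sub>F n in sequentially. norm (L2_norm \<Omega> (\<lambda>x. c n x *\<^sub>R G n x - d x *\<^sub>R g x))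
        \<le> M * L2_norm \<Omega> (\<lambda>x. G n x - g x) + L2_norm \<Omega> (\<lambda>x. (c n x - d x) *\<^sub>R g x)"
    proof (intro always_eventually allI)
      fix n
      have Gn: "(\<lambda>x. G n x - g x) \<in> L2 \<Omega>" by (intro L2_diff G g)
      have "(\<lambda>x. c n x *\<^sub>R G n x - d x *\<^sub>R g x) = (\<lambda>x. c n x *\<^sub>R (G n x - g x) + (c n x - d x) *\<^sub>R g x)"
        by (simp add: algebra_simps)
      then show "norm (L2_norm \<Omega> (\<lambda>x. c n x *\<^sub>R G n x - d x *\<^sub>R g x))
        \<le> M * L2_norm \<Omega> (\<lambda>x. G n x - g x) + L2_norm \<Omega> (\<lambda>x. (c n x - d x) *\<^sub>R g x)"
        using L2_norm_triangle[OF L2_bounded_mult(1)[OF c Gn, of n] L2_bounded_mult(1)[OF m cd g, of n]]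
          L2_bounded_mult(2)[OF c Gn, of n] by (simp add: L2_norm_nonneg)
    qed
  qed
qed

text \<open>A smooth substitute for the smaller of two numbers of equal sign: it is dominated by both
  arguments, close to the identity on the diagonal, and has bounded derivatives.\<close>

definition tden :: "real \<Rightarrow> real \<Rightarrow> real \<Rightarrow> real" where
  "tden \<epsilon> a b = a * a + b * b + \<epsilon>"

definition tcoef :: "real \<Rightarrow> real \<Rightarrow> real \<Rightarrow> real" where
  "tcoef \<epsilon> a b = 2 * b * b * inverse (tden \<epsilon> a b)"

definition trunc :: "real \<Rightarrow> real \<Rightarrow> real \<Rightarrow> real" where
  "trunc \<epsilon> a b = a * tcoef \<epsilon> a b"

text \<open>\<open>trunc1\<close> and \<open>trunc2\<close> are the partial derivatives of
  \<open>trunc\<close> in \<open>a\<close> and \<open>b\<close>, arranged as polynomials in the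
  quotients 2 b^2 / D and 2 a b / D with D = \<open>tden \<epsilon> a b\<close>. These quotients are
  bounded by 2 and 1, so the derivatives are bounded uniformly in \<epsilon>.\<close>

definition trunc1 :: "real \<Rightarrow> real \<Rightarrow> real \<Rightarrow> real" where
  "trunc1 \<epsilon> a b = tcoef \<epsilon> a b - (2 * a * b * inverse (tden \<epsilon> a b))\<^sup>2"

definition trunc2 :: "real \<Rightarrow> real \<Rightarrow> real \<Rightarrow> real" where
  "trunc2 \<epsilon> a b = 2 * a * b * inverse (tden \<epsilon> a b) * (2 - tcoef \<epsilon> a b)"

lemma tden_pos: "\<epsilon> > 0 \<Longrightarrow> 0 < tden \<epsilon> a b"
  unfolding tden_def by (intro add_nonneg_pos add_nonneg_nonneg) auto

lemma tcoef_bounds: "\<epsilon> > 0 \<Longrightarrow> 0 \<le> tcoef \<epsilon> a b" "\<epsilon> > 0 \<Longrightarrow> tcoef \<epsilon> a b \<le> 2"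
proof -
  assume e: "\<epsilon> > 0"
  show "0 \<le> tcoef \<epsilon> a b"
    using mult_nonneg_nonneg[OF zero_le_square[of b], of "inverse (tden \<epsilon> a b)"] tden_pos[OF e, of a b]
    unfolding tcoef_def by (simp add: mult.assoc)
  have "b * b \<le> tden \<epsilon> a b" using e unfolding tden_def by simp
  then show "tcoef \<epsilon> a b \<le> 2"
    using tden_pos[OF e, of a b] unfolding tcoef_def by (simp add: field_simps)
qed

lemma tcross_bound: "\<epsilon> > 0 \<Longrightarrow> \<bar>2 * a * b * inverse (tden \<epsilon> a b)\<bar> \<le> 1"
proof -
  assume e: "\<epsilon> > 0"
  have "\<bar>2 * a * b\<bar> \<le> a\<^sup>2 + b\<^sup>2"
    using sum_squares_bound[of "\<bar>a\<bar>" "\<bar>b\<bar>"] by (simp add: abs_mult)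
  also have "\<dots> \<le> tden \<epsilon> a b" using e by (simp add: tden_def power2_eq_square)
  finally show ?thesis
    using tden_pos[OF e, of a b] unfolding abs_mult[of _ "inverse _"] by (simp add: field_simps)
qed

lemma trunc_bounds:
  assumes "\<epsilon> > 0"
  shows "\<bar>trunc \<epsilon> a b\<bar> \<le> \<bar>b\<bar>" "\<bar>trunc \<epsilon> a b\<bar> \<le> 2 * \<bar>a\<bar>"
proof -
  have "trunc \<epsilon> a b = (2 * a * b * inverse (tden \<epsilon> a b)) * b"
    by (simp add: trunc_def tcoef_def)
  then show "\<bar>trunc \<epsilon> a b\<bar> \<le> \<bar>b\<bar>"
    using mult_right_mono[OF tcross_bound[OF assms, of a b] abs_ge_zero[of b]] by (simp only: abs_mult mult_1)
  show "\<bar>trunc \<epsilon> a b\<bar> \<le> 2 * \<bar>a\<bar>"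
    using mult_right_mono[OF tcoef_bounds(2)[OF assms, of a b] abs_ge_zero[of a]] tcoef_bounds(1)[OF assms, of a b]
    by (simp add: trunc_def abs_mult mult.commute)
qed

lemma trunc1_bound: "\<epsilon> > 0 \<Longrightarrow> \<bar>trunc1 \<epsilon> a b\<bar> \<le> 2"
proof -
  assume e: "\<epsilon> > 0"
  have "(2 * a * b * inverse (tden \<epsilon> a b))\<^sup>2 \<le> 1"
    using power_mono[OF tcross_bound[OF e, of a b], of 2] by simp
  then show ?thesis
    unfolding trunc1_def using tcoef_bounds[OF e, of a b] zero_le_power2[of "2 * a * b * inverse (tden \<epsilon> a b)"]
    by linarith
qed

lemma trunc2_bound: "\<epsilon> > 0 \<Longrightarrow> \<bar>trunc2 \<epsilon> a b\<bar> \<le> 2"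
proof -
  assume e: "\<epsilon> > 0"
  have "\<bar>2 * a * b * inverse (tden \<epsilon> a b)\<bar> * \<bar>2 - tcoef \<epsilon> a b\<bar> \<le> 1 * 2"
    using tcross_bound[OF e, of a b] tcoef_bounds[OF e, of a b] by (intro mult_mono) auto
  then show ?thesis unfolding trunc2_def abs_mult by simp
qed

lemma trunc_has_derivative:
  assumes e: "\<epsilon> > 0" and \<phi>: "(\<phi> has_derivative \<phi>') (at x)" and \<psi>: "(\<psi> has_derivative \<psi>') (at x)"
  shows "((\<lambda>x. trunc \<epsilon> (\<phi> x) (\<psi> x)) has_derivative
    (\<lambda>h. trunc1 \<epsilon> (\<phi> x) (\<psi> x) * \<phi>' h + trunc2 \<epsilon> (\<phi> x) (\<psi> x) * \<psi>' h)) (at x)"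
proof -
  have nz: "\<phi> x * \<phi> x + \<psi> x * \<psi> x + \<epsilon> \<noteq> 0" using tden_pos[OF e, of "\<phi> x" "\<psi> x"] by (simp add: tden_def)
  show ?thesis
    unfolding trunc_def tcoef_def tden_def
    by (rule has_derivative_eq_rhs, (rule derivative_intros \<phi> \<psi> nz)+)
      (simp add: fun_eq_iff trunc1_def trunc2_def tcoef_def tden_def algebra_simps power2_eq_square)
qed

lemma trunc_test_function:
  assumes e: "\<epsilon> > 0" and \<phi>: "\<phi> \<in> test_functions \<Omega>" and \<psi>: "\<psi> \<in> test_functions \<Omega>"
  shows "(\<lambda>x. trunc \<epsilon> (\<phi> x) (\<psi> x)) \<in> test_functions \<Omega>"
  unfolding trunc_def
proof (rule test_function_times[OF \<phi>])
  fix k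
  have k: "Ck k \<phi>" "Ck k \<psi>" using \<phi> \<psi> by (auto simp: test_functions_def)
  have "tden \<epsilon> (\<phi> x) (\<psi> x) \<noteq> 0" for x using tden_pos[OF e, of "\<phi> x" "\<psi> x"] by simp
  then show "Ck k (\<lambda>x. tcoef \<epsilon> (\<phi> x) (\<psi> x))"
    unfolding tcoef_def tden_def by (intro Ck_mult Ck_inverse Ck_add Ck_const k) auto
qed

lemma trunc_cgrad:
  assumes e: "\<epsilon> > 0" and \<phi>: "\<phi> \<in> test_functions \<Omega>" and \<psi>: "\<psi> \<in> test_functions \<Omega>"
  shows "cgrad (\<lambda>x. trunc \<epsilon> (\<phi> x) (\<psi> x)) =
    (\<lambda>x. trunc1 \<epsilon> (\<phi> x) (\<psi> x) *\<^sub>R cgrad \<phi> x + trunc2 \<epsilon> (\<phi> x) (\<psi> x) *\<^sub>R cgrad \<psi> x)"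
  unfolding cgrad_def
    partial_eq[OF trunc_has_derivative[OF e test_function_differentiable[OF \<phi>] test_function_differentiable[OF \<psi>]]]
  by (simp add: scaleR_sum_right scaleR_add_left sum.distrib)

lemma trunc_tendsto:
  assumes "\<epsilon> > 0" "(f \<longlongrightarrow> a) F" "(g \<longlongrightarrow> b) F"
  shows "((\<lambda>n. tcoef \<epsilon> (f n) (g n)) \<longlongrightarrow> tcoef \<epsilon> a b) F" "((\<lambda>n. trunc \<epsilon> (f n) (g n)) \<longlongrightarrow> trunc \<epsilon> a b) F"
    "((\<lambda>n. trunc1 \<epsilon> (f n) (g n)) \<longlongrightarrow> trunc1 \<epsilon> a b) F" "((\<lambda>n. trunc2 \<epsilon> (f n) (g n)) \<longlongrightarrow> trunc2 \<epsilon> a b) F"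
proof -
  have d: "((\<lambda>n. inverse (tden \<epsilon> (f n) (g n))) \<longlongrightarrow> inverse (tden \<epsilon> a b)) F"
    using tden_pos[OF assms(1), of a b] unfolding tden_def by (intro tendsto_intros assms) auto
  show c: "((\<lambda>n. tcoef \<epsilon> (f n) (g n)) \<longlongrightarrow> tcoef \<epsilon> a b) F"
    unfolding tcoef_def by (intro tendsto_intros assms d)
  show "((\<lambda>n. trunc \<epsilon> (f n) (g n)) \<longlongrightarrow> trunc \<epsilon> a b) F"
    "((\<lambda>n. trunc1 \<epsilon> (f n) (g n)) \<longlongrightarrow> trunc1 \<epsilon> a b) F" "((\<lambda>n. trunc2 \<epsilon> (f n) (g n)) \<longlongrightarrow> trunc2 \<epsilon> a b) F"
    unfolding trunc_def trunc1_def trunc2_def by (intro tendsto_intros assms d c)+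
qed

lemma trunc_measurable [measurable]:
  assumes [measurable]: "f \<in> borel_measurable M" "g \<in> borel_measurable M"
  shows "(\<lambda>x. tcoef \<epsilon> (f x) (g x)) \<in> borel_measurable M" "(\<lambda>x. trunc \<epsilon> (f x) (g x)) \<in> borel_measurable M"
    "(\<lambda>x. trunc1 \<epsilon> (f x) (g x)) \<in> borel_measurable M" "(\<lambda>x. trunc2 \<epsilon> (f x) (g x)) \<in> borel_measurable M"
  unfolding trunc_def trunc1_def trunc2_def tcoef_def tden_def by measurable

text \<open>On the diagonal the coefficient is 2 b^2 / (2 b^2 + \<epsilon>). It is 0 at
  \<open>b = 0\<close> for every \<epsilon>, so in the limit the truncation keeps the function, but
  its gradient only where the function is nonzero.\<close>

lemma trunc_diagonal_tendsto:
  fixes b :: real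
  shows "(\<lambda>k. tcoef (1 / Suc k) b b) \<longlonglongrightarrow> of_bool (b \<noteq> 0)"
    "(\<lambda>k. trunc1 (1 / Suc k) b b + trunc2 (1 / Suc k) b b) \<longlonglongrightarrow> of_bool (b \<noteq> 0)"
proof -
  have c: "(\<lambda>k. tcoef (1 / Suc k) b b) \<longlonglongrightarrow> of_bool (b \<noteq> 0)"
  proof (cases "b = 0")
    case False
    have "(\<lambda>k. 1 / real (Suc k)) \<longlonglongrightarrow> 0" using LIMSEQ_inverse_real_of_nat by (simp add: inverse_eq_divide)
    then have "(\<lambda>k. tcoef (1 / Suc k) b b) \<longlonglongrightarrow> 2 * b * b * inverse (b * b + b * b + 0)"
      unfolding tcoef_def tden_def using False by (intro tendsto_intros) auto
    moreover have "2 * b * b * inverse (b * b + b * b + 0) = 1" using False by (simp add: field_simps)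
    ultimately show ?thesis using False by simp
  qed (simp add: tcoef_def)
  then show "(\<lambda>k. tcoef (1 / Suc k) b b) \<longlonglongrightarrow> of_bool (b \<noteq> 0)" .
  \<comment> \<open>With c = \<open>tcoef e b b\<close> the two derivatives are c - c^2 and c (2 -
    c); their sum tends to 1 as c tends to 1, and to 0 as c tends to 0.\<close>
  have "trunc1 e b b + trunc2 e b b = 3 * tcoef e b b - 2 * (tcoef e b b)\<^sup>2" for e
    by (simp add: trunc1_def trunc2_def tcoef_def power2_eq_square algebra_simps)
  moreover have "(\<lambda>k. 3 * tcoef (1 / Suc k) b b - 2 * (tcoef (1 / Suc k) b b)\<^sup>2)
      \<longlonglongrightarrow> 3 * of_bool (b \<noteq> 0) - 2 * (of_bool (b \<noteq> 0))\<^sup>2"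
    by (intro tendsto_intros c)
  moreover have "3 * of_bool (b \<noteq> 0) - 2 * (of_bool (b \<noteq> 0))\<^sup>2 = (of_bool (b \<noteq> 0) :: real)"
    by simp
  ultimately show "(\<lambda>k. trunc1 (1 / Suc k) b b + trunc2 (1 / Suc k) b b) \<longlonglongrightarrow> of_bool (b \<noteq> 0)"
    by simp
qed

section \<open>Limits of the equation against truncated test functions\<close>

lemma L2_tendsto_AE_subseq:
  fixes v :: "'a::euclidean_space \<Rightarrow> real"
  assumes v: "v \<in> L2 \<Omega>" and a: "\<And>n. a n \<in> L2 \<Omega>" and lim: "(\<lambda>n. L2_norm \<Omega> (\<lambda>x. a n x - v x)) \<longlonglongrightarrow> 0"
  obtains r :: "nat \<Rightarrow> nat" where "strict_mono r" "AE x in lebesgue_on \<Omega>. (\<lambda>n. a (r n) x) \<longlonglongrightarrow> v x"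
proof -
  have i: "integrable (lebesgue_on \<Omega>) (\<lambda>x. (a n x - v x)\<^sup>2)" for n
    using L2_D(2)[OF L2_diff[OF a[of n] v]] by simp
  have "(\<lambda>n. (L2_norm \<Omega> (\<lambda>x. a n x - v x))\<^sup>2) \<longlonglongrightarrow> 0"
    using tendsto_power[OF lim, of 2] by simp
  then have "(\<lambda>n. \<integral>x. norm ((a n x - v x)\<^sup>2) \<partial>lebesgue_on \<Omega>) \<longlonglongrightarrow> 0"
    by (simp add: L2_norm_square_integral)
  from tendsto_L1_AE_subseq[OF i this] obtain r :: "nat \<Rightarrow> nat" where r: "strict_mono r"
    "AE x in lebesgue_on \<Omega>. (\<lambda>n. (a (r n) x - v x)\<^sup>2) \<longlonglongrightarrow> 0" by blast
  have "AE x in lebesgue_on \<Omega>. (\<lambda>n. a (r n) x) \<longlonglongrightarrow> v x"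
    using r(2)
  proof eventually_elim
    case (elim x)
    then have "(\<lambda>n. sqrt ((a (r n) x - v x)\<^sup>2)) \<longlonglongrightarrow> sqrt 0" by (rule tendsto_real_sqrt)
    then have "(\<lambda>n. a (r n) x - v x) \<longlonglongrightarrow> 0" by (simp add: tendsto_rabs_zero_iff)
    then show ?case by (simp add: LIM_zero_iff)
  qed
  with r(1) show thesis by (rule that)
qed

text \<open>Integrability of \<open>F w\<close> alone provides the dominating function.
  \<open>w\<close> is a parameter because it is a test function in the inner limit and the solution
  in the outer one.\<close>

lemma integral_mult_tendsto:
  fixes F :: "'a::euclidean_space \<Rightarrow> real"
  assumes m: "F \<in> borel_measurable (lebesgue_on \<Omega>)" "\<And>n. a n \<in> borel_measurable (lebesgue_on \<Omega>)"
      "b \<in> borel_measurable (lebesgue_on \<Omega>)"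
    and i: "integrable (lebesgue_on \<Omega>) (\<lambda>x. F x * w x)"
    and le: "\<And>n x. \<bar>a n x\<bar> \<le> C * \<bar>w x\<bar>"
    and lim: "AE x in lebesgue_on \<Omega>. (\<lambda>n. a n x) \<longlonglongrightarrow> b x"
  shows "(\<lambda>n. \<integral>x. F x * a n x \<partial>lebesgue_on \<Omega>) \<longlonglongrightarrow> (\<integral>x. F x * b x \<partial>lebesgue_on \<Omega>)"
proof (rule integral_dominated_convergence)
  note [measurable] = m
  show "integrable (lebesgue_on \<Omega>) (\<lambda>x. C * \<bar>F x * w x\<bar>)" using i by simp
  show "(\<lambda>x. F x * b x) \<in> borel_measurable (lebesgue_on \<Omega>)"
    "(\<lambda>x. F x * a n x) \<in> borel_measurable (lebesgue_on \<Omega>)" for n by measurable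
  show "AE x in lebesgue_on \<Omega>. (\<lambda>n. F x * a n x) \<longlonglongrightarrow> F x * b x"
    using lim by eventually_elim (intro tendsto_intros)
  show "AE x in lebesgue_on \<Omega>. norm (F x * a n x) \<le> C * \<bar>F x * w x\<bar>" for n
  proof (rule AE_I2)
    fix x
    show "norm (F x * a n x) \<le> C * \<bar>F x * w x\<bar>"
      using mult_left_mono[OF le[of n x] abs_ge_zero[of "F x"]] by (simp add: abs_mult mult.left_commute)
  qed
qed

text \<open>\<open>F\<close> need not be square integrable; only \<open>F v\<close> is integrable. The truncations
  \<open>trunc \<epsilon> (\<phi> n) (\<phi> m)\<close> are dominated by \<open>\<phi> n\<close> in the limit \<open>m \<rightarrow> \<infinity>\<close> and by \<open>v\<close> in the limit
  \<open>n \<rightarrow> \<infinity>\<close>, and they form a countable family when \<open>\<phi>\<close> ranges over a countable set.\<close>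

lemma test_with_limit:
  fixes v :: "'a::euclidean_space \<Rightarrow> real"
  assumes \<Omega>: "open \<Omega>" and v: "v \<in> L2 \<Omega>" and g: "g \<in> L2 \<Omega>"
    and \<phi>: "\<And>n. \<phi> n \<in> test_functions \<Omega>"
    and lim: "(\<lambda>n. L2_norm \<Omega> (\<lambda>x. \<phi> n x - v x)) \<longlonglongrightarrow> 0" "(\<lambda>n. L2_norm \<Omega> (\<lambda>x. cgrad (\<phi> n) x - g x)) \<longlonglongrightarrow> 0"
    and F: "F \<in> borel_measurable (lebesgue_on \<Omega>)" "integrable (lebesgue_on \<Omega>) (\<lambda>x. F x * v x)"
      "\<And>n. integrable (lebesgue_on \<Omega>) (\<lambda>x. F x * \<phi> n x)"
    and L: "\<And>a z. a \<in> H1 \<Omega> \<Longrightarrow> z \<in> H1 \<Omega> \<Longrightarrow> \<bar>L a - L z\<bar> \<le> C * H1_norm \<Omega> (\<lambda>x. a x - z x)"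
    and eq: "\<And>k n m. L (\<lambda>x. trunc (1 / Suc k) (\<phi> n x) (\<phi> m x))
        + (\<integral>x. F x * trunc (1 / Suc k) (\<phi> n x) (\<phi> m x) \<partial>lebesgue_on \<Omega>) = 0"
  shows "L v + (\<integral>x. F x * v x \<partial>lebesgue_on \<Omega>) = 0"
proof -
  have s: "\<Omega> \<in> sets lebesgue" using \<Omega> by simp
  obtain r where r: "strict_mono r" and ae: "AE x in lebesgue_on \<Omega>. (\<lambda>n. \<phi> (r n) x) \<longlonglongrightarrow> v x"
    using L2_tendsto_AE_subseq[OF v test_function_L2[OF \<phi> s] lim(1)] by blast
  define \<psi> where "\<psi> n = \<phi> (r n)" for n
  have \<psi>t: "\<psi> n \<in> test_functions \<Omega>" for n by (simp add: \<psi>_def \<phi>)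
  have \<psi>L: "\<psi> n \<in> L2 \<Omega>" "cgrad (\<psi> n) \<in> L2 \<Omega>" for n
    using test_function_L2[OF \<psi>t s] cgrad_L2[OF \<psi>t s] by auto
  note [measurable] = L2_D(1)[OF v] L2_D(1)[OF \<psi>L(1)] F(1)
  have ae: "AE x in lebesgue_on \<Omega>. (\<lambda>n. \<psi> n x) \<longlonglongrightarrow> v x"
    using ae by (simp add: \<psi>_def)
  have lim': "(\<lambda>n. L2_norm \<Omega> (\<lambda>x. \<psi> n x - v x)) \<longlonglongrightarrow> 0" "(\<lambda>n. L2_norm \<Omega> (\<lambda>x. cgrad (\<psi> n) x - g x)) \<longlonglongrightarrow> 0"
    using LIMSEQ_subseq_LIMSEQ[OF lim(1) r] LIMSEQ_subseq_LIMSEQ[OF lim(2) r] by (simp_all add: \<psi>_def o_def)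
  \<comment> \<open>\<open>L\<close> is continuous for L^2 convergence of functions together with
    weak gradients. The limit \<open>h\<close> of the gradients is left free, since below it comes
    out as a cut-off of \<open>g\<close>.\<close>
  have Lcont: "(\<lambda>n. L (a n)) \<longlonglongrightarrow> L z"
    if a: "\<And>n. a n \<in> L2 \<Omega>" "\<And>n. b n \<in> L2 \<Omega>" "\<And>n. has_weak_grad \<Omega> (a n) (b n)" and z: "z \<in> L2 \<Omega>" "h \<in> L2 \<Omega>"
      and az: "(\<lambda>n. L2_norm \<Omega> (\<lambda>x. a n x - z x)) \<longlonglongrightarrow> 0" "(\<lambda>n. L2_norm \<Omega> (\<lambda>x. b n x - h x)) \<longlonglongrightarrow> 0" for a b z h
  proof (rule LIM_zero_cancel, rule Lim_null_comparison)
    have wz: "has_weak_grad \<Omega> z h" by (rule has_weak_grad_tendsto[OF \<Omega> z(1) a(1) z(2) a(2,3) az])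
    show "(\<lambda>n. \<bar>C\<bar> * (L2_norm \<Omega> (\<lambda>x. a n x - z x) + L2_norm \<Omega> (\<lambda>x. b n x - h x))) \<longlonglongrightarrow> 0"
      using tendsto_mult[OF tendsto_const tendsto_add[OF az]] by simp
    show "\<forall>\<^sub>F n in sequentially. norm (L (a n) - L z)
        \<le> \<bar>C\<bar> * (L2_norm \<Omega> (\<lambda>x. a n x - z x) + L2_norm \<Omega> (\<lambda>x. b n x - h x))"
    proof (intro always_eventually allI)
      fix n
      have "norm (L (a n) - L z) \<le> C * H1_norm \<Omega> (\<lambda>x. a n x - z x)"
        using L[OF H1_I[OF a] H1_I[OF z wz]] by simp
      also have "\<dots> \<le> \<bar>C\<bar> * H1_norm \<Omega> (\<lambda>x. a n x - z x)"
        by (intro mult_right_mono H1_norm_nonneg) simp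
      also have "\<dots> \<le> \<bar>C\<bar> * (L2_norm \<Omega> (\<lambda>x. a n x - z x) + L2_norm \<Omega> (\<lambda>x. b n x - h x))"
        by (intro mult_left_mono H1_norm_le L2_diff has_weak_grad_diff \<Omega> a z wz) simp
      finally show "norm (L (a n) - L z) \<le> \<bar>C\<bar> * (L2_norm \<Omega> (\<lambda>x. a n x - z x) + L2_norm \<Omega> (\<lambda>x. b n x - h x))" .
    qed
  qed
  \<comment> \<open>\<open>V k\<close> is the truncation with both arguments equal to
    \<open>v\<close>, and \<open>G k\<close> is what the chain rule suggests as its gradient; that
    it is a weak gradient will follow from closedness.\<close>
  define V where "V k x = tcoef (1 / Suc k) (v x) (v x) *\<^sub>R v x" for k x
  define G where "G k x = (trunc1 (1 / Suc k) (v x) (v x) + trunc2 (1 / Suc k) (v x) (v x)) *\<^sub>R g x" for k x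
  have VL: "V k \<in> L2 \<Omega>" for k
    unfolding V_def[abs_def] using tcoef_bounds[of "1 / Suc k"]
    by (intro L2_bounded_mult(1)[of _ _ 2] v) auto
  have b4: "\<bar>trunc1 (1 / Suc k) a b + trunc2 (1 / Suc k) a b\<bar> \<le> 4" for k a b
    using trunc1_bound[of "1 / Suc k" a b] trunc2_bound[of "1 / Suc k" a b] by simp
  have GL: "G k \<in> L2 \<Omega>" for k
    unfolding G_def[abs_def] by (rule L2_bounded_mult(1)[OF _ b4 g]) measurable
  have Veq: "V k x = trunc (1 / Suc k) (v x) (v x)" for k x
    by (simp add: V_def trunc_def mult.commute)
  have stage1: "L (V k) + (\<integral>x. F x * V k x \<partial>lebesgue_on \<Omega>) = 0 \<and> has_weak_grad \<Omega> (V k) (G k)" for k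
  proof -
    define e where "e = 1 / real (Suc k)"
    have e: "e > 0" by (simp add: e_def)
    have t: "(\<lambda>m. \<integral>x. F x * trunc e (\<psi> n x) (\<psi> m x) \<partial>lebesgue_on \<Omega>)
        \<longlonglongrightarrow> (\<integral>x. F x * trunc e (\<psi> n x) (v x) \<partial>lebesgue_on \<Omega>)" for n
    proof (rule integral_mult_tendsto[where w="\<psi> n" and C=2])
      show "integrable (lebesgue_on \<Omega>) (\<lambda>x. F x * \<psi> n x)" unfolding \<psi>_def by (rule F(3))
      show "AE x in lebesgue_on \<Omega>. (\<lambda>m. trunc e (\<psi> n x) (\<psi> m x)) \<longlonglongrightarrow> trunc e (\<psi> n x) (v x)"
        using ae by eventually_elim (intro trunc_tendsto e tendsto_const)
    qed (use trunc_bounds[OF e] in auto)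
    \<comment> \<open>A diagonal choice merges the two limits: \<open>m n\<close> is so large that
      the inner limit is reached up to 1/(n+1), and \<open>m n \<ge> n\<close> keeps
      \<open>\<psi> (m n)\<close> converging to \<open>v\<close>.\<close>
    have "\<exists>m\<ge>n. \<bar>(\<integral>x. F x * trunc e (\<psi> n x) (\<psi> m x) \<partial>lebesgue_on \<Omega>)
        - (\<integral>x. F x * trunc e (\<psi> n x) (v x) \<partial>lebesgue_on \<Omega>)\<bar> < 1 / Suc n" for n
    proof -
      obtain N where "\<forall>m\<ge>N. norm ((\<integral>x. F x * trunc e (\<psi> n x) (\<psi> m x) \<partial>lebesgue_on \<Omega>)
        - (\<integral>x. F x * trunc e (\<psi> n x) (v x) \<partial>lebesgue_on \<Omega>)) < 1 / Suc n"
        using LIMSEQ_D[OF t[of n], of "1 / Suc n"] by auto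
      then show ?thesis by (intro exI[of _ "max n N"]) auto
    qed
    then obtain m where m: "\<And>n. n \<le> m n" "\<And>n. \<bar>(\<integral>x. F x * trunc e (\<psi> n x) (\<psi> (m n) x) \<partial>lebesgue_on \<Omega>)
        - (\<integral>x. F x * trunc e (\<psi> n x) (v x) \<partial>lebesgue_on \<Omega>)\<bar> < 1 / Suc n" by metis
    have mt: "filterlim m at_top sequentially"
      using m(1) by (intro filterlim_at_top_mono[OF filterlim_ident]) auto
    define a where "a n x = trunc e (\<psi> n x) (\<psi> (m n) x)" for n x
    have at: "a n \<in> test_functions \<Omega>" for n
      unfolding a_def[abs_def] by (rule trunc_test_function[OF e \<psi>t \<psi>t])
    have ac: "cgrad (a n) = (\<lambda>x. trunc1 e (\<psi> n x) (\<psi> (m n) x) *\<^sub>R cgrad (\<psi> n) x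
        + trunc2 e (\<psi> n x) (\<psi> (m n) x) *\<^sub>R cgrad (\<psi> (m n)) x)" for n
      unfolding a_def[abs_def] by (rule trunc_cgrad[OF e \<psi>t \<psi>t])
    have aL: "a n \<in> L2 \<Omega>" "cgrad (a n) \<in> L2 \<Omega>" "has_weak_grad \<Omega> (a n) (cgrad (a n))" for n
      using at s by (auto intro: test_function_L2 cgrad_L2 has_weak_grad_cgrad)
    have aem: "AE x in lebesgue_on \<Omega>. (\<lambda>n. \<psi> (m n) x) \<longlonglongrightarrow> v x"
      using ae by eventually_elim (rule filterlim_compose[OF _ mt])
    have limm: "(\<lambda>n. L2_norm \<Omega> (\<lambda>x. cgrad (\<psi> (m n)) x - g x)) \<longlonglongrightarrow> 0"
      by (rule filterlim_compose[OF lim'(2) mt])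
    have "(\<lambda>n. \<integral>x. F x * trunc e (\<psi> n x) (v x) \<partial>lebesgue_on \<Omega>) \<longlonglongrightarrow> (\<integral>x. F x * trunc e (v x) (v x) \<partial>lebesgue_on \<Omega>)"
    proof (rule integral_mult_tendsto[where w=v and C=1])
      show "AE x in lebesgue_on \<Omega>. (\<lambda>n. trunc e (\<psi> n x) (v x)) \<longlonglongrightarrow> trunc e (v x) (v x)"
        using ae by eventually_elim (intro trunc_tendsto e tendsto_const)
    qed (use trunc_bounds[OF e] F(2) in auto)
    moreover have "(\<lambda>n. (\<integral>x. F x * a n x \<partial>lebesgue_on \<Omega>) - (\<integral>x. F x * trunc e (\<psi> n x) (v x) \<partial>lebesgue_on \<Omega>)) \<longlonglongrightarrow> 0"
    proof (rule Lim_null_comparison)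
      show "(\<lambda>n. 1 / real (Suc n)) \<longlonglongrightarrow> 0" using LIMSEQ_inverse_real_of_nat by (simp add: inverse_eq_divide)
    qed (use m(2) in \<open>auto simp: a_def less_imp_le simp del: of_nat_Suc intro!: always_eventually\<close>)
    ultimately have I: "(\<lambda>n. \<integral>x. F x * a n x \<partial>lebesgue_on \<Omega>) \<longlonglongrightarrow> (\<integral>x. F x * V k x \<partial>lebesgue_on \<Omega>)"
      using tendsto_add by (fastforce simp: Veq e_def)
    have aV: "(\<lambda>n. L2_norm \<Omega> (\<lambda>x. a n x - V k x)) \<longlonglongrightarrow> 0"
    proof -
      have "(\<lambda>n. L2_norm \<Omega> (\<lambda>x. tcoef e (\<psi> n x) (\<psi> (m n) x) *\<^sub>R \<psi> n x - tcoef e (v x) (v x) *\<^sub>R v x)) \<longlonglongrightarrow> 0"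
      proof (rule L2_mult_tendsto[where M=2])
        show "AE x in lebesgue_on \<Omega>. (\<lambda>n. tcoef e (\<psi> n x) (\<psi> (m n) x)) \<longlonglongrightarrow> tcoef e (v x) (v x)"
          using ae aem by eventually_elim (intro trunc_tendsto e)
      qed (use tcoef_bounds[OF e] \<psi>L v lim' in auto)
      then show ?thesis by (simp add: a_def V_def trunc_def e_def mult.commute)
    qed
    have aG: "(\<lambda>n. L2_norm \<Omega> (\<lambda>x. cgrad (a n) x - G k x)) \<longlonglongrightarrow> 0"
    proof (rule Lim_null_comparison)
      define d1 where "d1 n x = trunc1 e (\<psi> n x) (\<psi> (m n) x) *\<^sub>R cgrad (\<psi> n) x - trunc1 e (v x) (v x) *\<^sub>R g x" for n x
      define d2 where "d2 n x = trunc2 e (\<psi> n x) (\<psi> (m n) x) *\<^sub>R cgrad (\<psi> (m n)) x - trunc2 e (v x) (v x) *\<^sub>R g x" for n x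
      have "(\<lambda>n. L2_norm \<Omega> (d1 n)) \<longlonglongrightarrow> 0"
        unfolding d1_def
      proof (rule L2_mult_tendsto[where M=2])
        show "AE x in lebesgue_on \<Omega>. (\<lambda>n. trunc1 e (\<psi> n x) (\<psi> (m n) x)) \<longlonglongrightarrow> trunc1 e (v x) (v x)"
          using ae aem by eventually_elim (intro trunc_tendsto e)
      qed (use trunc1_bound[OF e] \<psi>L g lim' in auto)
      moreover have "(\<lambda>n. L2_norm \<Omega> (d2 n)) \<longlonglongrightarrow> 0"
        unfolding d2_def
      proof (rule L2_mult_tendsto[where M=2])
        show "AE x in lebesgue_on \<Omega>. (\<lambda>n. trunc2 e (\<psi> n x) (\<psi> (m n) x)) \<longlonglongrightarrow> trunc2 e (v x) (v x)"
          using ae aem by eventually_elim (intro trunc_tendsto e)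
      qed (use trunc2_bound[OF e] \<psi>L g limm in auto)
      ultimately show "(\<lambda>n. L2_norm \<Omega> (d1 n) + L2_norm \<Omega> (d2 n)) \<longlonglongrightarrow> 0"
        using tendsto_add by fastforce
      have "d1 n \<in> L2 \<Omega>" "d2 n \<in> L2 \<Omega>" for n
        unfolding d1_def[abs_def] d2_def[abs_def]
        by (intro L2_diff L2_bounded_mult(1)[of _ _ 2] trunc1_bound trunc2_bound e \<psi>L g; measurable)+
      moreover have "cgrad (a n) x - G k x = d1 n x + d2 n x" for n x
        unfolding ac G_def e_def[symmetric] d1_def d2_def by (simp add: scaleR_add_left)
      ultimately show "\<forall>\<^sub>F n in sequentially. norm (L2_norm \<Omega> (\<lambda>x. cgrad (a n) x - G k x))
          \<le> L2_norm \<Omega> (d1 n) + L2_norm \<Omega> (d2 n)"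
        using L2_norm_triangle[of "d1 n" \<Omega> "d2 n" for n] by (simp add: L2_norm_nonneg)
    qed
    have "(\<lambda>n. L (a n)) \<longlonglongrightarrow> L (V k)"
      by (rule Lcont[OF aL VL GL aV aG])
    from tendsto_add[OF this I] have "(\<lambda>n. 0) \<longlonglongrightarrow> L (V k) + (\<integral>x. F x * V k x \<partial>lebesgue_on \<Omega>)"
      using eq[of k] by (simp add: a_def[abs_def] \<psi>_def e_def)
    then have "L (V k) + (\<integral>x. F x * V k x \<partial>lebesgue_on \<Omega>) = 0" by (simp add: LIMSEQ_const_iff)
    then show ?thesis
      using has_weak_grad_tendsto[OF \<Omega> VL aL(1) GL aL(2,3) aV aG] by simp
  qed
  have 1: "(\<lambda>k. L2_norm \<Omega> (\<lambda>x. V k x - v x)) \<longlonglongrightarrow> 0"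
  proof -
    have "(\<lambda>k. L2_norm \<Omega> (\<lambda>x. tcoef (1 / Suc k) (v x) (v x) *\<^sub>R v x - of_bool (v x \<noteq> 0) *\<^sub>R v x)) \<longlonglongrightarrow> 0"
    proof (rule L2_mult_tendsto[where M=2])
      show "AE x in lebesgue_on \<Omega>. (\<lambda>k. tcoef (1 / Suc k) (v x) (v x)) \<longlonglongrightarrow> of_bool (v x \<noteq> 0)"
        by (intro AE_I2 trunc_diagonal_tendsto)
      show "\<bar>tcoef (1 / Suc k) (v x) (v x)\<bar> \<le> 2" for k x using tcoef_bounds[of "1 / Suc k"] by simp
      show "(\<lambda>k. L2_norm \<Omega> (\<lambda>x. v x - v x)) \<longlonglongrightarrow> 0" by (simp add: L2_norm_def L2_inner_def)
    qed (use v in auto)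
    moreover have "of_bool (v x \<noteq> 0) *\<^sub>R v x = v x" for x by simp
    ultimately show ?thesis unfolding V_def by (simp only:)
  qed
  \<comment> \<open>The limiting gradient is \<open>g\<close> cut off to the set where
    \<open>v\<close> is nonzero. By closedness it is a weak gradient of \<open>v\<close> as well,
    and this is enough for \<open>Lcont\<close>.\<close>
  have 2: "(\<lambda>k. L2_norm \<Omega> (\<lambda>x. G k x - of_bool (v x \<noteq> 0) *\<^sub>R g x)) \<longlonglongrightarrow> 0"
    unfolding G_def
  proof (rule L2_mult_tendsto[where M=4])
    show "AE x in lebesgue_on \<Omega>. (\<lambda>k. trunc1 (1 / Suc k) (v x) (v x) + trunc2 (1 / Suc k) (v x) (v x)) \<longlonglongrightarrow> of_bool (v x \<noteq> 0)"
      by (intro AE_I2 trunc_diagonal_tendsto)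
    show "(\<lambda>k. L2_norm \<Omega> (\<lambda>x. g x - g x)) \<longlonglongrightarrow> 0" by (simp add: L2_norm_def L2_inner_def)
  qed (use b4 g in auto)
  have gL: "(\<lambda>x. of_bool (v x \<noteq> 0) *\<^sub>R g x) \<in> L2 \<Omega>"
    by (rule L2_bounded_mult(1)[of _ _ 1, OF _ _ g]) auto
  have "(\<lambda>k. L (V k)) \<longlonglongrightarrow> L v"
    using stage1 by (intro Lcont[OF VL GL _ v gL 1 2]) auto
  moreover have "(\<lambda>k. \<integral>x. F x * V k x \<partial>lebesgue_on \<Omega>) \<longlonglongrightarrow> (\<integral>x. F x * v x \<partial>lebesgue_on \<Omega>)"
  proof (rule integral_mult_tendsto[where w=v and C=1])
    show "AE x in lebesgue_on \<Omega>. (\<lambda>k. V k x) \<longlonglongrightarrow> v x"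
    proof (rule AE_I2)
      fix x
      show "(\<lambda>k. V k x) \<longlonglongrightarrow> v x"
        using tendsto_scaleR[OF trunc_diagonal_tendsto(1)[of "v x"] tendsto_const[of "v x"]]
        unfolding V_def by (cases "v x = 0") simp_all
    qed
    show "\<bar>V k x\<bar> \<le> 1 * \<bar>v x\<bar>" for k x using trunc_bounds(1)[of "1 / Suc k" "v x" "v x"] by (simp add: Veq)
  qed (use F VL L2_D in auto)
  ultimately have "(\<lambda>k. L (V k) + (\<integral>x. F x * V k x \<partial>lebesgue_on \<Omega>)) \<longlonglongrightarrow> L v + (\<integral>x. F x * v x \<partial>lebesgue_on \<Omega>)"
    by (rule tendsto_add)
  then show ?thesis using stage1 by (simp add: LIMSEQ_const_iff)
qed

section \<open>From countably many test functions to the solution at almost every time\<close>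

lemma H1_norm_diff_ge:
  assumes \<Omega>: "open \<Omega>" and a: "a \<in> H1 \<Omega>" "ga \<in> L2 \<Omega>" "has_weak_grad \<Omega> a ga"
    and z: "z \<in> H1 \<Omega>" "gz \<in> L2 \<Omega>" "has_weak_grad \<Omega> z gz"
  shows "L2_norm \<Omega> (\<lambda>x. a x - z x) \<le> H1_norm \<Omega> (\<lambda>x. a x - z x)"
    "L2_norm \<Omega> (\<lambda>x. ga x - gz x) \<le> H1_norm \<Omega> (\<lambda>x. a x - z x)"
proof -
  have "H1_norm \<Omega> (\<lambda>x. a x - z x)
      = sqrt ((L2_norm \<Omega> (\<lambda>x. a x - z x))\<^sup>2 + (L2_norm \<Omega> (\<lambda>x. ga x - gz x))\<^sup>2)"
    using a z by (intro H1_norm_eq \<Omega> L2_diff has_weak_grad_diff H1_L2) auto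
  then show "L2_norm \<Omega> (\<lambda>x. ga x - gz x) \<le> H1_norm \<Omega> (\<lambda>x. a x - z x)"
    by (auto intro: real_le_rsqrt)
qed (rule L2_norm_le_H1_norm)

lemma H10_H1: "v \<in> H10 \<Omega> \<Longrightarrow> v \<in> H1 \<Omega>"
  unfolding H10_def by blast

text \<open>Simple functions take finitely many values, so an approximating sequence has countably
  many values altogether, and each of them is the limit of a sequence of test functions.
  Countability of \<open>D\<close> is what keeps a union of exceptional null sets null.\<close>

lemma strongly_measurable_countable_dense:
  fixes u :: "real \<Rightarrow> 'a::euclidean_space \<Rightarrow> real"
  assumes \<Omega>: "open \<Omega>" and u: "strongly_measurable T (H10 \<Omega>) (H1_norm \<Omega>) u"
  obtains D where "countable D" "D \<subseteq> test_functions \<Omega>"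
    "AE t in lebesgue_on {0..T}. \<forall>e>0. \<exists>\<psi>\<in>D. H1_norm \<Omega> (\<lambda>x. \<psi> x - u t x) < e"
proof -
  obtain s :: "nat \<Rightarrow> real \<Rightarrow> 'a \<Rightarrow> real" where
    s: "\<And>n. simple_function (lebesgue_on {0..T}) (s n)" "\<And>n. s n ` {0..T} \<subseteq> H10 \<Omega>"
      "AE t in lebesgue_on {0..T}. (\<lambda>n. H1_norm \<Omega> (s n t - u t)) \<longlonglongrightarrow> 0"
    and uH: "AE t in lebesgue_on {0..T}. u t \<in> H10 \<Omega>"
    using u unfolding strongly_measurable_def by blast
  have "\<exists>p::nat \<Rightarrow> 'a \<Rightarrow> real. (\<forall>k. p k \<in> test_functions \<Omega>) \<and> (\<lambda>k. H1_norm \<Omega> (c - p k)) \<longlonglongrightarrow> 0"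
    if "c \<in> H10 \<Omega>" for c
    using that unfolding H10_def by blast
  then obtain p :: "('a \<Rightarrow> real) \<Rightarrow> nat \<Rightarrow> 'a \<Rightarrow> real" where
    p: "\<And>c k. c \<in> H10 \<Omega> \<Longrightarrow> p c k \<in> test_functions \<Omega>" "\<And>c. c \<in> H10 \<Omega> \<Longrightarrow> (\<lambda>k. H1_norm \<Omega> (c - p c k)) \<longlonglongrightarrow> 0"
    by metis
  define S where "S = (\<Union>n. s n ` {0..T})"
  have S: "S \<subseteq> H10 \<Omega>" using s(2) unfolding S_def by blast
  have "finite (s n ` {0..T})" for n using s(1)[of n] unfolding simple_function_def by simp
  then have cS: "countable S" unfolding S_def by (intro countable_UN) (auto intro: countable_finite)
  define D where "D = (\<Union>c\<in>S. range (p c))"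
  show thesis
  proof (rule that[of D])
    show "countable D" unfolding D_def using cS by auto
    show D: "D \<subseteq> test_functions \<Omega>" unfolding D_def using p S by blast
    have "AE t in lebesgue_on {0..T}. t \<in> {0..T}" by (rule AE_I2) simp
    with s(3) uH show "AE t in lebesgue_on {0..T}. \<forall>e>0. \<exists>\<psi>\<in>D. H1_norm \<Omega> (\<lambda>x. \<psi> x - u t x) < e"
    proof eventually_elim
      case (elim t)
      show ?case
      proof (intro allI impI)
        fix e :: real assume e: "e > 0"
        obtain n where n: "H1_norm \<Omega> (s n t - u t) < e / 2"
          using order_tendstoD(2)[OF elim(1), of "e / 2"] e eventually_sequentially by auto
        have c: "s n t \<in> S" using elim(3) unfolding S_def by blast
        then have c: "s n t \<in> S" "s n t \<in> H10 \<Omega>" using S by blast+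
        obtain k where k: "H1_norm \<Omega> (s n t - p (s n t) k) < e / 2"
          using order_tendstoD(2)[OF p(2)[OF c(2)], of "e / 2"] e eventually_sequentially by auto
        let ?\<psi> = "p (s n t) k"
        have \<psi>: "?\<psi> \<in> D" "?\<psi> \<in> test_functions \<Omega>" using c D unfolding D_def by auto
        have h: "?\<psi> \<in> H1 \<Omega>" "s n t \<in> H1 \<Omega>" "u t \<in> H1 \<Omega>"
          using test_function_H1[OF \<psi>(2) \<Omega>] H10_H1 c elim by auto
        have "H1_norm \<Omega> (\<lambda>x. ?\<psi> x - u t x) \<le> H1_norm \<Omega> (\<lambda>x. ?\<psi> x - s n t x) + H1_norm \<Omega> (\<lambda>x. s n t x - u t x)"
          by (rule H1_norm_triangle_diff[OF \<Omega> h])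
        also have "\<dots> < e"
          using n k H1_norm_minus_commute[OF \<Omega> h(1,2)] by (simp add: fun_diff_def)
        finally show "\<exists>\<psi>\<in>D. H1_norm \<Omega> (\<lambda>x. \<psi> x - u t x) < e" using \<psi>(1) by blast
      qed
    qed
  qed
qed

lemma weak_form_tested_with_solution:
  fixes u :: "real \<Rightarrow> 'a::euclidean_space \<Rightarrow> real"
  assumes \<Omega>: "open \<Omega>" and f: "continuous_on UNIV f"
    and u: "u \<in> L2_time T (H10 \<Omega>) (H1_norm \<Omega>)" and w: "w \<in> L2_time T (Hm1 \<Omega>) (Hm1_norm \<Omega>)"
    and eq: "\<forall>\<phi>\<in>H10 \<Omega>. AE t in lebesgue_on {0..T}.
           integrable (lebesgue_on \<Omega>) (\<lambda>x. f (u t x) * u t x * \<phi> x) \<and>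
           w t \<phi> + \<nu> * L2_inner \<Omega> (wgrad \<Omega> (u t)) (wgrad \<Omega> \<phi>)
             + L2_inner \<Omega> (\<lambda>x. f (u t x) * u t x) \<phi> = 0"
    and i: "\<And>t. t \<in> {0..T} \<Longrightarrow> integrable (lebesgue_on \<Omega>) (\<lambda>x. f (u t x) * (u t x)\<^sup>2)"
  shows "AE t in lebesgue_on {0..T}. w t (u t) + \<nu> * (L2_norm \<Omega> (wgrad \<Omega> (u t)))\<^sup>2
      + (\<integral>x. f (u t x) * (u t x)\<^sup>2 \<partial>lebesgue_on \<Omega>) = 0"
proof -
  have s: "\<Omega> \<in> sets lebesgue" using \<Omega> by simp
  obtain D where D: "countable D" "D \<subseteq> test_functions \<Omega>"
    and dense: "AE t in lebesgue_on {0..T}. \<forall>e>0. \<exists>\<psi>\<in>D. H1_norm \<Omega> (\<lambda>x. \<psi> x - u t x) < e"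
    using strongly_measurable_countable_dense[OF \<Omega>, of T u] u unfolding L2_time_def by blast
  \<comment> \<open>\<open>D\<close> itself is included for the integrability of f(u) u times each
    approximant, the truncations for the equation. Countability of \<open>E\<close> gives one null
    set of times for all of them.\<close>
  define E where "E = D \<union> (\<lambda>(k, \<phi>, \<psi>). \<lambda>x. trunc (1 / Suc k) (\<phi> x) (\<psi> x)) ` (UNIV \<times> D \<times> D)"
  have E: "countable E" unfolding E_def using D(1) by auto
  have "E \<subseteq> test_functions \<Omega>"
    unfolding E_def using D(2) by (auto intro!: trunc_test_function)
  then have "E \<subseteq> H10 \<Omega>" using test_function_H10[OF _ \<Omega>] by blast
  then have "\<forall>\<phi>\<in>E. AE t in lebesgue_on {0..T}.
           integrable (lebesgue_on \<Omega>) (\<lambda>x. f (u t x) * u t x * \<phi> x) \<and>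
           w t \<phi> + \<nu> * L2_inner \<Omega> (wgrad \<Omega> (u t)) (wgrad \<Omega> \<phi>)
             + L2_inner \<Omega> (\<lambda>x. f (u t x) * u t x) \<phi> = 0" using eq by blast
  then have eqE: "AE t in lebesgue_on {0..T}. \<forall>\<phi>\<in>E.
           integrable (lebesgue_on \<Omega>) (\<lambda>x. f (u t x) * u t x * \<phi> x) \<and>
           w t \<phi> + \<nu> * L2_inner \<Omega> (wgrad \<Omega> (u t)) (wgrad \<Omega> \<phi>)
             + L2_inner \<Omega> (\<lambda>x. f (u t x) * u t x) \<phi> = 0"
    unfolding AE_ball_countable[OF E] .
  have uH: "AE t in lebesgue_on {0..T}. u t \<in> H10 \<Omega>" and wH: "AE t in lebesgue_on {0..T}. w t \<in> Hm1 \<Omega>"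
    using u w unfolding L2_time_def strongly_measurable_def by auto
  have "AE t in lebesgue_on {0..T}. t \<in> {0..T}" by (rule AE_I2) simp
  with dense eqE uH wH show ?thesis
  proof eventually_elim
    case (elim t)
    let ?g = "wgrad \<Omega> (u t)" and ?F = "\<lambda>x. f (u t x) * u t x"
    have v: "u t \<in> H1 \<Omega>" "u t \<in> L2 \<Omega>" using elim(3) H10_H1 H1_L2 by blast+
    note g = wgrad_props[OF v(1)]
    have "\<exists>\<psi>\<in>D. H1_norm \<Omega> (\<lambda>x. \<psi> x - u t x) < 1 / Suc n" for n using elim(1) by simp
    then obtain \<phi> where \<phi>: "\<And>n. \<phi> n \<in> D" "\<And>n. H1_norm \<Omega> (\<lambda>x. \<phi> n x - u t x) < 1 / Suc n" by metis
    have \<phi>t: "\<phi> n \<in> test_functions \<Omega>" for n using \<phi> D by blast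
    have n0: "(\<lambda>n. 1 / real (Suc n)) \<longlonglongrightarrow> 0" using LIMSEQ_inverse_real_of_nat by (simp add: inverse_eq_divide)
    note ge = H1_norm_diff_ge[OF \<Omega> test_function_H1[OF \<phi>t \<Omega>] cgrad_L2[OF \<phi>t s] has_weak_grad_cgrad[OF \<phi>t s] v(1) g]
    have lim: "(\<lambda>n. L2_norm \<Omega> (\<lambda>x. \<phi> n x - u t x)) \<longlonglongrightarrow> 0" "(\<lambda>n. L2_norm \<Omega> (\<lambda>x. cgrad (\<phi> n) x - ?g x)) \<longlonglongrightarrow> 0"
      using order_trans[OF ge(1) less_imp_le[OF \<phi>(2)]] order_trans[OF ge(2) less_imp_le[OF \<phi>(2)]]
      by (auto intro!: Lim_null_comparison[OF always_eventually n0] simp: L2_norm_nonneg simp del: of_nat_Suc)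
    note [measurable] = L2_D(1)[OF v(2)]
    have fm[measurable]: "f \<in> borel_measurable borel" using f by (rule borel_measurable_continuous_onI)
    \<comment> \<open>Everything in the equation except the nonlinear term; at fixed
      \<open>t\<close> it is Lipschitz on H^1, with a constant that may depend on
      \<open>t\<close>.\<close>
    define L where "L z = w t z + \<nu> * L2_inner \<Omega> ?g (wgrad \<Omega> z)" for z
    have "L (u t) + (\<integral>x. ?F x * u t x \<partial>lebesgue_on \<Omega>) = 0"
    proof (rule test_with_limit[OF \<Omega> v(2) g(1) \<phi>t lim])
      show "?F \<in> borel_measurable (lebesgue_on \<Omega>)" by measurable
      show "integrable (lebesgue_on \<Omega>) (\<lambda>x. ?F x * u t x)"
        using i[OF elim(5)] by (simp add: power2_eq_square mult.assoc)
      show "integrable (lebesgue_on \<Omega>) (\<lambda>x. ?F x * \<phi> n x)" for n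
        using elim(2) \<phi>(1)[of n] unfolding E_def by blast
      show "L (\<lambda>x. trunc (1 / Suc k) (\<phi> n x) (\<phi> m x))
        + (\<integral>x. ?F x * trunc (1 / Suc k) (\<phi> n x) (\<phi> m x) \<partial>lebesgue_on \<Omega>) = 0" for k n m
      proof -
        have "(\<lambda>x. trunc (1 / Suc k) (\<phi> n x) (\<phi> m x)) \<in> E"
          unfolding E_def using \<phi>(1) by (intro UnI2 image_eqI[of _ _ "(k, \<phi> n, \<phi> m)"]) auto
        from bspec[OF elim(2) this] show ?thesis unfolding L_def L2_inner_def by simp
      qed
      fix a z assume a: "a \<in> H1 \<Omega>" and z: "z \<in> H1 \<Omega>"
      note ga = wgrad_props[OF a] and gz = wgrad_props[OF z]
      have "L a - L z = w t (\<lambda>x. a x - z x) + \<nu> * L2_inner \<Omega> (\<lambda>x. wgrad \<Omega> a x - wgrad \<Omega> z x) ?g"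
        unfolding L_def Hm1_diff[OF \<Omega> elim(4) a z] L2_inner_diff[OF ga(1) gz(1) g(1)]
        by (simp add: L2_inner_commute right_diff_distrib)
      also have "\<bar>\<dots>\<bar> \<le> \<bar>w t (\<lambda>x. a x - z x)\<bar> + \<bar>\<nu>\<bar> * \<bar>L2_inner \<Omega> (\<lambda>x. wgrad \<Omega> a x - wgrad \<Omega> z x) ?g\<bar>"
        by (simp add: abs_mult[symmetric] abs_triangle_ineq)
      also have "\<dots> \<le> Hm1_norm \<Omega> (w t) * H1_norm \<Omega> (\<lambda>x. a x - z x)
          + \<bar>\<nu>\<bar> * (H1_norm \<Omega> (\<lambda>x. a x - z x) * L2_norm \<Omega> ?g)"
      proof (intro add_mono mult_left_mono Hm1_bound[OF \<Omega> elim(4)] H1_diff \<Omega> a z)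
        have "\<bar>L2_inner \<Omega> (\<lambda>x. wgrad \<Omega> a x - wgrad \<Omega> z x) ?g\<bar>
            \<le> L2_norm \<Omega> (\<lambda>x. wgrad \<Omega> a x - wgrad \<Omega> z x) * L2_norm \<Omega> ?g"
          by (intro L2_Cauchy_Schwarz L2_diff ga gz g)
        also have "\<dots> \<le> H1_norm \<Omega> (\<lambda>x. a x - z x) * L2_norm \<Omega> ?g"
          by (intro mult_right_mono H1_norm_diff_ge(2)[OF \<Omega> a ga z gz] L2_norm_nonneg)
        finally show "\<bar>L2_inner \<Omega> (\<lambda>x. wgrad \<Omega> a x - wgrad \<Omega> z x) ?g\<bar>
            \<le> H1_norm \<Omega> (\<lambda>x. a x - z x) * L2_norm \<Omega> ?g" .
      qed auto
      finally show "\<bar>L a - L z\<bar> \<le> (Hm1_norm \<Omega> (w t) + \<bar>\<nu>\<bar> * L2_norm \<Omega> ?g) * H1_norm \<Omega> (\<lambda>x. a x - z x)"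
        by (simp add: algebra_simps)
    qed
    then show ?case unfolding L_def L2_norm_square[symmetric] by (simp add: power2_eq_square mult.assoc)
  qed
qed

subsection \<open>The weak time derivative\<close>

lemma bmp_at_top: "(bmp \<longlongrightarrow> 1) at_top"
proof (rule Lim_transform_eventually)
  show "((\<lambda>s::real. exp (- inverse s)) \<longlongrightarrow> 1) at_top"
    by real_asymp
  show "\<forall>\<^sub>F s in at_top. exp (- inverse s) = bmp s"
    using eventually_gt_at_top[of 0] by eventually_elim (simp add: flat_def)
qed

text \<open>\<open>flat (flat_step 1)\<close> is the derivative of \<open>bmp\<close>, which rises
  from 0 to 1, so it is a probability density.\<close>

lemma bmp_deriv_integral:
  "integrable lborel (flat (flat_step 1))" "(\<integral>s. flat (flat_step 1) s \<partial>lborel) = 1"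
proof -
  have nn: "0 \<le> flat (flat_step 1) s" for s
    by (auto simp: flat_def flat_step_def poly_monom)
  have "(\<integral>\<^sup>+s. ennreal (flat (flat_step 1) s) * indicator {0..} s \<partial>lborel) = 1 - bmp 0"
    using nn_integral_FTC_atLeast[OF flat_measurable flat_deriv nn bmp_at_top] by simp
  moreover have "ennreal (flat (flat_step 1) s) * indicator {0..} s = ennreal (flat (flat_step 1) s)" for s
    by (auto simp: indicator_def flat_def)
  ultimately have "(\<integral>\<^sup>+s. ennreal (flat (flat_step 1) s) \<partial>lborel) = ennreal 1"
    by (simp add: flat_def)
  then have "has_bochner_integral lborel (flat (flat_step 1)) 1"
    using flat_measurable nn by (intro has_bochner_integral_nn_integral) auto
  then show "integrable lborel (flat (flat_step 1))" "(\<integral>s. flat (flat_step 1) s \<partial>lborel) = 1"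
    by (auto simp: has_bochner_integral_iff)
qed

lemma bmp_tendsto_shift:
  assumes "d > 0"
  shows "(\<lambda>j. bmp (real (Suc j) * d - r)) \<longlonglongrightarrow> 1"
proof -
  have "filterlim (\<lambda>j. real (Suc j) * d - r) at_top sequentially"
    using assms by real_asymp
  then show ?thesis by (rule filterlim_compose[OF bmp_at_top])
qed

text \<open>The derivative of \<open>bmp (j (x - a))\<close> is an approximate identity concentrating at \<open>a\<close> from the
  right; for negative \<open>c\<close> one obtains the reflected statement.\<close>

lemma approximate_identity:
  assumes Y: "continuous_on UNIV Y" "\<And>t. \<bar>Y t\<bar> \<le> M" and d: "d > 0" and c: "\<bar>c\<bar> = 1"
  shows "(\<lambda>j. \<integral>x. Y x * (Suc j * flat (flat_step 1) (Suc j * (c * (x - a))) * bmp (Suc j * (d - c * (x - a)))) \<partial>lborel)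
    \<longlonglongrightarrow> Y a"
proof -
  let ?q = "flat (flat_step 1)"
  have mY[measurable]: "Y \<in> borel_measurable borel" using Y(1) by (rule borel_measurable_continuous_onI)
  note [measurable] = flat_measurable
  have cc: "c * c = 1" using c by (cases "c \<ge> 0") (auto simp: abs_if)
  have nn: "0 \<le> ?q s" for s
    by (auto simp: flat_def flat_step_def poly_monom)
  \<comment> \<open>The substitution x = a + (c/(j+1)) r turns the scaled kernel into the fixed
    density \<open>?q\<close>: c^2 = 1 restores its argument, and \<open>\<bar>c\<bar> = 1\<close>
    makes the Jacobian cancel the factor j+1. The remaining factor tends to 1 because
    \<open>d > 0\<close>.\<close>
  have sub: "(\<integral>x. Y x * (Suc j * ?q (Suc j * (c * (x - a))) * bmp (Suc j * (d - c * (x - a)))) \<partial>lborel)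
     = (\<integral>r. Y (a + (c / Suc j) * r) * (?q r * bmp (Suc j * d - r)) \<partial>lborel)" for j
  proof -
    have k: "c / real (Suc j) \<noteq> 0" using c by auto
    have *: "real (Suc j) * (c * ((a + c / Suc j * r) - a)) = r" for r
    proof -
      have "real (Suc j) * (c * ((a + c / Suc j * r) - a)) = (c * c) * r"
        by (simp add: field_simps del: of_nat_Suc)
      then show ?thesis using cc by simp
    qed
    have **: "real (Suc j) * (d - c * ((a + c / Suc j * r) - a)) = Suc j * d - r" for r
      unfolding right_diff_distrib[of "real (Suc j)" d] * ..
    have ab: "\<bar>c / real (Suc j)\<bar> * real (Suc j) = 1" using c by (simp add: abs_divide)
    have "(\<integral>x. Y x * (Suc j * ?q (Suc j * (c * (x - a))) * bmp (Suc j * (d - c * (x - a)))) \<partial>lborel)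
      = \<bar>c / Suc j\<bar> *\<^sub>R (\<integral>r. Y (a + c / Suc j * r) * (Suc j * ?q (Suc j * (c * ((a + c / Suc j * r) - a)))
          * bmp (Suc j * (d - c * ((a + c / Suc j * r) - a)))) \<partial>lborel)"
      by (rule lborel_integral_real_affine[OF k])
    also have "\<dots> = (\<integral>r. \<bar>c / Suc j\<bar> * (Y (a + c / Suc j * r) * (Suc j * ?q r * bmp (Suc j * d - r))) \<partial>lborel)"
      unfolding * ** real_scaleR_def by (rule integral_mult_right_zero[symmetric])
    also have "\<dots> = (\<integral>r. Y (a + c / Suc j * r) * (?q r * bmp (Suc j * d - r)) \<partial>lborel)"
    proof (intro Bochner_Integration.integral_cong refl)
      fix r
      have "\<bar>c / Suc j\<bar> * (Y (a + c / Suc j * r) * (Suc j * ?q r * bmp (Suc j * d - r)))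
        = (\<bar>c / real (Suc j)\<bar> * real (Suc j)) * (Y (a + c / Suc j * r) * (?q r * bmp (Suc j * d - r)))"
        by (simp only: mult_ac)
      then show "\<bar>c / Suc j\<bar> * (Y (a + c / Suc j * r) * (Suc j * ?q r * bmp (Suc j * d - r)))
        = Y (a + c / Suc j * r) * (?q r * bmp (Suc j * d - r))" unfolding ab by simp
    qed
    finally show ?thesis .
  qed
  have "(\<lambda>j. \<integral>r. Y (a + (c / Suc j) * r) * (?q r * bmp (Suc j * d - r)) \<partial>lborel) \<longlonglongrightarrow> (\<integral>r. Y a * ?q r \<partial>lborel)"
  proof (rule integral_dominated_convergence)
    show "integrable lborel (\<lambda>r. M * ?q r)" using bmp_deriv_integral(1) by simp
    show "AE r in lborel. (\<lambda>j. Y (a + (c / Suc j) * r) * (?q r * bmp (Suc j * d - r))) \<longlonglongrightarrow> Y a * ?q r"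
    proof (rule AE_I2)
      fix r
      have "(\<lambda>j. a + (c / Suc j) * r) \<longlonglongrightarrow> a + 0 * r"
        by (intro tendsto_intros) real_asymp
      then have "(\<lambda>j. Y (a + (c / Suc j) * r)) \<longlonglongrightarrow> Y a"
        using Y(1) by (intro isCont_tendsto_compose[where g=Y]) (auto simp: continuous_on_eq_continuous_at)
      then have "(\<lambda>j. Y (a + (c / Suc j) * r) * (?q r * bmp (Suc j * d - r))) \<longlonglongrightarrow> Y a * (?q r * 1)"
        by (intro tendsto_intros bmp_tendsto_shift d)
      then show "(\<lambda>j. Y (a + (c / Suc j) * r) * (?q r * bmp (Suc j * d - r))) \<longlonglongrightarrow> Y a * ?q r" by simp
    qed
    show "AE r in lborel. norm (Y (a + (c / Suc j) * r) * (?q r * bmp (Suc j * d - r))) \<le> M * ?q r" for j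
    proof (rule AE_I2)
      fix r
      have "\<bar>Y (a + (c / Suc j) * r)\<bar> * (?q r * bmp (Suc j * d - r)) \<le> M * (?q r * 1)"
        using Y(2) nn bmp_bounds by (intro mult_mono mult_nonneg_nonneg) (auto intro: order_trans[OF abs_ge_zero Y(2)])
      then show "norm (Y (a + (c / Suc j) * r) * (?q r * bmp (Suc j * d - r))) \<le> M * ?q r"
        using nn[of r] bmp_bounds(1)[of "Suc j * d - r"] by (simp add: abs_mult del: of_nat_Suc)
    qed
  qed measurable
  then show ?thesis unfolding sub using bmp_deriv_integral(2) by simp
qed

lemma box_bump_real: "box_bump a b j x = bmp (real j * (x - a)) * bmp (real j * (b - x))"
  by (simp add: box_bump_def)

text \<open>Tested with bumps for (a,b), the derivative of the bump concentrates at \<open>a\<close>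
  with mass 1 and at \<open>b\<close> with mass -1, while the bumps themselves tend to the
  indicator. Interior endpoints keep the supports compact in the open time interval.\<close>

lemma weak_deriv_imp_integral:
  fixes y \<omega> :: "real \<Rightarrow> real"
  assumes y: "continuous_on {0..T} y" and \<omega>: "integrable (lebesgue_on {0..T}) \<omega>"
    and weak: "\<And>\<eta>. \<eta> \<in> test_functions {0<..<T} \<Longrightarrow>
      (\<integral>t. y t * deriv \<eta> t \<partial>lebesgue_on {0..T}) = - (\<integral>t. \<omega> t * \<eta> t \<partial>lebesgue_on {0..T})"
    and ab: "0 < a" "a < b" "b < T"
  shows "y b - y a = integral {a..b} \<omega>"
proof -
  let ?q = "flat (flat_step 1)"
  \<comment> \<open>\<open>y\<close> is continued by its end values, as the approximate identity
    needs a bounded continuous function on the whole line.\<close>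
  define Y where "Y t = y (max 0 (min T t))" for t
  have Yc: "continuous_on UNIV Y"
    unfolding Y_def by (intro continuous_on_compose2[OF y] continuous_intros) (use ab in auto)
  have "bounded (y ` {0..T})" using y by (intro compact_imp_bounded compact_continuous_image) auto
  then obtain M where "\<forall>z\<in>y ` {0..T}. norm z \<le> M" unfolding bounded_iff by blast
  then have M: "\<bar>Y t\<bar> \<le> M" for t unfolding Y_def using ab by auto
  have Yy: "Y t = y t" if "t \<in> {0..T}" for t using that by (simp add: Y_def)
  note [measurable] = borel_measurable_continuous_onI[OF Yc] 
  note [measurable] = flat_measurable
  define \<eta> where "\<eta> j = box_bump a b (Suc j)" for j
  have \<eta>: "\<eta> j \<in> test_functions {0<..<T}" for j
    unfolding \<eta>_def by (rule box_bump_test) (use ab in auto)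
  have \<eta>x: "\<eta> j x = bmp (Suc j * (x - a)) * bmp (Suc j * (b - x))" for j x
    by (simp only: \<eta>_def box_bump_real)
  \<comment> \<open>The two terms of the product rule, at \<open>a\<close> with c = 1 and at
    \<open>b\<close> with c = -1, written in the form of \<open>approximate_identity\<close>; each
    carries the other factor of the bump.\<close>
  define A where "A j x = Y x * (Suc j * ?q (Suc j * (1 * (x - a))) * bmp (Suc j * ((b - a) - 1 * (x - a))))" for j x
  define B where "B j x = Y x * (Suc j * ?q (Suc j * (-1 * (x - b))) * bmp (Suc j * ((b - a) - -1 * (x - b))))" for j x
  have d: "deriv (\<eta> j) x = Suc j * ?q (Suc j * (x - a)) * bmp (Suc j * (b - x))
       - Suc j * ?q (Suc j * (b - x)) * bmp (Suc j * (x - a))" for j x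
  proof (rule DERIV_imp_deriv)
    have "((\<lambda>x. bmp (Suc j * (x - a))) has_real_derivative ?q (Suc j * (x - a)) * Suc j) (at x)"
      "((\<lambda>x. bmp (Suc j * (b - x))) has_real_derivative ?q (Suc j * (b - x)) * - Suc j) (at x)"
      by (rule DERIV_chain2[OF flat_deriv]; auto intro!: derivative_eq_intros)+
    from DERIV_mult[OF this] show "(\<eta> j has_real_derivative Suc j * ?q (Suc j * (x - a)) * bmp (Suc j * (b - x))
       - Suc j * ?q (Suc j * (b - x)) * bmp (Suc j * (x - a))) (at x)"
      unfolding \<eta>x[abs_def] by (simp add: algebra_simps del: of_nat_Suc)
  qed
  have intA: "integrable lborel (A j)" and intB: "integrable lborel (B j)" for j
  proof -
    \<comment> \<open>On [a,b] both arguments of \<open>?q\<close> stay in this compact interval,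
      and outside [a,b] one factor vanishes; so \<open>A j\<close> and \<open>B j\<close> are
      bounded with compact support.\<close>
    have bd: "bounded (?q ` {0..real (Suc j) * (b - a)})"
      using flat_deriv by (intro compact_imp_bounded compact_continuous_image continuous_at_imp_continuous_on)
        (auto intro: DERIV_isCont)
    then obtain Q where "\<forall>z\<in>?q ` {0..real (Suc j) * (b - a)}. norm z \<le> Q" unfolding bounded_iff by blast
    then have Q: "\<And>s. s \<in> {0..real (Suc j) * (b - a)} \<Longrightarrow> \<bar>?q s\<bar> \<le> Q" by auto
    have Q0: "0 \<le> Q" using Q[of 0] ab by (intro order_trans[OF abs_ge_zero Q[of 0]]) (simp del: of_nat_Suc)
    have M0: "0 \<le> M" using M[of 0] by linarith
    have in1: "real (Suc j) * (x - a) \<in> {0..real (Suc j) * (b - a)}" "real (Suc j) * (b - x) \<in> {0..real (Suc j) * (b - a)}"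
      if "x \<in> {a..b}" for x using that by (auto intro!: mult_left_mono mult_nonneg_nonneg simp del: of_nat_Suc)
    have AB: "\<bar>A j x\<bar> \<le> M * (real (Suc j) * Q * 1)" "\<bar>B j x\<bar> \<le> M * (real (Suc j) * Q * 1)" if "x \<in> {a..b}" for x
      unfolding A_def B_def abs_mult using M0 Q0 M bmp_bounds Q[OF in1(1)[OF that]] Q[OF in1(2)[OF that]]
      by (intro mult_mono mult_nonneg_nonneg; simp add: algebra_simps del: of_nat_Suc)+
    have z: "A j x = 0" "B j x = 0" if "x \<notin> {a..b}" for x
    proof -
      have "x < a \<or> b < x" using that by auto
      then have "?q (Suc j * (x - a)) * bmp (Suc j * (b - x)) = 0" "?q (Suc j * (b - x)) * bmp (Suc j * (x - a)) = 0"
        using bmp_pos(2) by (auto simp: flat_def zero_less_mult_iff simp del: of_nat_Suc)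
      then show "A j x = 0" "B j x = 0" unfolding A_def B_def by (auto simp: algebra_simps simp del: of_nat_Suc)
    qed
    have bound: "\<bar>A j x\<bar> \<le> M * (real (Suc j) * Q * 1)" "\<bar>B j x\<bar> \<le> M * (real (Suc j) * Q * 1)" for x
      using AB[of x] z[of x] M0 Q0 by (cases "x \<in> {a..b}"; simp)+
    have "A j \<in> borel_measurable borel" "B j \<in> borel_measurable borel"
      unfolding A_def[abs_def] B_def[abs_def] by measurable
    then show "integrable lborel (A j)" "integrable lborel (B j)"
      using z bound by (auto intro!: integrable_bounded_compact[of _ "{a..b}" "M * (real (Suc j) * Q * 1)"])
  qed
  have e: "Y x * deriv (\<eta> j) x = A j x - B j x" for j x
    unfolding d A_def B_def by (simp add: algebra_simps del: of_nat_Suc)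
  have lhs: "(\<integral>t. y t * deriv (\<eta> j) t \<partial>lebesgue_on {0..T}) = (\<integral>x. A j x \<partial>lborel) - (\<integral>x. B j x \<partial>lborel)" for j
  proof -
    have md: "deriv (\<eta> j) \<in> borel_measurable borel" unfolding d[abs_def] by measurable
    have z: "deriv (\<eta> j) x = 0" if "x \<notin> {0..T}" for x
    proof -
      have "x < a \<or> b < x" using that ab by auto
      then show ?thesis unfolding d using bmp_pos(2) by (auto simp: flat_def zero_less_mult_iff simp del: of_nat_Suc)
    qed
    have "(\<integral>t. y t * deriv (\<eta> j) t \<partial>lebesgue_on {0..T}) = (\<integral>t. Y t * deriv (\<eta> j) t \<partial>lebesgue_on {0..T})"
      by (intro Bochner_Integration.integral_cong refl) (simp add: Yy)
    also have "\<dots> = (\<integral>t. Y t * deriv (\<eta> j) t \<partial>lborel)"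
      using md z by (intro integral_lebesgue_on_eq_lborel) auto
    also have "\<dots> = (\<integral>x. A j x \<partial>lborel) - (\<integral>x. B j x \<partial>lborel)"
      unfolding e using intA intB by (rule Bochner_Integration.integral_diff)
    finally show ?thesis .
  qed
  have s1: "(\<lambda>j. (\<integral>x. A j x \<partial>lborel) - (\<integral>x. B j x \<partial>lborel)) \<longlonglongrightarrow> Y a - Y b"
    unfolding A_def B_def using ab by (intro tendsto_diff approximate_identity[OF Yc M]) auto
  have s2: "(\<lambda>j. \<integral>t. \<omega> t * \<eta> j t \<partial>lebesgue_on {0..T}) \<longlonglongrightarrow> (\<integral>t. \<omega> t * indicator (box a b) t \<partial>lebesgue_on {0..T})"
  proof (rule integral_dominated_convergence)
    show "integrable (lebesgue_on {0..T}) (\<lambda>t. \<bar>\<omega> t\<bar>)" using \<omega> by simp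
    have m: "\<omega> \<in> borel_measurable (lebesgue_on {0..T})" using \<omega> by simp
    have m2: "f \<in> borel_measurable (lebesgue_on {0..T})" if "f \<in> borel_measurable borel" for f :: "real \<Rightarrow> real"
      using that by (intro measurable_restrict_space1 measurable_completion) simp
    show "(\<lambda>t. \<omega> t * indicator (box a b) t) \<in> borel_measurable (lebesgue_on {0..T})"
      by (intro borel_measurable_times m m2) simp
    show "(\<lambda>t. \<omega> t * \<eta> j t) \<in> borel_measurable (lebesgue_on {0..T})" for j
      by (intro borel_measurable_times m m2 test_function_measurable[OF \<eta>])
    show "AE t in lebesgue_on {0..T}. (\<lambda>j. \<omega> t * \<eta> j t) \<longlonglongrightarrow> \<omega> t * indicator (box a b) t"
      using LIMSEQ_Suc[OF box_bump_tendsto] unfolding \<eta>_def by (intro AE_I2 tendsto_intros)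
    show "AE t in lebesgue_on {0..T}. norm (\<omega> t * \<eta> j t) \<le> \<bar>\<omega> t\<bar>" for j
      using box_bump_bounds(2) unfolding \<eta>_def
      by (intro AE_I2) (auto simp: abs_mult abs_of_nonneg[OF box_bump_bounds(1)] intro!: mult_left_le)
  qed
  have "(\<integral>x. A j x \<partial>lborel) - (\<integral>x. B j x \<partial>lborel) = - (\<integral>t. \<omega> t * \<eta> j t \<partial>lebesgue_on {0..T})" for j
    using weak[OF \<eta>[of j]] unfolding lhs .
  with s1 have "(\<lambda>j. - (\<integral>t. \<omega> t * \<eta> j t \<partial>lebesgue_on {0..T})) \<longlonglongrightarrow> Y a - Y b" by simp
  from LIMSEQ_unique[OF this tendsto_minus[OF s2]]
  have "Y a - Y b = - (\<integral>t. \<omega> t * indicator (box a b) t \<partial>lebesgue_on {0..T})" .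
  moreover have "(\<integral>t. \<omega> t * indicator (box a b) t \<partial>lebesgue_on {0..T}) = integral {a..b} \<omega>"
  proof -
    have i: "integrable (lebesgue_on {0..T}) (\<lambda>t. \<omega> t * indicator (box a b) t)"
      by (rule integrable_real_mult_indicator) (use \<omega> ab in \<open>auto simp: sets_restrict_space_iff\<close>)
    have "(\<integral>t. \<omega> t * indicator (box a b) t \<partial>lebesgue_on {0..T}) = integral {0..T} (\<lambda>t. \<omega> t * indicator (box a b) t)"
      using i by (rule lebesgue_integral_eq_integral) simp
    also have "\<dots> = integral {0..T} (\<lambda>t. if t \<in> {a<..<b} then \<omega> t else 0)"
      by (intro integral_cong) (simp add: indicator_def)
    also have "\<dots> = integral {a<..<b} \<omega>"
    proof -
      have "{a<..<b} \<inter> {0..T} = {a<..<b}" using ab by auto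
      then show ?thesis by (simp only: integral_restrict_Int)
    qed
    also have "\<dots> = integral {a..b} \<omega>" by (simp add: integral_open_interval_real)
    finally show ?thesis .
  qed
  ultimately show ?thesis using Yy[of a] Yy[of b] ab by simp
qed

subsection \<open>Right-endpoint sums along random partitions\<close>

lemma sum_integral_consecutive:
  fixes f :: "real \<Rightarrow> real"
  assumes "f integrable_on {c..c + real n * h}" "0 \<le> h"
  shows "(\<Sum>i<n. integral {c + real i * h..c + real (Suc i) * h} f) = integral {c..c + real n * h} f"
  using assms(1)
proof (induction n)
  case (Suc n)
  have le: "c \<le> c + real n * h" "c + real n * h \<le> c + real (Suc n) * h"
    using assms(2) by (simp_all add: distrib_right)
  have "f integrable_on {c..c + real n * h}"
    using Suc.prems le by (elim integrable_on_subinterval) auto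
  then show ?case
    using Suc.IH Henstock_Kurzweil_Integration.integral_combine[OF le Suc.prems] by simp
qed simp

text \<open>The mean over the shift \<open>\<sigma>\<close> of the sums \<open>h * (\<Sum>i. E (a + \<sigma> + i h))\<close> is an integral of \<open>E\<close>.\<close>

lemma good_shift:
  fixes E :: "real \<Rightarrow> real"
  assumes E: "E integrable_on {0..T}" "\<And>t. 0 \<le> E t" "integral {0..T} E < \<epsilon>"
    and N: "negligible N" and a: "0 \<le> a" and h: "0 < h" and T: "a + real (Suc n) * h \<le> T"
  obtains \<sigma> where "\<sigma> \<in> {0<..<h}" "\<And>i. i \<le> n \<Longrightarrow> a + \<sigma> + real i * h \<notin> N"
    "h * (\<Sum>i<n. E (a + \<sigma> + real (Suc i) * h)) \<le> \<epsilon>"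
proof -
  define f where "f \<sigma> = (\<Sum>i<n. E (\<sigma> + (a + real (Suc i) * h)))" for \<sigma>
  \<comment> \<open>These are the shifts that move some partition point into \<open>N\<close>,
    together with both ends, so that the chosen shift lies strictly inside the interval.\<close>
  define N' where "N' = (\<Union>i\<le>n. (\<lambda>x. - (a + real i * h) + x) ` N) \<union> {0, h}"
  have N': "negligible N'"
    unfolding N'_def using N negligible_translation
    by (intro negligible_Un negligible_Union) (auto simp: negligible_finite[of "{0, h}", simplified])
  have sub: "E integrable_on {a + real (Suc i) * h..a + real (Suc (Suc i)) * h}" if "i < n" for i
  proof (rule integrable_on_subinterval[OF E(1)])
    have "real (Suc (Suc i)) * h \<le> real (Suc n) * h" using that h by (intro mult_right_mono) auto
    moreover have "0 \<le> real (Suc i) * h" using h by simp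
    ultimately show "{a + real (Suc i) * h..a + real (Suc (Suc i)) * h} \<subseteq> {0..T}" using a T by auto
  qed
  \<comment> \<open>As the shift runs over [0,h], the right endpoints sweep consecutive intervals of
    length \<open>h\<close> starting at \<open>a + h\<close>, so the integrals over the shift add up
    to one integral of \<open>E\<close>.\<close>
  have shift: "(\<lambda>\<sigma>. E (\<sigma> + (a + real (Suc i) * h))) integrable_on {0..h}"
    "integral {0..h} (\<lambda>\<sigma>. E (\<sigma> + (a + real (Suc i) * h))) = integral {a + h + real i * h..a + h + real (Suc i) * h} E"
    if "i < n" for i
    using integrable_shift_real_ivl[OF sub[OF that], of "a + real (Suc i) * h"]
      integral_shift_real_ivl[of "a + real (Suc i) * h" "a + real (Suc i) * h" "a + real (Suc (Suc i)) * h" E]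
    by (simp_all add: algebra_simps)
  have fi: "f integrable_on {0..h}" unfolding f_def using shift by (intro integrable_sum) auto
  have bound: "a + h + real n * h \<le> T" using T by (simp add: algebra_simps)
  have Ei: "E integrable_on {a + h..a + h + real n * h}"
    using E(1) by (rule integrable_on_subinterval) (use a h bound in auto)
  have "integral {0..h} f = (\<Sum>i<n. integral {a + h + real i * h..a + h + real (Suc i) * h} E)"
    unfolding f_def using shift by (subst integral_sum) auto
  also have "\<dots> = integral {a + h..a + h + real n * h} E"
    using Ei h by (intro sum_integral_consecutive) auto
  also have "\<dots> \<le> integral {0..T} E"
    using E(1,2) Ei a h bound by (intro integral_subset_le) auto
  finally have lt: "integral {0..h} f < \<epsilon>" using E(3) by simp
  \<comment> \<open>If \<open>f\<close> were at least \<epsilon>/h almost everywhere on an interval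
    of length \<open>h\<close>, its integral would reach \<epsilon>.\<close>
  have "\<exists>\<sigma>\<in>{0..h} - N'. h * f \<sigma> \<le> \<epsilon>"
  proof (rule ccontr)
    assume "\<not> ?thesis"
    then have gt: "\<epsilon> / h \<le> f \<sigma>" if "\<sigma> \<in> {0..h} - N'" for \<sigma>
      using that h by (force simp: field_simps)
    define f' where "f' \<sigma> = (if \<sigma> \<in> N' then \<epsilon> / h else f \<sigma>)" for \<sigma>
    have f': "f' integrable_on {0..h}" "integral {0..h} f' = integral {0..h} f"
      using integrable_spike[OF fi N', of f'] integral_spike[OF N', of "{0..h}" f f'] by (auto simp: f'_def)
    have "\<epsilon> = integral {0..h} (\<lambda>\<sigma>. \<epsilon> / h)" using h by simp
    also have "\<dots> \<le> integral {0..h} f'"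
      using f'(1) gt by (intro integral_le) (auto simp: f'_def)
    finally show False using lt f'(2) by simp
  qed
  then obtain \<sigma> where \<sigma>: "\<sigma> \<in> {0..h}" "\<sigma> \<notin> N'" "h * f \<sigma> \<le> \<epsilon>" by blast
  show thesis
  proof (rule that)
    have "\<sigma> \<noteq> 0" "\<sigma> \<noteq> h" using \<sigma>(2) unfolding N'_def by auto
    then show "\<sigma> \<in> {0<..<h}" using \<sigma>(1) by auto
    show "a + \<sigma> + real i * h \<notin> N" if "i \<le> n" for i
    proof
      assume "a + \<sigma> + real i * h \<in> N"
      then have "- (a + real i * h) + (a + \<sigma> + real i * h) \<in> (\<lambda>x. - (a + real i * h) + x) ` N" by (rule imageI)
      then have "\<sigma> \<in> (\<lambda>x. - (a + real i * h) + x) ` N" by simp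
      then show False using \<sigma>(2) that unfolding N'_def by blast
    qed
    show "h * (\<Sum>i<n. E (a + \<sigma> + real (Suc i) * h)) \<le> \<epsilon>"
      using \<sigma>(3) unfolding f_def by (simp only: add.assoc add.left_commute[of a])
  qed
qed

text \<open>Summed over the partition, \<open>step\<close> leaves \<kappa> times an integral of
  \<open>p\<close> and, divided by \<kappa>, three small terms: the integral of \<open>E\<close>,
  the endpoint sum bounded by \<open>good_shift\<close>, and the part from \<epsilon>. Since
  \<epsilon> may be chosen after \<kappa>, the division does no harm.\<close>

lemma antimono_from_random_partitions:
  fixes D p :: "real \<Rightarrow> real"
  assumes D: "continuous_on {0..T} D" and p: "p integrable_on {0..T}" "\<And>t. 0 \<le> p t"
    and step: "\<And>\<kappa> \<epsilon>. 0 < \<kappa> \<Longrightarrow> 0 < \<epsilon> \<Longrightarrow> \<exists>E \<delta> N. E integrable_on {0..T} \<and> (\<forall>t. 0 \<le> E t) \<and> integral {0..T} E < \<epsilon>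
        \<and> 0 < \<delta> \<and> negligible N \<and> (\<forall>s t. 0 < s \<longrightarrow> s < t \<longrightarrow> t < T \<longrightarrow> t < s + \<delta> \<longrightarrow> s \<notin> N \<longrightarrow> t \<notin> N \<longrightarrow>
          D t - D s \<le> \<kappa> * integral {s..t} p + (integral {s..t} E + (t - s) * (E t + \<epsilon>)) / \<kappa>)"
    and ab: "0 < a" "a < b" "b < T"
  shows "D b \<le> D a"
proof (rule field_le_epsilon)
  fix e :: real assume e: "0 < e"
  define P where "P = integral {0..T} p"
  have P: "0 \<le> P" unfolding P_def using p by (intro integral_nonneg) auto
  \<comment> \<open>The budget is e/4 for \<open>p\<close>, e/4 for the terms with \<open>E\<close>
    and \<epsilon>, and e/4 for each of the two shifted endpoints. \<open>P + 1\<close> avoids a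
    division by zero.\<close>
  define \<kappa> where "\<kappa> = e / (4 * (P + 1))"
  have \<kappa>: "0 < \<kappa>" using e P by (simp add: \<kappa>_def)
  have \<kappa>P: "\<kappa> * P \<le> e / 4" using e P by (simp add: \<kappa>_def field_simps)
  \<comment> \<open>The factor \<open>2 + T\<close> counts the integral of \<open>E\<close>, the
    endpoint sum, and the constant \<epsilon> over a length of at most \<open>T\<close>.\<close>
  define \<epsilon> where "\<epsilon> = \<kappa> * (e / 4) / (2 + T)"
  have T: "0 < T" using ab by simp
  have \<epsilon>: "0 < \<epsilon>" using e \<kappa> T by (simp add: \<epsilon>_def)
  have \<epsilon>T: "(2 * \<epsilon> + T * \<epsilon>) / \<kappa> = e / 4"
  proof -
    have "2 * \<epsilon> + T * \<epsilon> = (2 + T) * \<epsilon>" by (simp add: distrib_right)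
    also have "\<dots> = \<kappa> * (e / 4)"
      using iffD1[OF nonzero_divide_eq_eq \<epsilon>_def[symmetric]] T by (simp only: mult.commute)
    finally show ?thesis using \<kappa> by simp
  qed
  obtain E \<delta> N where E: "E integrable_on {0..T}" "\<And>t. 0 \<le> E t" "integral {0..T} E < \<epsilon>" and \<delta>: "0 < \<delta>" and N: "negligible N"
    and st: "\<And>s t. 0 < s \<Longrightarrow> s < t \<Longrightarrow> t < T \<Longrightarrow> t < s + \<delta> \<Longrightarrow> s \<notin> N \<Longrightarrow> t \<notin> N \<Longrightarrow>
          D t - D s \<le> \<kappa> * integral {s..t} p + (integral {s..t} E + (t - s) * (E t + \<epsilon>)) / \<kappa>"
    using step[OF \<kappa> \<epsilon>] by blast
  obtain r where r: "0 < r" "\<And>x y. x \<in> {0..T} \<Longrightarrow> y \<in> {0..T} \<Longrightarrow> \<bar>y - x\<bar> < r \<Longrightarrow> \<bar>D y - D x\<bar> < e / 4"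
    using compact_uniformly_continuous[OF D] e unfolding uniformly_continuous_on_def dist_real_def
    by (metis compact_Icc divide_pos_pos zero_less_numeral)
  \<comment> \<open>The mesh has to be below \<open>\<delta>\<close> for \<open>step\<close>, below
    \<open>r\<close> so that shifting an endpoint changes \<open>D\<close> by less than e/4, and
    below \<open>T - b\<close> so that the shifted partition ends before \<open>T\<close>.\<close>
  obtain n0 where n0: "(b - a) / Min {\<delta>, r, T - b} < real n0" using reals_Archimedean2 by blast
  define n where "n = Suc n0"
  define h where "h = (b - a) / real n"
  have m: "0 < Min {\<delta>, r, T - b}" using \<delta> r ab by simp
  have h0: "0 < h" using ab by (simp add: h_def n_def)
  have "(b - a) / Min {\<delta>, r, T - b} < real n" using n0 by (simp add: n_def)
  then have "h < Min {\<delta>, r, T - b}"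
    unfolding h_def using m by (subst pos_divide_less_eq) (simp_all add: n_def pos_divide_less_eq mult.commute del: Min_gr_iff)
  then have h: "h < \<delta>" "h < r" "h < T - b" by auto
  have nh: "real n * h = b - a" by (simp add: h_def n_def)
  have "a + real (Suc n) * h \<le> T" using nh h by (simp add: algebra_simps)
  from good_shift[OF E N less_imp_le[OF ab(1)] h0 this] obtain \<sigma> where
    \<sigma>: "\<sigma> \<in> {0<..<h}" "\<And>i. i \<le> n \<Longrightarrow> a + \<sigma> + real i * h \<notin> N"
    "h * (\<Sum>i<n. E (a + \<sigma> + real (Suc i) * h)) \<le> \<epsilon>" by blast
  define c where "c = a + \<sigma>"
  have c: "0 < c" "c + real n * h < T" using \<sigma>(1) ab nh h by (auto simp: c_def)
  have ci: "c + real i * h \<le> c + real n * h" if "i \<le> n" for i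
    using that h0 by simp
  have sub: "{c..c + real n * h} \<subseteq> {0..T}" using c by auto
  have "D (c + real n * h) - D (c + real 0 * h)
      = (\<Sum>i<n. D (c + real (Suc i) * h) - D (c + real i * h))"
    by (simp only: sum_lessThan_telescope[of "\<lambda>i. D (c + real i * h)"])
  also have "\<dots> \<le> (\<Sum>i<n. \<kappa> * integral {c + real i * h..c + real (Suc i) * h} p
      + (integral {c + real i * h..c + real (Suc i) * h} E + h * (E (c + real (Suc i) * h) + \<epsilon>)) / \<kappa>)"
  proof (rule sum_mono)
    fix i assume i: "i \<in> {..<n}"
    have d: "c + real (Suc i) * h - (c + real i * h) = h" by (simp add: algebra_simps)
    have ih: "0 \<le> real i * h" using h0 by simp
    have i': "Suc i \<le> n" using i by simp
    have pre: "0 < c + real i * h" "c + real i * h < c + real (Suc i) * h"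
      "c + real (Suc i) * h < T" "c + real (Suc i) * h < c + real i * h + \<delta>"
      using ih c ci[OF i'] d h(1) h0 by linarith+
    have "c + real i * h \<notin> N" "c + real (Suc i) * h \<notin> N"
      using \<sigma>(2)[of i] \<sigma>(2)[of "Suc i"] i unfolding c_def by auto
    from st[OF pre this]
    show "D (c + real (Suc i) * h) - D (c + real i * h) \<le> \<kappa> * integral {c + real i * h..c + real (Suc i) * h} p
      + (integral {c + real i * h..c + real (Suc i) * h} E + h * (E (c + real (Suc i) * h) + \<epsilon>)) / \<kappa>"
      unfolding d .
  qed
  also have "\<dots> = \<kappa> * (\<Sum>i<n. integral {c + real i * h..c + real (Suc i) * h} p)
      + ((\<Sum>i<n. integral {c + real i * h..c + real (Suc i) * h} E) + (h * (\<Sum>i<n. E (c + real (Suc i) * h)) + real n * h * \<epsilon>)) / \<kappa>"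
    by (simp add: sum.distrib sum_distrib_left sum_divide_distrib[symmetric] distrib_left mult.assoc del: of_nat_Suc)
  also have "\<dots> = \<kappa> * integral {c..c + real n * h} p
      + (integral {c..c + real n * h} E + (h * (\<Sum>i<n. E (c + real (Suc i) * h)) + real n * h * \<epsilon>)) / \<kappa>"
    using integrable_on_subinterval[OF p(1) sub] integrable_on_subinterval[OF E(1) sub] h0
    by (simp only: sum_integral_consecutive less_imp_le)
  also have "\<dots> \<le> \<kappa> * P + (\<epsilon> + (\<epsilon> + T * \<epsilon>)) / \<kappa>"
  proof (intro add_mono mult_left_mono divide_right_mono)
    show "integral {c..c + real n * h} p \<le> P"
      unfolding P_def using integrable_on_subinterval[OF p(1) sub] p sub by (intro integral_subset_le) auto
    have "integral {c..c + real n * h} E \<le> integral {0..T} E"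
      using integrable_on_subinterval[OF E(1) sub] E sub by (intro integral_subset_le) auto
    then show "integral {c..c + real n * h} E \<le> \<epsilon>" using E(3) by simp
    show "h * (\<Sum>i<n. E (c + real (Suc i) * h)) \<le> \<epsilon>" using \<sigma>(3) by (simp add: c_def)
    show "real n * h * \<epsilon> \<le> T * \<epsilon>" using nh ab \<epsilon> by (intro mult_right_mono) auto
  qed (use \<kappa> in auto)
  also have "\<dots> \<le> e / 2"
  proof -
    have eq: "\<epsilon> + (\<epsilon> + T * \<epsilon>) = 2 * \<epsilon> + T * \<epsilon>" by simp
    show ?thesis unfolding eq \<epsilon>T using \<kappa>P by linarith
  qed
  finally have main: "D (c + real n * h) - D (c + real 0 * h) \<le> e / 2" .
  then have main: "D (c + real n * h) - D c \<le> e / 2" by simp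
  have \<sigma>h: "0 < \<sigma>" "\<sigma> < h" using \<sigma>(1) by auto
  have "\<bar>D (c + real n * h) - D b\<bar> < e / 4"
    by (rule r(2)) (use c ab nh h \<sigma>h in \<open>auto simp: c_def\<close>)
  moreover have "\<bar>D c - D a\<bar> < e / 4"
    by (rule r(2)) (use c ab nh h \<sigma>h in \<open>auto simp: c_def\<close>)
  ultimately show "D b \<le> D a + e" using main by linarith
qed

subsection \<open>Integral inequalities of Gronwall type\<close>

lemma antimono_if_locally_antimono:
  fixes \<Psi> :: "real \<Rightarrow> real"
  assumes "0 < \<delta>" "s \<le> t"
    and loc: "\<And>t1 t2. s \<le> t1 \<Longrightarrow> t1 \<le> t2 \<Longrightarrow> t2 \<le> t \<Longrightarrow> t2 - t1 < \<delta> \<Longrightarrow> \<Psi> t2 \<le> \<Psi> t1"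
  shows "\<Psi> t \<le> \<Psi> s"
proof -
  obtain n0 where n0: "(t - s) / \<delta> < real n0" using reals_Archimedean2 by blast
  define n where "n = Suc n0"
  define h where "h = (t - s) / real n"
  have "(t - s) / \<delta> < real n" using n0 by (simp add: n_def)
  then have h: "0 \<le> h" "h < \<delta>" using assms(1,2) by (simp_all add: h_def n_def field_simps)
  have nh: "real n * h = t - s" by (simp add: h_def n_def)
  have "\<Psi> (s + real i * h) \<le> \<Psi> s" if "i \<le> n" for i
    using that
  proof (induction i)
    case (Suc i)
    have "real (Suc i) * h \<le> real n * h" using Suc.prems h by (intro mult_right_mono) auto
    then have "\<Psi> (s + real (Suc i) * h) \<le> \<Psi> (s + real i * h)"
      using h nh by (intro loc) (auto simp: algebra_simps)
    then show ?case using Suc by simp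
  qed simp
  from this[of n] show ?thesis using nh by simp
qed

lemma absolutely_integrable_continuous_mult:
  fixes k z :: "real \<Rightarrow> real"
  assumes "k absolutely_integrable_on {s..t}" "continuous_on {s..t} z"
  shows "(\<lambda>\<tau>. z \<tau> * k \<tau>) absolutely_integrable_on {s..t}"
proof (rule absolutely_integrable_bounded_measurable_product_real[OF _ _ _ assms(1)])
  show "z \<in> borel_measurable (lebesgue_on {s..t})"
    using assms(2) by (intro continuous_imp_measurable_on_sets_lebesgue) auto
  show "bounded (z ` {s..t})"
    using assms(2) by (intro compact_imp_bounded compact_continuous_image) auto
qed simp

text \<open>Only increments of \<open>y\<close> are controlled, so the logarithm is not
  differentiated: ln x \<le> x - 1 bounds its increments by integrals of \<open>y k\<close> divided
  by the left value of \<open>y\<close>. On short intervals the quotient of values of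
  \<open>y\<close> is close to 1, at the price of \<epsilon> times the integral of the absolute
  value of \<open>k\<close>.\<close>

lemma gronwall_positive:
  fixes y k :: "real \<Rightarrow> real"
  assumes st: "s \<le> t" and y: "continuous_on {s..t} y" "\<And>\<tau>. \<tau> \<in> {s..t} \<Longrightarrow> 0 < y \<tau>"
    and k: "k absolutely_integrable_on {s..t}"
    and le: "\<And>t1 t2. s \<le> t1 \<Longrightarrow> t1 \<le> t2 \<Longrightarrow> t2 \<le> t \<Longrightarrow> y t2 - y t1 \<le> integral {t1..t2} (\<lambda>\<tau>. y \<tau> * k \<tau>)"
  shows "y t \<le> y s * exp (integral {s..t} k)"
proof -
  define K where "K = integral {s..t} (\<lambda>\<tau>. \<bar>k \<tau>\<bar>)"
  have ki: "k integrable_on {s..t}" "(\<lambda>\<tau>. \<bar>k \<tau>\<bar>) integrable_on {s..t}"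
    using k unfolding absolutely_integrable_on_def by auto
  have K: "0 \<le> K" unfolding K_def using ki by (intro integral_nonneg) auto
  have yk: "(\<lambda>\<tau>. y \<tau> * k \<tau>) integrable_on {s..t}"
    using absolutely_integrable_continuous_mult[OF k y(1)] set_lebesgue_integral_eq_integral(1) by blast
  obtain m where m: "m \<in> {s..t}" "\<And>\<tau>. \<tau> \<in> {s..t} \<Longrightarrow> y m \<le> y \<tau>"
    using continuous_attains_inf[OF compact_Icc _ y(1)] st by auto
  have m0: "0 < y m" using y(2) m by blast
  have main: "ln (y t) - ln (y s) \<le> integral {s..t} k + \<epsilon> * K" if \<epsilon>: "0 < \<epsilon>" for \<epsilon>
  proof -
    \<comment> \<open>A tolerance relative to the minimum of \<open>y\<close> makes the quotient of
      two nearby values differ from 1 by at most \<epsilon>.\<close>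
    obtain \<delta> where \<delta>: "0 < \<delta>" "\<And>x z. x \<in> {s..t} \<Longrightarrow> z \<in> {s..t} \<Longrightarrow> \<bar>z - x\<bar> < \<delta> \<Longrightarrow> \<bar>y z - y x\<bar> < \<epsilon> * y m"
      using compact_uniformly_continuous[OF y(1)] \<epsilon> m0 unfolding uniformly_continuous_on_def dist_real_def
      by (metis compact_Icc mult_pos_pos)
    \<comment> \<open>The error term carries the absolute value because \<open>k\<close> may have
      either sign.\<close>
    define A where "A \<tau> = k \<tau> + \<epsilon> * \<bar>k \<tau>\<bar>" for \<tau>
    have Ai: "A integrable_on {s..t}" unfolding A_def using ki by (intro integrable_add integrable_on_mult_right) auto
    define \<Psi> where "\<Psi> r = ln (y r) - integral {s..r} A" for r
    have "\<Psi> t \<le> \<Psi> s"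
    proof (rule antimono_if_locally_antimono[OF \<delta>(1) st])
      fix t1 t2 assume t: "s \<le> t1" "t1 \<le> t2" "t2 \<le> t" "t2 - t1 < \<delta>"
      have in12: "t1 \<in> {s..t}" "t2 \<in> {s..t}" using t by auto
      have sub: "{t1..t2} \<subseteq> {s..t}" using t by auto
      note pos = y(2)[OF in12(1)] y(2)[OF in12(2)]
      have "ln (y t2) - ln (y t1) = ln (y t2 / y t1)" using pos by (simp add: ln_div)
      also have "\<dots> \<le> y t2 / y t1 - 1" using pos by (intro ln_le_minus_one) simp
      also have "\<dots> = (y t2 - y t1) / y t1" using pos by (simp add: diff_divide_distrib)
      also have "\<dots> \<le> integral {t1..t2} (\<lambda>\<tau>. y \<tau> * k \<tau>) / y t1"
        using le[OF t(1,2,3)] pos by (intro divide_right_mono) auto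
      also have "\<dots> = integral {t1..t2} (\<lambda>\<tau>. y \<tau> * k \<tau> / y t1)" by simp
      also have "\<dots> \<le> integral {t1..t2} A"
      proof (rule integral_le)
        show "(\<lambda>\<tau>. y \<tau> * k \<tau> / y t1) integrable_on {t1..t2}"
          using integrable_on_subinterval[OF yk sub] unfolding divide_inverse by (rule integrable_on_mult_left)
        show "A integrable_on {t1..t2}" using integrable_on_subinterval[OF Ai sub] .
        fix \<tau> assume \<tau>: "\<tau> \<in> {t1..t2}"
        have "\<bar>y \<tau> - y t1\<bar> \<le> \<epsilon> * y m" using \<delta>(2)[of t1 \<tau>] in12 \<tau> t by force
        also have "\<dots> \<le> \<epsilon> * y t1" using m(2)[OF in12(1)] \<epsilon> by simp
        finally have "\<bar>y \<tau> / y t1 - 1\<bar> \<le> \<epsilon>"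
          using pos by (simp add: abs_le_iff field_simps)
        then have "\<bar>(y \<tau> / y t1 - 1) * k \<tau>\<bar> \<le> \<epsilon> * \<bar>k \<tau>\<bar>"
          unfolding abs_mult by (rule mult_right_mono) simp
        then have "(y \<tau> / y t1 - 1) * k \<tau> \<le> \<epsilon> * \<bar>k \<tau>\<bar>" by linarith
        moreover have "y \<tau> * k \<tau> / y t1 = k \<tau> + (y \<tau> / y t1 - 1) * k \<tau>"
          by (simp add: left_diff_distrib)
        ultimately show "y \<tau> * k \<tau> / y t1 \<le> A \<tau>" unfolding A_def by linarith
      qed
      also have "integral {t1..t2} A = integral {s..t2} A - integral {s..t1} A"
        using Henstock_Kurzweil_Integration.integral_combine[of s t1 t2 A]
          integrable_on_subinterval[OF Ai, of s t2] t by auto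
      finally show "\<Psi> t2 \<le> \<Psi> t1" by (simp add: \<Psi>_def)
    qed
    moreover have "integral {s..t} A = integral {s..t} k + \<epsilon> * K"
      unfolding A_def K_def using ki by (subst Henstock_Kurzweil_Integration.integral_add) (auto intro: integrable_on_mult_right)
    ultimately show ?thesis by (simp add: \<Psi>_def)
  qed
  have "ln (y t) - ln (y s) \<le> integral {s..t} k"
  proof (rule field_le_epsilon)
    fix e :: real assume "0 < e"
    then have "0 < e / (K + 1)" "e / (K + 1) * K \<le> e" using K by (auto simp: field_simps)
    then show "ln (y t) - ln (y s) \<le> integral {s..t} k + e" using main by fastforce
  qed
  then have "exp (ln (y t)) \<le> exp (ln (y s) + integral {s..t} k)" by simp
  then show ?thesis using y(2) st by (simp add: exp_add)
qed

lemma absolutely_integrable_quotient: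
  fixes y g :: "real \<Rightarrow> real"
  assumes "(\<lambda>\<tau>. g \<tau> * y \<tau>) absolutely_integrable_on {s..t}" "continuous_on {s..t} y"
    "\<And>\<tau>. \<tau> \<in> {s..t} \<Longrightarrow> y \<tau> \<noteq> 0"
  shows "g absolutely_integrable_on {s..t}"
proof -
  have "(\<lambda>\<tau>. inverse (y \<tau>) * (g \<tau> * y \<tau>)) absolutely_integrable_on {s..t}"
    using absolutely_integrable_continuous_mult[OF assms(1) continuous_on_inverse[OF assms(2)]] assms(3) by blast
  then show ?thesis
    by (rule absolutely_integrable_spike[OF _ negligible_empty]) (use assms(3) in auto)
qed

text \<open>Here \<open>g\<close> is only gauge integrable: on intervals where \<open>y\<close> is positive, the absolute
  integrability of \<open>g y\<close> is inherited by \<open>g\<close>, and past a zero \<open>y\<close> cannot become positive again.\<close>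

lemma gronwall_nonneg:
  fixes y g :: "real \<Rightarrow> real"
  assumes t: "0 \<le> t" and y: "continuous_on {0..t} y" "\<And>\<tau>. \<tau> \<in> {0..t} \<Longrightarrow> 0 \<le> y \<tau>"
    and g: "g integrable_on {0..t}" and gy: "(\<lambda>\<tau>. g \<tau> * y \<tau>) absolutely_integrable_on {0..t}"
    and le: "\<And>t1 t2. 0 \<le> t1 \<Longrightarrow> t1 \<le> t2 \<Longrightarrow> t2 \<le> t \<Longrightarrow> y t2 - y t1 \<le> - 2 * integral {t1..t2} (\<lambda>\<tau>. g \<tau> * y \<tau>)"
  shows "y t \<le> y 0 * exp (- 2 * integral {0..t} g)"
proof (cases "y t = 0")
  case True
  then show ?thesis using y(2)[of 0] t by simp
next
  case False
  have pos_case: "y t \<le> y s * exp (- 2 * integral {s..t} g)"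
    if s: "0 \<le> s" "s \<le> t" and nz: "\<And>\<tau>. \<tau> \<in> {s..t} \<Longrightarrow> y \<tau> \<noteq> 0" for s
  proof -
    have sub: "{s..t} \<subseteq> {0..t}" using s by auto
    have yc: "continuous_on {s..t} y" using continuous_on_subset[OF y(1) sub] .
    have "(\<lambda>\<tau>. g \<tau> * y \<tau>) absolutely_integrable_on {s..t}"
      using gy by (rule absolutely_integrable_on_subinterval) (use s in auto)
    then have ga: "g absolutely_integrable_on {s..t}"
      using yc nz by (rule absolutely_integrable_quotient)
    have "y t \<le> y s * exp (integral {s..t} (\<lambda>\<tau>. - 2 * g \<tau>))"
    proof (rule gronwall_positive[OF s(2) yc])
      show "0 < y \<tau>" if "\<tau> \<in> {s..t}" for \<tau> using nz[OF that] y(2)[of \<tau>] that s by force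
      show "(\<lambda>\<tau>. - 2 * g \<tau>) absolutely_integrable_on {s..t}"
        using absolutely_integrable_continuous_mult[OF ga continuous_on_const] .
      fix t1 t2 assume t12: "s \<le> t1" "t1 \<le> t2" "t2 \<le> t"
      then have "y t2 - y t1 \<le> - 2 * integral {t1..t2} (\<lambda>\<tau>. g \<tau> * y \<tau>)" using s by (intro le) auto
      also have "\<dots> = integral {t1..t2} (\<lambda>\<tau>. y \<tau> * (- 2 * g \<tau>))"
        unfolding integral_mult_right[symmetric] by (intro integral_cong) simp
      finally show "y t2 - y t1 \<le> integral {t1..t2} (\<lambda>\<tau>. y \<tau> * (- 2 * g \<tau>))" .
    qed
    then show ?thesis by simp
  qed
  show ?thesis
  proof (cases "\<exists>\<tau>\<in>{0..t}. y \<tau> = 0")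
    case False
    then show ?thesis using pos_case[of 0] t by auto
  next
    case True
    \<comment> \<open>Its maximum \<open>t0\<close> is the last zero before \<open>t\<close>; the
      positive case applies on every [s,t] with \<open>s > t0\<close>.\<close>
    define Z where "Z = {\<tau> \<in> {0..t}. y \<tau> = 0}"
    have "closed Z" unfolding Z_def
      using continuous_closed_preimage_constant[OF y(1) closed_atLeastAtMost] .
    then have "compact Z" unfolding Z_def
      by (metis (no_types, lifting) bounded_closed_interval bounded_subset compact_eq_bounded_closed mem_Collect_eq subsetI)
    then obtain t0 where t0: "t0 \<in> Z" "\<And>\<tau>. \<tau> \<in> Z \<Longrightarrow> \<tau> \<le> t0"
      using compact_attains_sup[of Z] True unfolding Z_def by blast
    have t0': "0 \<le> t0" "t0 < t" "y t0 = 0" using t0(1) \<open>y t \<noteq> 0\<close> unfolding Z_def by (auto simp: less_le)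
    have nz: "y \<tau> \<noteq> 0" if "t0 < \<tau>" "\<tau> \<le> t" for \<tau> using t0(2)[of \<tau>] that t0' unfolding Z_def by force
    \<comment> \<open>\<open>G s\<close> is the bound of the positive case as a function of its
      starting point. Gauge integrability of \<open>g\<close> on all of [0,t] makes the exponent
      continuous at \<open>t0\<close>, so the bound tends to \<open>G t0 = 0\<close>, against
      \<open>y t > 0\<close>.\<close>
    define G where "G s = y s * exp (- 2 * (integral {0..t} g - integral {0..s} g))" for s
    have Gc: "continuous_on {0..t} G"
      unfolding G_def using indefinite_integral_continuous_1[OF g] y(1) by (intro continuous_intros)
    have le_G: "y t \<le> G s" if "t0 < s" "s \<le> t" for s
    proof -
      have "integral {s..t} g = integral {0..t} g - integral {0..s} g"
        using Henstock_Kurzweil_Integration.integral_combine[of 0 s t g] g that t0' by auto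
      then show ?thesis using pos_case[of s] nz that t0' unfolding G_def by auto
    qed
    have "(G \<longlongrightarrow> G t0) (at t0 within {t0<..t})"
    proof (rule tendsto_within_subset)
      show "(G \<longlongrightarrow> G t0) (at t0 within {0..t})" using Gc t0' by (simp add: continuous_on_def)
    qed (use t0' in auto)
    moreover have "\<forall>\<^sub>F s in at t0 within {t0<..t}. y t \<le> G s"
      unfolding eventually_at_filter using le_G by (intro always_eventually) auto
    moreover have "at t0 within {t0<..t} \<noteq> bot"
      using t0' by (simp add: trivial_limit_within islimpt_Ioc)
    ultimately have "y t \<le> G t0" by (rule tendsto_lowerbound)
    then have "y t \<le> 0" using t0' by (simp add: G_def)
    then show ?thesis using y(2)[of t] t \<open>y t \<noteq> 0\<close> by auto
  qed
qed

subsection \<open>Functions of time\<close>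

text \<open>This rests on the completeness of Lebesgue measure, by which every subset of a null set
  is measurable.\<close>

lemma AE_cong_measurable_lebesgue_on:
  fixes f g :: "real \<Rightarrow> real"
  assumes f: "f \<in> borel_measurable (lebesgue_on S)" and S: "S \<in> sets lebesgue"
    and ae: "AE x in lebesgue_on S. f x = g x"
  shows "g \<in> borel_measurable (lebesgue_on S)"
proof -
  have "(\<lambda>x. indicator S x *\<^sub>R f x) \<in> borel_measurable lebesgue"
    using f S by (subst (asm) borel_measurable_restrict_space_iff) auto
  moreover have "AE x in lebesgue. indicator S x *\<^sub>R f x = indicator S x *\<^sub>R g x"
    using ae S by (subst (asm) AE_restrict_space_iff) (auto simp: indicator_def)
  ultimately have "(\<lambda>x. indicator S x *\<^sub>R g x) \<in> borel_measurable lebesgue"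
    by (rule borel_measurable_AE)
  then show ?thesis using S by (subst borel_measurable_restrict_space_iff) auto
qed

lemma AE_LIMSEQ_measurable_lebesgue_on:
  fixes g :: "real \<Rightarrow> real"
  assumes f: "\<And>n. f n \<in> borel_measurable (lebesgue_on S)" and S: "S \<in> sets lebesgue"
    and ae: "AE x in lebesgue_on S. (\<lambda>n. f n x) \<longlonglongrightarrow> g x"
  shows "g \<in> borel_measurable (lebesgue_on S)"
proof (rule AE_cong_measurable_lebesgue_on[OF _ S])
  show "(\<lambda>x. lim (\<lambda>n. f n x)) \<in> borel_measurable (lebesgue_on S)"
    using f by (rule borel_measurable_lim_metric)
  show "AE x in lebesgue_on S. lim (\<lambda>n. f n x) = g x"
    using ae by eventually_elim (rule limI)
qed

lemma integrable_lebesgue_on_iff: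
  fixes f :: "real \<Rightarrow> real"
  shows "S \<in> sets lebesgue \<Longrightarrow> integrable (lebesgue_on S) f \<longleftrightarrow> f absolutely_integrable_on S"
  by (simp add: set_integrable_def integrable_restrict_space)

lemma AE_lebesgue_on_negligible:
  assumes "AE x in lebesgue_on S. P x" "S \<in> sets lebesgue"
  obtains N where "negligible N" "\<And>x. x \<in> S \<Longrightarrow> x \<notin> N \<Longrightarrow> P x"
proof -
  have "AE x in lebesgue. x \<in> S \<longrightarrow> P x" using assms by (simp add: AE_restrict_space_iff)
  from AE_E3[OF this] obtain N where "\<And>x. x \<in> space lebesgue - N \<Longrightarrow> x \<in> S \<longrightarrow> P x" "N \<in> null_sets lebesgue"
    by blast
  then show thesis using that[of N] by (auto simp: negligible_iff_null_sets)
qed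

lemma strongly_measurable_const:
  fixes \<phi> :: "'a::euclidean_space \<Rightarrow> real"
  assumes "open \<Omega>" "\<phi> \<in> H10 \<Omega>"
  shows "strongly_measurable T (H10 \<Omega>) (H1_norm \<Omega>) (\<lambda>t. \<phi>)"
proof -
  have "H1_norm \<Omega> (\<phi> - \<phi>) = 0" using H1_norm_zero[OF assms(1)] by (simp add: fun_diff_def)
  then show ?thesis
    unfolding strongly_measurable_def using assms by (auto intro!: exI[of _ "\<lambda>n t. \<phi>"])
qed

lemma L2_time_const:
  assumes "open \<Omega>" "\<phi> \<in> H10 \<Omega>"
  shows "(\<lambda>t. \<phi>) \<in> L2_time T (H10 \<Omega>) (H1_norm \<Omega>)"
proof -
  have "finite_measure (lebesgue_on {0..T})" by (intro finite_measure_lebesgue_on) auto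
  then show ?thesis
    unfolding L2_time_def using strongly_measurable_const[OF assms] finite_measure.integrable_const by auto
qed

text \<open>No sigma-algebra is placed on the function space, so measurability in time has to come
  from simple functions: the distance of two of them is a simple real function, and these converge
  to the distance from \<open>u\<close>.\<close>

lemma H1_distance_measurable:
  fixes u :: "real \<Rightarrow> 'a::euclidean_space \<Rightarrow> real"
  assumes \<Omega>: "open \<Omega>" and u: "strongly_measurable T (H10 \<Omega>) (H1_norm \<Omega>) u"
    and c: "simple_function (lebesgue_on {0..T}) c" "c ` {0..T} \<subseteq> H1 \<Omega>"
  shows "(\<lambda>t. H1_norm \<Omega> (\<lambda>x. c t x - u t x)) \<in> borel_measurable (lebesgue_on {0..T})"
proof -
  obtain s where s: "\<And>n. simple_function (lebesgue_on {0..T}) (s n)" "\<And>n. s n ` {0..T} \<subseteq> H10 \<Omega>"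
      "AE t in lebesgue_on {0..T}. (\<lambda>n. H1_norm \<Omega> (s n t - u t)) \<longlonglongrightarrow> 0"
    and uH: "AE t in lebesgue_on {0..T}. u t \<in> H10 \<Omega>"
    using u unfolding strongly_measurable_def by blast
  show ?thesis
  proof (rule AE_LIMSEQ_measurable_lebesgue_on)
    show "(\<lambda>t. H1_norm \<Omega> (\<lambda>x. c t x - s n t x)) \<in> borel_measurable (lebesgue_on {0..T})" for n
      using simple_function_compose2[OF c(1) s(1), of "\<lambda>a b. H1_norm \<Omega> (\<lambda>x. a x - b x)"]
      by (rule borel_measurable_simple_function)
    have "AE t in lebesgue_on {0..T}. t \<in> {0..T}" by (rule AE_I2) simp
    with s(3) uH show "AE t in lebesgue_on {0..T}. (\<lambda>n. H1_norm \<Omega> (\<lambda>x. c t x - s n t x)) \<longlonglongrightarrow> H1_norm \<Omega> (\<lambda>x. c t x - u t x)"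
    proof eventually_elim
      case (elim t)
      have h: "u t \<in> H1 \<Omega>" "c t \<in> H1 \<Omega>" using elim H10_H1 c(2) by auto
      have sn: "s n t \<in> H1 \<Omega>" for n using s(2) elim(3) H10_H1 by blast
      show ?case
      proof (rule LIM_zero_cancel, rule Lim_null_comparison[OF always_eventually elim(1)], rule allI)
        fix n
        have "\<bar>H1_norm \<Omega> (\<lambda>x. c t x - s n t x) - H1_norm \<Omega> (\<lambda>x. c t x - u t x)\<bar>
            \<le> H1_norm \<Omega> (\<lambda>x. (c t x - s n t x) - (c t x - u t x))"
          by (intro H1_norm_le_diff H1_diff \<Omega> h sn)
        also have "\<dots> = H1_norm \<Omega> (\<lambda>x. u t x - s n t x)" by simp
        also have "\<dots> = H1_norm \<Omega> (s n t - u t)"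
          using H1_norm_minus_commute[OF \<Omega> h(1) sn] by (simp add: fun_diff_def)
        finally show "norm (H1_norm \<Omega> (\<lambda>x. c t x - s n t x) - H1_norm \<Omega> (\<lambda>x. c t x - u t x)) \<le> H1_norm \<Omega> (s n t - u t)"
          by simp
      qed
    qed
  qed simp
qed

text \<open>Pairing simple approximations of \<open>w\<close> and \<open>u\<close> gives simple real
  functions, whence measurability. The product of the two norms is at most the sum of their squares,
  whence integrability.\<close>

lemma pairing_integrable:
  fixes u :: "real \<Rightarrow> 'a::euclidean_space \<Rightarrow> real"
  assumes \<Omega>: "open \<Omega>" and u: "u \<in> L2_time T (H10 \<Omega>) (H1_norm \<Omega>)" and w: "w \<in> L2_time T (Hm1 \<Omega>) (Hm1_norm \<Omega>)"
  shows "integrable (lebesgue_on {0..T}) (\<lambda>t. w t (u t))"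
proof -
  obtain s where s: "\<And>n. simple_function (lebesgue_on {0..T}) (s n)" "\<And>n. s n ` {0..T} \<subseteq> H10 \<Omega>"
      "AE t in lebesgue_on {0..T}. (\<lambda>n. H1_norm \<Omega> (s n t - u t)) \<longlonglongrightarrow> 0"
    and uH: "AE t in lebesgue_on {0..T}. u t \<in> H10 \<Omega>"
    using u unfolding L2_time_def strongly_measurable_def by blast
  obtain z where z: "\<And>n. simple_function (lebesgue_on {0..T}) (z n)" "\<And>n. z n ` {0..T} \<subseteq> Hm1 \<Omega>"
      "AE t in lebesgue_on {0..T}. (\<lambda>n. Hm1_norm \<Omega> (z n t - w t)) \<longlonglongrightarrow> 0"
    and wH: "AE t in lebesgue_on {0..T}. w t \<in> Hm1 \<Omega>"
    using w unfolding L2_time_def strongly_measurable_def by blast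
  have T: "AE t in lebesgue_on {0..T}. t \<in> {0..T}" by (rule AE_I2) simp
  have m: "(\<lambda>t. w t (u t)) \<in> borel_measurable (lebesgue_on {0..T})"
  proof (rule AE_LIMSEQ_measurable_lebesgue_on)
    show "(\<lambda>t. z n t (s n t)) \<in> borel_measurable (lebesgue_on {0..T})" for n
      using simple_function_compose2[OF z(1) s(1), of "\<lambda>a b. a b"]
      by (rule borel_measurable_simple_function)
    from s(3) uH z(3) wH T show "AE t in lebesgue_on {0..T}. (\<lambda>n. z n t (s n t)) \<longlonglongrightarrow> w t (u t)"
    proof eventually_elim
      case (elim t)
      have h: "u t \<in> H1 \<Omega>" using elim H10_H1 by auto
      have sn: "s n t \<in> H1 \<Omega>" for n using s(2) elim(5) H10_H1 by blast
      have zn: "z n t \<in> Hm1 \<Omega>" for n using z(2) elim(5) by blast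
      have sl: "(\<lambda>n. H1_norm \<Omega> (s n t)) \<longlonglongrightarrow> H1_norm \<Omega> (u t)"
        using H1_norm_le_diff[OF \<Omega> sn h]
        by (intro LIM_zero_cancel[OF Lim_null_comparison[OF always_eventually elim(1)]]) (simp add: fun_diff_def)
      show ?case
      proof (rule LIM_zero_cancel, rule Lim_null_comparison[OF always_eventually], rule allI)
        fix n
        have "z n t (s n t) - w t (u t) = (z n t - w t) (s n t) + w t (\<lambda>x. s n t x - u t x)"
          unfolding Hm1_diff[OF \<Omega> elim(4) sn h] minus_apply by linarith
        then show "norm (z n t (s n t) - w t (u t)) \<le> Hm1_norm \<Omega> (z n t - w t) * H1_norm \<Omega> (s n t)
            + Hm1_norm \<Omega> (w t) * H1_norm \<Omega> (s n t - u t)"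
          unfolding real_norm_def fun_diff_def[of "s n t" "u t"]
          using Hm1_bound[OF \<Omega> Hm1_minus[OF zn[of n] elim(4)] sn[of n]]
            Hm1_bound[OF \<Omega> elim(4) H1_diff[OF \<Omega> sn[of n] h]] by linarith
        show "(\<lambda>n. Hm1_norm \<Omega> (z n t - w t) * H1_norm \<Omega> (s n t) + Hm1_norm \<Omega> (w t) * H1_norm \<Omega> (s n t - u t)) \<longlonglongrightarrow> 0"
          using tendsto_add[OF tendsto_mult[OF elim(3) sl] tendsto_mult[OF tendsto_const elim(1)]] by simp
      qed
    qed
  qed simp
  show ?thesis
  proof (rule Bochner_Integration.integrable_bound[OF _ m])
    show "integrable (lebesgue_on {0..T}) (\<lambda>t. (Hm1_norm \<Omega> (w t))\<^sup>2 + (H1_norm \<Omega> (u t))\<^sup>2)"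
      using u w unfolding L2_time_def by auto
    show "AE t in lebesgue_on {0..T}. norm (w t (u t)) \<le> norm ((Hm1_norm \<Omega> (w t))\<^sup>2 + (H1_norm \<Omega> (u t))\<^sup>2)"
      using uH wH
    proof eventually_elim
      case (elim t)
      have "\<bar>w t (u t)\<bar> \<le> Hm1_norm \<Omega> (w t) * H1_norm \<Omega> (u t)"
        by (rule Hm1_bound[OF \<Omega> elim(2) H10_H1[OF elim(1)]])
      also have "\<dots> \<le> 2 * Hm1_norm \<Omega> (w t) * H1_norm \<Omega> (u t)"
        using Hm1_norm_nonneg[OF \<Omega> elim(2)] H1_norm_nonneg[of \<Omega> "u t"] by simp
      also have "\<dots> \<le> (Hm1_norm \<Omega> (w t))\<^sup>2 + (H1_norm \<Omega> (u t))\<^sup>2" by (rule sum_squares_bound)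
      finally show ?case by simp
    qed
  qed
qed

text \<open>The indicator differs from a Urysohn function \<open>g\<close> between a closed inner
  and an open outer set only on a set \<open>N\<close> of small measure. Uniform continuity of
  \<open>g\<close> on the time interval gives \<delta>, and \<open>e\<close> is the indicator of
  \<open>N\<close>, which pays for each of the two times that falls into it.\<close>

lemma indicator_modulus:
  fixes A :: "real set" and \<epsilon> T :: real
  assumes A: "A \<in> sets lebesgue" and \<epsilon>: "0 < \<epsilon>"
  shows "\<exists>e \<delta>. integrable (lebesgue_on {0..T}) e \<and> (\<forall>t. 0 \<le> e t) \<and> (\<integral>t. e t \<partial>lebesgue_on {0..T}) \<le> \<epsilon> \<and> 0 < \<delta> \<and>
    (\<forall>s\<in>{0..T}. \<forall>t\<in>{0..T}. \<bar>s - t\<bar> < \<delta> \<longrightarrow> \<bar>indicat_real A s - indicat_real A t\<bar> \<le> e s + e t + \<epsilon>)"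
proof -
  obtain U where U: "open U" "A \<subseteq> U" "U - A \<in> lmeasurable" "emeasure lebesgue (U - A) < ennreal (\<epsilon> / 2)"
    using sets_lebesgue_outer_open[OF A, of "\<epsilon> / 2"] \<epsilon> by auto
  obtain C where C: "closed C" "C \<subseteq> A" "A - C \<in> lmeasurable" "emeasure lebesgue (A - C) < ennreal (\<epsilon> / 2)"
    using sets_lebesgue_inner_closed[OF A, of "\<epsilon> / 2"] \<epsilon> by auto
  define N where "N = (U - A) \<union> (A - C)"
  have N: "N \<in> lmeasurable" unfolding N_def using U C by (intro fmeasurable.Un) auto
  have "measure lebesgue N \<le> measure lebesgue (U - A) + measure lebesgue (A - C)"
    unfolding N_def using U C by (intro measure_Un_le) auto
  moreover have "measure lebesgue (U - A) < \<epsilon> / 2" "measure lebesgue (A - C) < \<epsilon> / 2"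
    using U(3,4) C(3,4) \<epsilon> by (auto simp: emeasure_eq_measure2 ennreal_less_iff)
  ultimately have mN: "measure lebesgue N < \<epsilon>" by linarith
  have iN: "integrable lebesgue (indicator N :: real \<Rightarrow> real)"
    using N by (auto simp: fmeasurable_def)
  have "C \<inter> - U = {}" using U(2) C(2) by auto
  then obtain g :: "real \<Rightarrow> real" where g: "continuous_on UNIV g" "\<And>x. g x \<in> closed_segment 1 0"
      "\<And>x. x \<in> C \<Longrightarrow> g x = 1" "\<And>x. x \<in> - U \<Longrightarrow> g x = 0"
    using Urysohn[OF C(1) closed_Compl[OF U(1)], of 1 "0::real"] by metis
  have g01: "0 \<le> g x" "g x \<le> 1" for x using g(2)[of x] by (auto simp: closed_segment_eq_real_ivl)
  have ag: "\<bar>indicator A x - g x\<bar> \<le> indicator N x" for x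
    using g01[of x] g(3,4)[of x] U(2) C(2) unfolding N_def by (auto simp: indicator_def)
  have "uniformly_continuous_on {0..T} g"
    using g(1) continuous_on_subset by (intro compact_uniformly_continuous) auto
  then obtain \<delta> where \<delta>: "0 < \<delta>" "\<And>s t. s \<in> {0..T} \<Longrightarrow> t \<in> {0..T} \<Longrightarrow> \<bar>s - t\<bar> < \<delta> \<Longrightarrow> \<bar>g s - g t\<bar> < \<epsilon>"
    unfolding uniformly_continuous_on_def dist_real_def using \<epsilon> by metis
  have 1: "integrable (lebesgue_on {0..T}) (indicator N :: real \<Rightarrow> real)"
    using iN by (rule integrable_restrict_lebesgue_on) simp
  have 2: "(\<integral>t. indicat_real N t \<partial>lebesgue_on {0..T}) \<le> \<epsilon>"
  proof -
    have "(\<integral>t. indicat_real N t \<partial>lebesgue_on {0..T}) = (\<integral>t. indicator {0..T} t *\<^sub>R indicat_real N t \<partial>lebesgue)"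
      by (subst integral_restrict_space) auto
    also have "\<dots> \<le> (\<integral>t. indicat_real N t \<partial>lebesgue)"
    proof (rule integral_mono)
      show "integrable lebesgue (\<lambda>t. indicator {0..T} t *\<^sub>R indicat_real N t)"
        using integrable_mult_indicator[OF _ iN, of "{0..T}"] by simp
    qed (rule iN, simp add: mult_left_le_one_le)
    also have "\<dots> = measure lebesgue N" using N by simp
    finally show ?thesis using mN by simp
  qed
  have 3: "\<bar>indicat_real A s - indicat_real A t\<bar> \<le> indicator N s + indicator N t + \<epsilon>"
    if "s \<in> {0..T}" "t \<in> {0..T}" "\<bar>s - t\<bar> < \<delta>" for s t
    using ag[of s] ag[of t] \<delta>(2)[OF that] by linarith
  show ?thesis using 1 2 3 \<delta>(1) by (intro exI[of _ "indicator N"] exI[of _ \<delta>]) auto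
qed

text \<open>\<open>u\<close> is close in the mean to one simple function, and the finitely many
  level sets of that function are handled by \<open>indicator_modulus\<close>. \<open>E\<close>
  combines the squared distance to the simple function with the error functions of the level
  sets.\<close>

lemma H1_modulus:
  fixes u :: "real \<Rightarrow> 'a::euclidean_space \<Rightarrow> real"
  assumes \<Omega>: "open \<Omega>" and u: "u \<in> L2_time T (H10 \<Omega>) (H1_norm \<Omega>)" and \<epsilon>: "0 < \<epsilon>"
  shows "\<exists>E \<delta>. integrable (lebesgue_on {0..T}) E \<and> (\<forall>t. 0 \<le> E t) \<and> (\<integral>t. E t \<partial>lebesgue_on {0..T}) < \<epsilon> \<and> 0 < \<delta> \<and>
    (\<forall>s\<in>{0..T}. \<forall>t\<in>{0..T}. u s \<in> H10 \<Omega> \<longrightarrow> u t \<in> H10 \<Omega> \<longrightarrow> \<bar>s - t\<bar> < \<delta> \<longrightarrow>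
      (H1_norm \<Omega> (\<lambda>x. u s x - u t x))\<^sup>2 \<le> E s + E t + \<epsilon>)"
proof -
  let ?M = "lebesgue_on {0..T}"
  have us: "strongly_measurable T (H10 \<Omega>) (H1_norm \<Omega>) u" and ui: "integrable ?M (\<lambda>t. (H1_norm \<Omega> (u t))\<^sup>2)"
    using u unfolding L2_time_def by auto
  obtain s where s: "\<And>n. simple_function ?M (s n)" "\<And>n. s n ` {0..T} \<subseteq> H10 \<Omega>"
      "AE t in ?M. (\<lambda>n. H1_norm \<Omega> (s n t - u t)) \<longlonglongrightarrow> 0"
    and uH: "AE t in ?M. u t \<in> H10 \<Omega>"
    using us unfolding strongly_measurable_def by blast
  have um[measurable]: "(\<lambda>t. H1_norm \<Omega> (u t)) \<in> borel_measurable ?M"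
    using measurable_compose[OF borel_measurable_integrable[OF ui] borel_measurable_sqrt] by (simp add: H1_norm_nonneg)
  \<comment> \<open>Strong measurability provides no dominating function. Replacing values of norm
    more than twice that of \<open>u t\<close> by 0 keeps the functions simple and bounds the
    distance to \<open>u t\<close> by three times its norm.\<close>
  define p where "p n t = (if H1_norm \<Omega> (s n t) \<le> 2 * H1_norm \<Omega> (u t) then s n t else (\<lambda>x. 0))" for n t
  have ps: "simple_function ?M (p n)" for n
    unfolding p_def[abs_def]
  proof (rule simple_function_If[OF s(1) simple_function_const])
    have [measurable]: "(\<lambda>t. H1_norm \<Omega> (s n t)) \<in> borel_measurable ?M"
      using simple_function_compose1[OF s(1)] by (rule borel_measurable_simple_function)
    show "{t \<in> space ?M. H1_norm \<Omega> (s n t) \<le> 2 * H1_norm \<Omega> (u t)} \<in> sets ?M" by measurable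
  qed
  have pH: "p n t \<in> H1 \<Omega>" if "t \<in> {0..T}" for n t
  proof -
    have "s n t \<in> H1 \<Omega>" using s(2)[of n] that H10_H1 by blast
    then show ?thesis by (simp add: p_def zero_H1)
  qed
  define r where "r n t = (H1_norm \<Omega> (\<lambda>x. p n t x - u t x))\<^sup>2" for n t
  have rm[measurable]: "r n \<in> borel_measurable ?M" for n
    unfolding r_def[abs_def] using pH by (intro borel_measurable_power H1_distance_measurable[OF \<Omega> us ps]) auto
  have T: "AE t in ?M. t \<in> {0..T}" by (rule AE_I2) simp
  have rb: "AE t in ?M. norm (r n t) \<le> 9 * (H1_norm \<Omega> (u t))\<^sup>2" for n
    using uH T
  proof eventually_elim
    case (elim t)
    have "H1_norm \<Omega> (\<lambda>x. p n t x - u t x) \<le> H1_norm \<Omega> (\<lambda>x. p n t x - 0) + H1_norm \<Omega> (\<lambda>x. 0 - u t x)"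
      using H1_norm_triangle_diff[OF \<Omega> pH[OF elim(2)] zero_H1 H10_H1[OF elim(1)]] .
    also have "\<dots> = H1_norm \<Omega> (p n t) + H1_norm \<Omega> (u t)"
      using H1_norm_minus_commute[OF \<Omega> zero_H1 H10_H1[OF elim(1)]] by simp
    also have "\<dots> \<le> 3 * H1_norm \<Omega> (u t)"
      using H1_norm_nonneg[of \<Omega> "u t"] H1_norm_zero[OF \<Omega>] unfolding p_def by auto
    finally have "(H1_norm \<Omega> (\<lambda>x. p n t x - u t x))\<^sup>2 \<le> (3 * H1_norm \<Omega> (u t))\<^sup>2"
      by (intro power_mono H1_norm_nonneg)
    then show ?case by (simp add: r_def power_mult_distrib)
  qed
  have rball: "AE t in ?M. \<forall>n. norm (r n t) \<le> 9 * (H1_norm \<Omega> (u t))\<^sup>2"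
    unfolding AE_all_countable using rb by blast
  have rint: "integrable ?M (r n)" for n
  proof (rule Bochner_Integration.integrable_bound[OF _ rm])
    show "integrable ?M (\<lambda>t. 9 * (H1_norm \<Omega> (u t))\<^sup>2)" using ui by simp
    show "AE t in ?M. norm (r n t) \<le> norm (9 * (H1_norm \<Omega> (u t))\<^sup>2)" using rb by simp
  qed
  have "(\<lambda>n. \<integral>t. r n t \<partial>?M) \<longlonglongrightarrow> (\<integral>t. 0 \<partial>?M)"
  proof (rule integral_dominated_convergence[OF _ rm _ _ rb])
    show "integrable ?M (\<lambda>t. 9 * (H1_norm \<Omega> (u t))\<^sup>2)" using ui by simp
    show "AE t in ?M. (\<lambda>n. r n t) \<longlonglongrightarrow> 0"
      using uH T s(3) rball
    proof eventually_elim
      case (elim t)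
      show ?case
      \<comment> \<open>Where \<open>u t\<close> has norm zero the dominating bound is itself zero;
        elsewhere the replacement by 0 eventually does not occur.\<close>
      proof (cases "H1_norm \<Omega> (u t) = 0")
        case True
        have "r n t = 0" for n using elim(4) True zero_le_power2[of "H1_norm \<Omega> (\<lambda>x. p n t x - u t x)"] by (simp add: r_def)
        then show ?thesis by simp
      next
        case False
        then have pos: "0 < H1_norm \<Omega> (u t)" using H1_norm_nonneg[of \<Omega> "u t"] by linarith
        have "\<forall>\<^sub>F n in sequentially. H1_norm \<Omega> (s n t - u t) < H1_norm \<Omega> (u t)"
          using order_tendstoD(2)[OF elim(3) pos] .
        then have "\<forall>\<^sub>F n in sequentially. (H1_norm \<Omega> (s n t - u t))\<^sup>2 = r n t"
        proof eventually_elim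
          case (elim n)
          have sn: "s n t \<in> H1 \<Omega>" "u t \<in> H1 \<Omega>" using s(2)[of n] \<open>t \<in> {0..T}\<close> \<open>u t \<in> H10 \<Omega>\<close> H10_H1 by blast+
          have "H1_norm \<Omega> (s n t) \<le> 2 * H1_norm \<Omega> (u t)"
            using H1_norm_le_diff[OF \<Omega> sn] elim unfolding fun_diff_def[of "s n t" "u t"] by linarith
          then show ?case by (simp add: r_def p_def fun_diff_def[of "s n t" "u t"])
        qed
        moreover have "(\<lambda>n. (H1_norm \<Omega> (s n t - u t))\<^sup>2) \<longlonglongrightarrow> 0"
          using tendsto_power[OF elim(3), of 2] by simp
        ultimately show ?thesis by (rule Lim_transform_eventually[rotated])
      qed
    qed
  qed simp
  then have "\<forall>\<^sub>F n in sequentially. (\<integral>t. r n t \<partial>?M) < \<epsilon> / 6"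
    using order_tendstoD(2)[of _ 0 sequentially "\<epsilon> / 6"] \<epsilon> by simp
  then obtain n where n: "(\<integral>t. r n t \<partial>?M) < \<epsilon> / 6" by (auto simp: eventually_sequentially)
  define C where "C = p n ` {0..T}"
  have C: "finite C" using simple_functionD(1)[OF ps[of n]] by (simp add: C_def)
  \<comment> \<open>\<open>K\<close> dominates every squared distance between two values of the
    simple function; the summand 1 makes it positive.\<close>
  define K where "K = 1 + (\<Sum>c\<in>C. \<Sum>d\<in>C. (H1_norm \<Omega> (\<lambda>x. c x - d x))\<^sup>2)"
  have K0: "0 < K" unfolding K_def by (intro add_pos_nonneg sum_nonneg) auto
  have K: "(H1_norm \<Omega> (\<lambda>x. c x - d x))\<^sup>2 \<le> K" if "c \<in> C" "d \<in> C" for c d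
  proof -
    have "(H1_norm \<Omega> (\<lambda>x. c x - d x))\<^sup>2 \<le> (\<Sum>d\<in>C. (H1_norm \<Omega> (\<lambda>x. c x - d x))\<^sup>2)"
      using member_le_sum[OF that(2), of "\<lambda>d. (H1_norm \<Omega> (\<lambda>x. c x - d x))\<^sup>2"] C by simp
    also have "\<dots> \<le> (\<Sum>c\<in>C. \<Sum>d\<in>C. (H1_norm \<Omega> (\<lambda>x. c x - d x))\<^sup>2)"
      using member_le_sum[OF that(1), of "\<lambda>c. \<Sum>d\<in>C. (H1_norm \<Omega> (\<lambda>x. c x - d x))\<^sup>2"] C by (simp add: sum_nonneg)
    finally show ?thesis by (simp add: K_def)
  qed
  define A where "A c = {t \<in> {0..T}. p n t = c}" for c
  have Am: "A c \<in> sets lebesgue" for c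
  proof -
    have "p n -` {c} \<inter> space ?M \<in> sets ?M" by (rule simple_functionD(2)[OF ps])
    moreover have "p n -` {c} \<inter> space ?M = A c" unfolding A_def by auto
    ultimately show ?thesis using sets_restrict_space_iff[of "{0..T}" lebesgue "A c"] by simp
  qed
  \<comment> \<open>Half of \<epsilon> goes to the distance from the simple function, already below
    \<epsilon>/6 before the factor 3, and half to the level sets. The factor 3 comes from (a + b +
    c)^2 \<le> 3 (a^2 + b^2 + c^2).\<close>
  define \<eta> where "\<eta> = (\<epsilon> / 6) / (K * (real (card C) + 1))"
  have \<eta>: "0 < \<eta>" using \<epsilon> K0 by (simp add: \<eta>_def)
  have K\<eta>: "3 * (K * (real (card C) * \<eta>)) \<le> \<epsilon> / 2"
  proof -
    have "K * (real (card C) * \<eta>) \<le> K * ((real (card C) + 1) * \<eta>)" using K0 \<eta> by simp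
    also have "\<dots> = \<epsilon> / 6"
    proof -
      have "\<eta> * (K * (real (card C) + 1)) = \<epsilon> / 6"
        by (rule iffD1[OF nonzero_divide_eq_eq \<eta>_def[symmetric], symmetric]) (use K0 in auto)
      then show ?thesis by (simp only: mult_ac)
    qed
    finally show ?thesis by simp
  qed
  obtain e \<delta> where e: "\<And>c. integrable ?M (e c)" "\<And>c t. 0 \<le> e c t" "\<And>c. (\<integral>t. e c t \<partial>?M) \<le> \<eta>" "\<And>c. 0 < \<delta> c"
    "\<And>c s t. s \<in> {0..T} \<Longrightarrow> t \<in> {0..T} \<Longrightarrow> \<bar>s - t\<bar> < \<delta> c \<Longrightarrow> \<bar>indicat_real (A c) s - indicat_real (A c) t\<bar> \<le> e c s + e c t + \<eta>"
    using indicator_modulus[OF Am \<eta>, where T=T] by metis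
  define E where "E t = 3 * r n t + 3 * (K * (\<Sum>c\<in>C. e c t))" for t
  define d where "d = Min (insert 1 (\<delta> ` C))"
  have d0: "0 < d" unfolding d_def using C e(4) by simp
  have dle: "d \<le> \<delta> c" if "c \<in> C" for c unfolding d_def using that C by (intro Min_le) auto
  have 1: "integrable ?M E" unfolding E_def using rint e(1) by auto
  have 2: "0 \<le> E t" for t
    unfolding E_def r_def using e(2) K0 by (intro add_nonneg_nonneg mult_nonneg_nonneg sum_nonneg) auto
  have 3: "(\<integral>t. E t \<partial>?M) < \<epsilon>"
  proof -
    have "(\<integral>t. E t \<partial>?M) = 3 * (\<integral>t. r n t \<partial>?M) + 3 * (K * (\<Sum>c\<in>C. \<integral>t. e c t \<partial>?M))"
      unfolding E_def using rint e(1) by (simp add: Bochner_Integration.integral_sum)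
    also have "\<dots> \<le> 3 * (\<integral>t. r n t \<partial>?M) + 3 * (K * (real (card C) * \<eta>))"
      using K0 e(3) sum_bounded_above[of C "\<lambda>c. \<integral>t. e c t \<partial>?M" \<eta>] by simp
    also have "\<dots> < \<epsilon>" using n K\<eta> by simp
    finally show ?thesis .
  qed
  have 4: "(H1_norm \<Omega> (\<lambda>x. u s x - u t x))\<^sup>2 \<le> E s + E t + \<epsilon>"
    if st: "s \<in> {0..T}" "t \<in> {0..T}" "u s \<in> H10 \<Omega>" "u t \<in> H10 \<Omega>" "\<bar>s - t\<bar> < d" for s t
  proof -
    have h: "u s \<in> H1 \<Omega>" "u t \<in> H1 \<Omega>" "p n s \<in> H1 \<Omega>" "p n t \<in> H1 \<Omega>" using st H10_H1 pH by auto
    let ?a = "H1_norm \<Omega> (\<lambda>x. p n s x - u s x)" and ?b = "H1_norm \<Omega> (\<lambda>x. p n s x - p n t x)"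
      and ?c = "H1_norm \<Omega> (\<lambda>x. p n t x - u t x)"
    have "H1_norm \<Omega> (\<lambda>x. u s x - u t x) \<le> ?a + (?b + ?c)"
      using H1_norm_triangle_diff[OF \<Omega> h(1,3,2)] H1_norm_triangle_diff[OF \<Omega> h(3,4,2)]
        H1_norm_minus_commute[OF \<Omega> h(1,3)] by linarith
    then have "(H1_norm \<Omega> (\<lambda>x. u s x - u t x))\<^sup>2 \<le> (?a + (?b + ?c))\<^sup>2"
      by (intro power_mono H1_norm_nonneg)
    also have "\<dots> \<le> 3 * ?a\<^sup>2 + 3 * ?b\<^sup>2 + 3 * ?c\<^sup>2"
      using sum_squares_bound[of ?a ?b] sum_squares_bound[of ?a ?c] sum_squares_bound[of ?b ?c]
      by (simp add: power2_sum algebra_simps)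
    also have "\<dots> = 3 * r n s + 3 * ?b\<^sup>2 + 3 * r n t" by (simp add: r_def)
    also have "?b\<^sup>2 \<le> K * (\<Sum>c\<in>C. e c s + e c t + \<eta>)"
    proof (cases "p n s = p n t")
      case True
      have "0 \<le> K * (\<Sum>c\<in>C. e c s + e c t + \<eta>)"
        using K0 e(2) \<eta> by (intro mult_nonneg_nonneg sum_nonneg add_nonneg_nonneg) auto
      then show ?thesis using True H1_norm_zero[OF \<Omega>] by simp
    next
      case False
      have c: "p n s \<in> C" "p n t \<in> C" using st by (auto simp: C_def)
      \<comment> \<open>If the simple function has different values at \<open>s\<close> and
        \<open>t\<close>, the indicator of one of its level sets jumps by 1. Hence the sum of the
        moduli is at least 1, and \<open>K\<close> times it covers the distance of the
        values.\<close>
      have "1 = \<bar>indicat_real (A (p n s)) s - indicat_real (A (p n s)) t\<bar>"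
        using False st by (auto simp: A_def indicator_def)
      also have "\<dots> \<le> e (p n s) s + e (p n s) t + \<eta>"
        using dle[OF c(1)] st by (intro e(5)) auto
      also have "\<dots> \<le> (\<Sum>c\<in>C. e c s + e c t + \<eta>)"
        using member_le_sum[OF c(1), of "\<lambda>c. e c s + e c t + \<eta>"] C e(2) \<eta> by (simp add: add_nonneg_nonneg less_imp_le)
      finally have "K * 1 \<le> K * (\<Sum>c\<in>C. e c s + e c t + \<eta>)" using K0 by (intro mult_left_mono) auto
      then show ?thesis using K[OF c] by simp
    qed
    also have "3 * r n s + 3 * (K * (\<Sum>c\<in>C. e c s + e c t + \<eta>)) + 3 * r n t
        = E s + E t + 3 * (K * (real (card C) * \<eta>))"
      by (simp add: E_def sum.distrib distrib_left)
    also have "\<dots> \<le> E s + E t + \<epsilon>" using K\<eta> \<epsilon> by simp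
    finally show ?thesis by simp
  qed
  show ?thesis using 1 2 3 4 d0 by (intro exI[of _ E] exI[of _ d]) auto
qed

subsection \<open>The energy inequality\<close>

lemma C_time_tendsto:
  assumes u: "u \<in> C_time T (L2 \<Omega>) (L2_norm \<Omega>)" and t: "t \<in> {0..T}"
  shows "u t \<in> L2 \<Omega>" "((\<lambda>s. L2_norm \<Omega> (\<lambda>x. u s x - u t x)) \<longlongrightarrow> 0) (at t within {0..T})"
  using u t unfolding C_time_def by (auto simp: fun_diff_def)

lemma C_time_inner_continuous:
  fixes u :: "real \<Rightarrow> 'a::euclidean_space \<Rightarrow> real"
  assumes u: "u \<in> C_time T (L2 \<Omega>) (L2_norm \<Omega>)" and \<phi>: "\<phi> \<in> L2 \<Omega>"
  shows "continuous_on {0..T} (\<lambda>t. L2_inner \<Omega> (u t) \<phi>)"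
  unfolding continuous_on_def
proof
  fix t assume t: "t \<in> {0..T}"
  note ut = C_time_tendsto[OF u t]
  show "((\<lambda>s. L2_inner \<Omega> (u s) \<phi>) \<longlongrightarrow> L2_inner \<Omega> (u t) \<phi>) (at t within {0..T})"
  proof (rule LIM_zero_cancel, rule Lim_null_comparison)
    show "((\<lambda>s. L2_norm \<Omega> (\<lambda>x. u s x - u t x) * L2_norm \<Omega> \<phi>) \<longlongrightarrow> 0) (at t within {0..T})"
      using tendsto_mult[OF ut(2) tendsto_const[of "L2_norm \<Omega> \<phi>"]] by simp
    show "\<forall>\<^sub>F s in at t within {0..T}. norm (L2_inner \<Omega> (u s) \<phi> - L2_inner \<Omega> (u t) \<phi>)
        \<le> L2_norm \<Omega> (\<lambda>x. u s x - u t x) * L2_norm \<Omega> \<phi>"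
      unfolding eventually_at_filter
    proof (intro always_eventually allI impI)
      fix s assume "s \<in> {0..T}"
      note us = C_time_tendsto(1)[OF u this]
      show "norm (L2_inner \<Omega> (u s) \<phi> - L2_inner \<Omega> (u t) \<phi>) \<le> L2_norm \<Omega> (\<lambda>x. u s x - u t x) * L2_norm \<Omega> \<phi>"
        using L2_Cauchy_Schwarz[OF L2_diff[OF us ut(1)] \<phi>] by (simp add: L2_inner_diff us ut(1) \<phi>)
    qed
  qed
qed

lemma L2_norm_le_diff:
  assumes "v \<in> L2 \<Omega>" "w \<in> L2 \<Omega>"
  shows "\<bar>L2_norm \<Omega> v - L2_norm \<Omega> w\<bar> \<le> L2_norm \<Omega> (\<lambda>x. v x - w x)"
  using L2_norm_triangle[OF L2_diff[OF assms] assms(2)] L2_norm_triangle[OF L2_diff[OF assms(2,1)] assms(1)]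
    L2_norm_minus_commute[of \<Omega> v w] by simp

lemma C_time_norm_continuous:
  fixes u :: "real \<Rightarrow> 'a::euclidean_space \<Rightarrow> real"
  assumes u: "u \<in> C_time T (L2 \<Omega>) (L2_norm \<Omega>)"
  shows "continuous_on {0..T} (\<lambda>t. L2_norm \<Omega> (u t))"
  unfolding continuous_on_def
proof
  fix t assume t: "t \<in> {0..T}"
  note ut = C_time_tendsto[OF u t]
  show "((\<lambda>s. L2_norm \<Omega> (u s)) \<longlongrightarrow> L2_norm \<Omega> (u t)) (at t within {0..T})"
  proof (rule LIM_zero_cancel, rule Lim_null_comparison[OF _ ut(2)])
    show "\<forall>\<^sub>F s in at t within {0..T}. norm (L2_norm \<Omega> (u s) - L2_norm \<Omega> (u t)) \<le> L2_norm \<Omega> (\<lambda>x. u s x - u t x)"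
      unfolding eventually_at_filter using L2_norm_le_diff[OF C_time_tendsto(1)[OF u] ut(1)]
      by (intro always_eventually allI impI) simp
  qed
qed

text \<open>The integrated equation is available at interior times only, because test functions in
  time have compact support in the open interval; continuity adds the two ends.\<close>

lemma antimono_extends_to_closure:
  fixes D :: "real \<Rightarrow> real"
  assumes D: "continuous_on {0..T} D" and int: "\<And>a b. 0 < a \<Longrightarrow> a < b \<Longrightarrow> b < T \<Longrightarrow> D b \<le> D a"
    and ab: "0 \<le> a" "a \<le> b" "b \<le> T"
  shows "D b \<le> D a"
proof (cases "a = b")
  case False
  \<comment> \<open>At most a third of the length is cut off on each side, so \<open>a + d n\<close>
    stays strictly left of \<open>b - d n\<close>.\<close>
  define d where "d n = (b - a) * inverse (real (Suc n)) / 3" for n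
  have d: "0 < d n" "d n \<le> (b - a) / 3" for n
  proof -
    have "inverse (real (Suc n)) \<le> 1" by (simp add: field_simps)
    then show "d n \<le> (b - a) / 3"
      using mult_left_le[of "inverse (real (Suc n))" "b - a"] ab unfolding d_def by simp
  qed (use False ab in \<open>simp add: d_def\<close>)
  have "d \<longlonglongrightarrow> (b - a) * 0 / 3"
    unfolding d_def[abs_def] by (intro tendsto_intros LIMSEQ_inverse_real_of_nat) simp
  then have d0: "d \<longlonglongrightarrow> 0" by simp
  have inside: "a + d n \<in> {0..T}" "b - d n \<in> {0..T}" "a + d n < b - d n" for n
    using d[of n] ab False by auto
  have "(\<lambda>n. D (a + d n)) \<longlonglongrightarrow> D a"
  proof (rule continuous_on_tendsto_compose[OF D])
    show "(\<lambda>n. a + d n) \<longlonglongrightarrow> a" using tendsto_add[OF tendsto_const d0, of a] by simp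
  qed (use inside ab in auto)
  moreover have "(\<lambda>n. D (b - d n)) \<longlonglongrightarrow> D b"
  proof (rule continuous_on_tendsto_compose[OF D])
    show "(\<lambda>n. b - d n) \<longlonglongrightarrow> b" using tendsto_diff[OF tendsto_const d0, of b] by simp
  qed (use inside ab in auto)
  moreover have "D (b - d n) \<le> D (a + d n)" for n
    using d[of n] inside(3)[of n] ab by (intro int) auto
  ultimately show ?thesis by (intro LIMSEQ_le) auto
qed simp

lemma energy_inequality:
  fixes u :: "real \<Rightarrow> 'a::euclidean_space \<Rightarrow> real"
  assumes \<Omega>: "open \<Omega>" and T: "0 < T"
    and uC: "u \<in> C_time T (L2 \<Omega>) (L2_norm \<Omega>)" and u: "u \<in> L2_time T (H10 \<Omega>) (H1_norm \<Omega>)"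
    and w: "w \<in> L2_time T (Hm1 \<Omega>) (Hm1_norm \<Omega>)" and d: "has_weak_time_deriv \<Omega> T u w"
    and ab: "0 \<le> a" "a \<le> b" "b \<le> T"
  shows "(L2_norm \<Omega> (u b))\<^sup>2 - (L2_norm \<Omega> (u a))\<^sup>2 \<le> 2 * integral {a..b} (\<lambda>\<tau>. w \<tau> (u \<tau>))"
proof -
  let ?M = "lebesgue_on {0..T}"
  have HK: "f integrable_on {0..T}" "integral {0..T} f = (\<integral>t. f t \<partial>?M)" if "integrable ?M f" for f :: "real \<Rightarrow> real"
    using that integrable_lebesgue_on_iff[of "{0..T}" f] lebesgue_integral_eq_integral[OF that]
      set_lebesgue_integral_eq_integral(1) by auto
  have wu: "(\<lambda>\<tau>. w \<tau> (u \<tau>)) integrable_on {0..T}"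
    by (rule HK(1)[OF pairing_integrable[OF \<Omega> u w]])
  define D where "D t = (L2_norm \<Omega> (u t))\<^sup>2 - 2 * integral {0..t} (\<lambda>\<tau>. w \<tau> (u \<tau>))" for t
  have Dc: "continuous_on {0..T} D"
    unfolding D_def using C_time_norm_continuous[OF uC] indefinite_integral_continuous_1[OF wu]
    by (intro continuous_intros)
  define p where "p t = (Hm1_norm \<Omega> (w t))\<^sup>2" for t
  have p: "p integrable_on {0..T}"
    unfolding p_def using w by (intro HK) (simp add: L2_time_def)
  have combine: "integral {0..t} (\<lambda>\<tau>. w \<tau> (u \<tau>)) - integral {0..s} (\<lambda>\<tau>. w \<tau> (u \<tau>)) = integral {s..t} (\<lambda>\<tau>. w \<tau> (u \<tau>))"
    if "0 \<le> s" "s \<le> t" "t \<le> T" for s t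
  proof -
    have "(\<lambda>\<tau>. w \<tau> (u \<tau>)) integrable_on {0..t}" using wu by (rule integrable_on_subinterval) (use that in auto)
    from Henstock_Kurzweil_Integration.integral_combine[OF that(1,2) this] show ?thesis by linarith
  qed
  have "D b \<le> D a"
  proof (rule antimono_extends_to_closure[OF Dc _ ab])
    fix a b assume ab: "0 < a" "a < b" "b < T"
    show "D b \<le> D a"
    proof (rule antimono_from_random_partitions[OF Dc p _ _ ab])
      show "0 \<le> p t" for t by (simp add: p_def)
      fix \<kappa> \<epsilon> :: real assume \<kappa>: "0 < \<kappa>" and \<epsilon>: "0 < \<epsilon>"
      obtain E \<delta> where E': "integrable ?M E \<and> (\<forall>t. 0 \<le> E t) \<and> (\<integral>t. E t \<partial>?M) < \<epsilon> \<and> 0 < \<delta> \<and>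
          (\<forall>s\<in>{0..T}. \<forall>t\<in>{0..T}. u s \<in> H10 \<Omega> \<longrightarrow> u t \<in> H10 \<Omega> \<longrightarrow> \<bar>s - t\<bar> < \<delta> \<longrightarrow>
            (H1_norm \<Omega> (\<lambda>x. u s x - u t x))\<^sup>2 \<le> E s + E t + \<epsilon>)"
        using H1_modulus[OF \<Omega> u \<epsilon>] by (elim exE)
      then have E: "integrable ?M E" "\<And>t. 0 \<le> E t" "(\<integral>t. E t \<partial>?M) < \<epsilon>" "0 < \<delta>" by auto
      have Eu: "(H1_norm \<Omega> (\<lambda>x. u s x - u t x))\<^sup>2 \<le> E s + E t + \<epsilon>"
        if "s \<in> {0..T}" "t \<in> {0..T}" "u s \<in> H10 \<Omega>" "u t \<in> H10 \<Omega>" "\<bar>s - t\<bar> < \<delta>" for s t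
        using E' that by blast
      have "AE t in ?M. u t \<in> H10 \<Omega> \<and> w t \<in> Hm1 \<Omega>"
        using u w unfolding L2_time_def strongly_measurable_def by auto
      then obtain N where N: "negligible N" "\<And>t. t \<in> {0..T} \<Longrightarrow> t \<notin> N \<Longrightarrow> u t \<in> H10 \<Omega> \<and> w t \<in> Hm1 \<Omega>"
        by (rule AE_lebesgue_on_negligible) auto
      have "D t - D s \<le> \<kappa> * integral {s..t} p + (integral {s..t} E + (t - s) * (E t + \<epsilon>)) / \<kappa>"
        if st: "0 < s" "s < t" "t < T" "t < s + \<delta>" "s \<notin> N" "t \<notin> N" for s t
      proof -
        have ut: "u t \<in> H10 \<Omega>" and us: "u s \<in> H10 \<Omega>" using N(2)[of s] N(2)[of t] st by auto
        have L: "u t \<in> L2 \<Omega>" "u s \<in> L2 \<Omega>" using ut us H10_H1 H1_L2 by blast+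
        have sub: "{s..t} \<subseteq> {0..T}" using st by auto
        have c: "(\<lambda>t. u t0) \<in> L2_time T (H10 \<Omega>) (H1_norm \<Omega>)" if "u t0 \<in> H10 \<Omega>" for t0
          using L2_time_const[OF \<Omega> that] .
        have i1: "integrable ?M (\<lambda>\<tau>. w \<tau> (u t))" by (rule pairing_integrable[OF \<Omega> c[OF ut] w])
        have ftc: "L2_inner \<Omega> (u t) (u t) - L2_inner \<Omega> (u s) (u t) = integral {s..t} (\<lambda>\<tau>. w \<tau> (u t))"
        proof (rule weak_deriv_imp_integral[OF C_time_inner_continuous[OF uC L(1)] i1])
          fix \<eta> assume "\<eta> \<in> test_functions {0<..<T}"
          then show "(\<integral>\<tau>. L2_inner \<Omega> (u \<tau>) (u t) * deriv \<eta> \<tau> \<partial>?M) = - (\<integral>\<tau>. w \<tau> (u t) * \<eta> \<tau> \<partial>?M)"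
            using d H10_H1[OF ut] unfolding has_weak_time_deriv_def by blast
        qed (use st in auto)
        have "0 \<le> (L2_norm \<Omega> (\<lambda>x. u t x - u s x))\<^sup>2" by simp
        also have "\<dots> = (L2_norm \<Omega> (u t))\<^sup>2 - 2 * L2_inner \<Omega> (u s) (u t) + (L2_norm \<Omega> (u s))\<^sup>2"
          using L2_norm_add_square[OF L(1) L2_scale[OF L(2), of "-1"]] L2_norm_scale[of \<Omega> "-1" "u s"]
            L2_inner_scale[of \<Omega> "-1" "u s" "u t"] L2_inner_commute[of \<Omega> "u t"] by simp
        finally have "(L2_norm \<Omega> (u t))\<^sup>2 - (L2_norm \<Omega> (u s))\<^sup>2
            \<le> 2 * (L2_inner \<Omega> (u t) (u t) - L2_inner \<Omega> (u s) (u t))"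
          by (simp add: L2_norm_square)
        then have "D t - D s \<le> 2 * integral {s..t} (\<lambda>\<tau>. w \<tau> (u t)) - 2 * integral {s..t} (\<lambda>\<tau>. w \<tau> (u \<tau>))"
          unfolding ftc using combine[of s t] st unfolding D_def by simp
        also have "\<dots> = integral {s..t} (\<lambda>\<tau>. 2 * (w \<tau> (u t) - w \<tau> (u \<tau>)))"
          using integrable_on_subinterval[OF HK(1)[OF i1] sub] integrable_on_subinterval[OF wu sub]
          by (simp add: Henstock_Kurzweil_Integration.integral_diff)
        also have "\<dots> \<le> integral {s..t} (\<lambda>\<tau>. \<kappa> * p \<tau> + (E \<tau> + (E t + \<epsilon>)) / \<kappa>)"
        proof -
          define f where "f \<tau> = 2 * (w \<tau> (u t) - w \<tau> (u \<tau>))" for \<tau>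
          define g where "g \<tau> = \<kappa> * p \<tau> + (E \<tau> + (E t + \<epsilon>)) / \<kappa>" for \<tau>
          \<comment> \<open>On the null set the integrand is replaced by the bound \<open>g\<close>,
            so that the comparison holds at every time.\<close>
          define f' where "f' \<tau> = (if \<tau> \<in> N then g \<tau> else f \<tau>)" for \<tau>
          have fi: "f integrable_on {s..t}"
            unfolding f_def using integrable_on_subinterval[OF HK(1)[OF i1] sub] integrable_on_subinterval[OF wu sub]
            by (intro integrable_on_mult_right integrable_diff)
          have gi: "g integrable_on {s..t}"
            unfolding g_def divide_inverse
            using integrable_on_subinterval[OF p sub] integrable_on_subinterval[OF HK(1)[OF E(1)] sub]
            by (intro integrable_add integrable_on_mult_right integrable_on_mult_left integrable_const_ivl)
          have f'i: "f' integrable_on {s..t}" "integral {s..t} f' = integral {s..t} f"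
            using integrable_spike[OF fi N(1), of f'] integral_spike[OF N(1), of "{s..t}" f f'] by (auto simp: f'_def)
          have "integral {s..t} f' \<le> integral {s..t} g"
          proof (rule integral_le[OF f'i(1) gi])
            fix \<tau> assume \<tau>: "\<tau> \<in> {s..t}"
            show "f' \<tau> \<le> g \<tau>"
            proof (cases "\<tau> \<in> N")
              case False
              have good: "u \<tau> \<in> H10 \<Omega>" "w \<tau> \<in> Hm1 \<Omega>" using N(2)[of \<tau>] \<tau> sub False by auto
              let ?P = "Hm1_norm \<Omega> (w \<tau>)" and ?d = "H1_norm \<Omega> (\<lambda>x. u t x - u \<tau> x)"
              have "f \<tau> = 2 * w \<tau> (\<lambda>x. u t x - u \<tau> x)"
                unfolding f_def Hm1_diff[OF \<Omega> good(2) H10_H1[OF ut] H10_H1[OF good(1)]] ..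
              then have "f \<tau> \<le> 2 * (?P * ?d)"
                using Hm1_bound[OF \<Omega> good(2) H1_diff[OF \<Omega> H10_H1[OF ut] H10_H1[OF good(1)]]] by simp
              \<comment> \<open>Young's inequality; \<open>sqrt \<kappa>\<close> is moved between
                the factors so that the squared dual norm receives the weight \<kappa> and the
                squared distance its inverse.\<close>
              also have "2 * (?P * ?d) = 2 * (sqrt \<kappa> * ?P) * (?d / sqrt \<kappa>)" using \<kappa> by simp
              also have "\<dots> \<le> (sqrt \<kappa> * ?P)\<^sup>2 + (?d / sqrt \<kappa>)\<^sup>2" by (rule sum_squares_bound)
              also have "\<dots> = \<kappa> * p \<tau> + ?d\<^sup>2 / \<kappa>" using \<kappa> by (simp add: p_def power_mult_distrib power_divide)
              also have "?d\<^sup>2 \<le> E t + E \<tau> + \<epsilon>"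
                using Eu[of t \<tau>] ut good(1) \<tau> st by auto
              finally have "f \<tau> \<le> \<kappa> * p \<tau> + (E t + E \<tau> + \<epsilon>) / \<kappa>" using \<kappa> by (simp add: divide_right_mono)
              then show ?thesis using False by (simp add: f'_def g_def add_ac)
            qed (simp add: f'_def)
          qed
          then show ?thesis unfolding f'i(2) unfolding f_def g_def .
        qed
        also have "\<dots> = \<kappa> * integral {s..t} p + (integral {s..t} E + (t - s) * (E t + \<epsilon>)) / \<kappa>"
        proof -
          have pi: "p integrable_on {s..t}" and Ei: "E integrable_on {s..t}"
            using integrable_on_subinterval[OF p sub] integrable_on_subinterval[OF HK(1)[OF E(1)] sub] by auto
          have "((\<lambda>\<tau>. \<kappa> * p \<tau> + (E \<tau> + (E t + \<epsilon>)) / \<kappa>) has_integral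
              \<kappa> * integral {s..t} p + (integral {s..t} E + (t - s) * (E t + \<epsilon>)) / \<kappa>) {s..t}"
            using has_integral_const_real[of "E t + \<epsilon>" s t] st
            by (intro has_integral_add has_integral_mult_right has_integral_divide integrable_integral pi Ei) simp
          then show ?thesis by (rule integral_unique)
        qed
        finally show ?thesis .
      qed
      then show "\<exists>E \<delta> N. E integrable_on {0..T} \<and> (\<forall>t. 0 \<le> E t) \<and> integral {0..T} E < \<epsilon>
        \<and> 0 < \<delta> \<and> negligible N \<and> (\<forall>s t. 0 < s \<longrightarrow> s < t \<longrightarrow> t < T \<longrightarrow> t < s + \<delta> \<longrightarrow> s \<notin> N \<longrightarrow> t \<notin> N \<longrightarrow>
          D t - D s \<le> \<kappa> * integral {s..t} p + (integral {s..t} E + (t - s) * (E t + \<epsilon>)) / \<kappa>)"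
        using HK[OF E(1)] E N(1) by (intro exI[of _ E] exI[of _ \<delta>] exI[of _ N]) auto
    qed
  qed
  then show ?thesis using combine[OF ab] unfolding D_def by linarith
qed

subsection \<open>The decay estimate\<close>

text \<open>At a time where \<open>u\<close> vanishes both sides of the mean value identity are
  zero, so it says nothing about the exponent there. As long as the norm has no zero, integrability
  of the exponent is a conclusion; otherwise it is the condition under which the estimate has a
  meaning, since \<open>integral\<close> has the default value 0.\<close>

theorem theorem2p3:
  fixes \<Omega> :: "(real ^ 'n) set" and \<nu> T :: real and f :: "real \<Rightarrow> real"
    and u0 :: "real ^ 'n \<Rightarrow> real" and u :: "real \<Rightarrow> real ^ 'n \<Rightarrow> real"
    and \<xi> :: "real \<Rightarrow> real ^ 'n"
  assumes "open \<Omega>" and "connected \<Omega>" and "bounded \<Omega>" and "Ck_boundary 1 \<Omega>"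
    and "\<nu> > 0" and "continuous_on UNIV f" and "u0 \<in> H10 \<Omega>" and "T > 0"
    and "weak_solution \<Omega> \<nu> f u0 T u"
    and "mean_value_path \<Omega> f T u \<xi>"
  shows "\<forall>t\<in>{0..T}.
    ((\<forall>s\<in>{0..t}. L2_norm \<Omega> (u s) \<noteq> 0) \<longrightarrow> (\<lambda>\<tau>. f (u \<tau> (\<xi> \<tau>))) integrable_on {0..t}) \<and>
    ((\<lambda>\<tau>. f (u \<tau> (\<xi> \<tau>))) integrable_on {0..t} \<longrightarrow>
       L2_norm \<Omega> (u t) \<le> exp (- integral {0..t} (\<lambda>\<tau>. f (u \<tau> (\<xi> \<tau>)))) * L2_norm \<Omega> u0)"
proof
  fix t assume t: "t \<in> {0..T}"
  let ?M = "lebesgue_on {0..T}"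
  note \<Omega> = \<open>open \<Omega>\<close>
  define y where "y \<tau> = (L2_norm \<Omega> (u \<tau>))\<^sup>2" for \<tau>
  define g where "g \<tau> = f (u \<tau> (\<xi> \<tau>))" for \<tau>
  obtain w where u: "u \<in> C_time T (L2 \<Omega>) (L2_norm \<Omega>)" "u \<in> L2_time T (H10 \<Omega>) (H1_norm \<Omega>)"
    and w: "w \<in> L2_time T (Hm1 \<Omega>) (Hm1_norm \<Omega>)" "has_weak_time_deriv \<Omega> T u w"
    and eq: "\<forall>\<phi>\<in>H10 \<Omega>. AE t in ?M.
           integrable (lebesgue_on \<Omega>) (\<lambda>x. f (u t x) * u t x * \<phi> x) \<and>
           w t \<phi> + \<nu> * L2_inner \<Omega> (wgrad \<Omega> (u t)) (wgrad \<Omega> \<phi>)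
             + L2_inner \<Omega> (\<lambda>x. f (u t x) * u t x) \<phi> = 0"
    and u00: "AE x in lebesgue_on \<Omega>. u 0 x = u0 x"
    using \<open>weak_solution \<Omega> \<nu> f u0 T u\<close> unfolding weak_solution_def by blast
  have mvp: "integrable (lebesgue_on \<Omega>) (\<lambda>x. f (u \<tau> x) * (u \<tau> x)\<^sup>2)"
      "(\<integral>x. f (u \<tau> x) * (u \<tau> x)\<^sup>2 \<partial>lebesgue_on \<Omega>) = g \<tau> * y \<tau>" if "\<tau> \<in> {0..T}" for \<tau>
    using \<open>mean_value_path \<Omega> f T u \<xi>\<close> that unfolding mean_value_path_def g_def y_def L2_norm_square_integral by auto
  have yc: "continuous_on {0..T} y"
    unfolding y_def using C_time_norm_continuous[OF u(1)] by (intro continuous_intros)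
  have "AE \<tau> in ?M. w \<tau> (u \<tau>) + \<nu> * (L2_norm \<Omega> (wgrad \<Omega> (u \<tau>)))\<^sup>2
      + (\<integral>x. f (u \<tau> x) * (u \<tau> x)\<^sup>2 \<partial>lebesgue_on \<Omega>) = 0"
    by (rule weak_form_tested_with_solution[OF \<Omega> \<open>continuous_on UNIV f\<close> u(2) w(1) eq]) (rule mvp(1))
  moreover have "AE \<tau> in ?M. \<tau> \<in> {0..T}" by (rule AE_I2) simp
  ultimately have "AE \<tau> in ?M. w \<tau> (u \<tau>) = - (g \<tau> * y \<tau>) - \<nu> * (L2_norm \<Omega> (wgrad \<Omega> (u \<tau>)))\<^sup>2"
    by eventually_elim (simp add: mvp(2))
  then obtain N where N: "negligible N" "\<And>\<tau>. \<tau> \<in> {0..T} \<Longrightarrow> \<tau> \<notin> N \<Longrightarrow>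
      w \<tau> (u \<tau>) = - (g \<tau> * y \<tau>) - \<nu> * (L2_norm \<Omega> (wgrad \<Omega> (u \<tau>)))\<^sup>2"
    by (rule AE_lebesgue_on_negligible) auto
  have wu: "(\<lambda>\<tau>. w \<tau> (u \<tau>)) absolutely_integrable_on {0..T}"
    using pairing_integrable[OF \<Omega> u(2) w(1)] by (subst (asm) integrable_lebesgue_on_iff) auto
  have "(\<lambda>\<tau>. (H1_norm \<Omega> (u \<tau>))\<^sup>2) absolutely_integrable_on {0..T}"
    using u(2) by (subst integrable_lebesgue_on_iff[symmetric]) (auto simp: L2_time_def)
  \<comment> \<open>The squared norm of the gradient is the squared H^1 norm minus \<open>y\<close>.
    This settles the integrability of the gradient term in time, although \<open>wgrad\<close> is a
    separate choice at each time.\<close>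
  then have grad: "(\<lambda>\<tau>. \<nu> * ((H1_norm \<Omega> (u \<tau>))\<^sup>2 - y \<tau>)) absolutely_integrable_on {0..T}"
    using absolutely_integrable_continuous_real[OF yc] by (intro absolutely_integrable_continuous_mult set_integral_diff) auto
  have "(\<lambda>\<tau>. - w \<tau> (u \<tau>) - \<nu> * ((H1_norm \<Omega> (u \<tau>))\<^sup>2 - y \<tau>)) absolutely_integrable_on {0..T}"
    using absolutely_integrable_continuous_mult[OF wu continuous_on_const[of _ "-1"]] grad by (intro set_integral_diff) simp_all
  \<comment> \<open>The tested equation expresses \<open>g y\<close> through integrable functions of
    time almost everywhere; \<open>g\<close> alone is not determined by it where \<open>y\<close>
    vanishes.\<close>
  then have gy: "(\<lambda>\<tau>. g \<tau> * y \<tau>) absolutely_integrable_on {0..T}"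
    by (rule absolutely_integrable_spike[OF _ N(1)]) (simp add: N(2) H1_norm_def y_def)
  have gyt: "(\<lambda>\<tau>. g \<tau> * y \<tau>) absolutely_integrable_on {0..t}"
    using gy by (rule absolutely_integrable_on_subinterval) (use t in auto)
  have yct: "continuous_on {0..t} y" using yc by (rule continuous_on_subset) (use t in auto)
  have decay: "L2_norm \<Omega> (u t) \<le> exp (- integral {0..t} g) * L2_norm \<Omega> u0" if g: "g integrable_on {0..t}"
  proof -
    have "y t \<le> y 0 * exp (- 2 * integral {0..t} g)"
    proof (rule gronwall_nonneg[OF _ yct _ g gyt])
      fix t1 t2 assume t12: "0 \<le> t1" "t1 \<le> t2" "t2 \<le> t"
      have sub: "{t1..t2} \<subseteq> {0..T}" using t12 t by auto
      have i: "(\<lambda>\<tau>. w \<tau> (u \<tau>)) integrable_on {t1..t2}" "(\<lambda>\<tau>. g \<tau> * y \<tau>) integrable_on {t1..t2}"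
        using integrable_on_subinterval[OF set_lebesgue_integral_eq_integral(1)[OF wu] sub]
          integrable_on_subinterval[OF set_lebesgue_integral_eq_integral(1)[OF gy] sub] by auto
      define h where "h \<tau> = (if \<tau> \<in> N then - (g \<tau> * y \<tau>) else w \<tau> (u \<tau>))" for \<tau>
      have h: "h integrable_on {t1..t2}" "integral {t1..t2} h = integral {t1..t2} (\<lambda>\<tau>. w \<tau> (u \<tau>))"
        using integrable_spike[OF i(1) N(1), of h] integral_spike[OF N(1), of "{t1..t2}" "\<lambda>\<tau>. w \<tau> (u \<tau>)" h]
        by (auto simp: h_def)
      have "y t2 - y t1 \<le> 2 * integral {t1..t2} (\<lambda>\<tau>. w \<tau> (u \<tau>))"
        unfolding y_def using t12 t by (intro energy_inequality[OF \<Omega> \<open>T > 0\<close> u w]) auto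
      \<comment> \<open>The gradient term is discarded here, which is where the sign of \<nu>
        enters.\<close>
      also have "integral {t1..t2} (\<lambda>\<tau>. w \<tau> (u \<tau>)) \<le> integral {t1..t2} (\<lambda>\<tau>. - (g \<tau> * y \<tau>))"
        unfolding h(2)[symmetric]
      proof (rule integral_le[OF h(1)])
        show "(\<lambda>\<tau>. - (g \<tau> * y \<tau>)) integrable_on {t1..t2}" using i(2) by (rule integrable_neg)
        show "h \<tau> \<le> - (g \<tau> * y \<tau>)" if "\<tau> \<in> {t1..t2}" for \<tau>
          using N(2)[of \<tau>] that sub \<open>\<nu> > 0\<close> unfolding h_def by auto
      qed
      finally show "y t2 - y t1 \<le> - 2 * integral {t1..t2} (\<lambda>\<tau>. g \<tau> * y \<tau>)" by simp
    qed (use t in \<open>auto simp: y_def\<close>)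
    also have "\<dots> = (exp (- integral {0..t} g) * L2_norm \<Omega> (u 0))\<^sup>2"
      by (simp add: y_def power_mult_distrib exp_double[symmetric] mult.commute)
    finally have "L2_norm \<Omega> (u t) \<le> exp (- integral {0..t} g) * L2_norm \<Omega> (u 0)"
      unfolding y_def by (rule power2_le_imp_le) (simp add: L2_norm_nonneg)
    moreover have "L2_norm \<Omega> (u 0) = L2_norm \<Omega> u0"
      using C_time_tendsto(1)[OF u(1), of 0] \<open>T > 0\<close> H1_L2[OF H10_H1[OF \<open>u0 \<in> H10 \<Omega>\<close>]] u00
      by (intro L2_norm_AE_cong) auto
    ultimately show ?thesis by simp
  qed
  \<comment> \<open>Here \<open>y\<close> is continuous without zeros on a compact interval, so
    dividing the integrable \<open>g y\<close> by it preserves integrability.\<close>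
  have "g integrable_on {0..t}" if nz: "\<forall>s\<in>{0..t}. L2_norm \<Omega> (u s) \<noteq> 0"
  proof -
    have "g absolutely_integrable_on {0..t}"
      using gyt yct by (rule absolutely_integrable_quotient) (use nz in \<open>auto simp: y_def\<close>)
    then show ?thesis by (rule set_lebesgue_integral_eq_integral(1))
  qed
  with decay show "((\<forall>s\<in>{0..t}. L2_norm \<Omega> (u s) \<noteq> 0) \<longrightarrow> (\<lambda>\<tau>. f (u \<tau> (\<xi> \<tau>))) integrable_on {0..t}) \<and>
    ((\<lambda>\<tau>. f (u \<tau> (\<xi> \<tau>))) integrable_on {0..t} \<longrightarrow>
       L2_norm \<Omega> (u t) \<le> exp (- integral {0..t} (\<lambda>\<tau>. f (u \<tau> (\<xi> \<tau>)))) * L2_norm \<Omega> u0)"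
    unfolding g_def by blast
qed

end
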